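(* There is an absolute constant $C>0$ such that for all integers $m,n \geq 2$, $$\frac{4mn}{33} - C\big(m^{3/2} + n\sqrt{m}\big) \;\leq\; E(m,n) \;\leq\; \frac{(m+2)(n+2)}{6}.$$ In particular, writing $E(n)=E(n,n)$, we have $\frac{4n^2}{33} + o(n^2) \leq E(n) \leq \frac{(n+2)^2}{6}$ as $n\to\infty$.
   Context: For $m,n\in\mathbb{N}$, $G(m,n)$ is the $m\times n$ grid graph with vertex set $[m]\times[n]$ (where $[m]=\{1,\dots,m\}$), two vertices adjacent iff they are at Euclidean distance 1. In 2-neighbour bootstrap percolation, starting from an initially infected set $A\subset V$, a vertex becomes infected once at least $2$ of its neighbours are infected, and infected vertices stay infected forever; $A$ percolates if eventually every vertex is infected. A minimal percolating set (MinPS) is a percolating set $A$ no proper subset of which percolates. $E(m,n)$ is the maximum of $|A|$ over all minimal percolating sets $A$ of $G(m,n)$. *)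

theory Defs
  imports "HOL-Analysis.Analysis" "HOL-Library.Landau_Symbols"
begin

definition grid_verts :: "nat \<Rightarrow> nat \<Rightarrow> (nat \<times> nat) set" where
  "grid_verts m n = {1..m} \<times> {1..n}"

(* The metric on real \<times> real is the Euclidean one. *)
definition grid_adj :: "nat \<times> nat \<Rightarrow> nat \<times> nat \<Rightarrow> bool" where
  "grid_adj u v \<longleftrightarrow>
     dist (real (fst u), real (snd u)) (real (fst v), real (snd v)) = 1"

(* Set of infected vertices after t steps of r-neighbour bootstrap percolation on the
   graph with vertex set V and adjacency relation adj, started from A. *)
primrec infected :: "'a set \<Rightarrow> ('a \<Rightarrow> 'a \<Rightarrow> bool) \<Rightarrow> nat \<Rightarrow> 'a set \<Rightarrow> nat \<Rightarrow> 'a set" where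
  "infected V adj r A 0 = A"
| "infected V adj r A (Suc t) =
     infected V adj r A t
       \<union> {v \<in> V. r \<le> card {u \<in> V. adj v u \<and> u \<in> infected V adj r A t}}"

definition percolates :: "'a set \<Rightarrow> ('a \<Rightarrow> 'a \<Rightarrow> bool) \<Rightarrow> nat \<Rightarrow> 'a set \<Rightarrow> bool" where
  "percolates V adj r A \<longleftrightarrow> A \<subseteq> V \<and> (\<forall>v\<in>V. \<exists>t. v \<in> infected V adj r A t)"

definition min_percolating :: "'a set \<Rightarrow> ('a \<Rightarrow> 'a \<Rightarrow> bool) \<Rightarrow> nat \<Rightarrow> 'a set \<Rightarrow> bool" where
  "min_percolating V adj r A \<longleftrightarrow>
     percolates V adj r A \<and> (\<forall>B. B \<subset> A \<longrightarrow> \<not> percolates V adj r B)"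

definition max_min_percolating :: "nat \<Rightarrow> nat \<Rightarrow> nat" where
  "max_min_percolating m n =
     Max {card A | A. min_percolating (grid_verts m n) grid_adj 2 A}"

lemma grid_adj_iff:
  "grid_adj (a, b) (c, d) \<longleftrightarrow>
     (a = c \<and> (b = Suc d \<or> d = Suc b)) \<or> (b = d \<and> (a = Suc c \<or> c = Suc a))"
proof -
  have sq: "x\<^sup>2 + y\<^sup>2 = 1 \<longleftrightarrow> (x = 0 \<and> (y = 1 \<or> y = -1)) \<or> (y = 0 \<and> (x = 1 \<or> x = -1))"
    for x y :: int
  proof
    assume h: "x\<^sup>2 + y\<^sup>2 = 1"
    have "x\<^sup>2 = 0 \<or> y\<^sup>2 = 0"
    proof (rule ccontr)
      assume "\<not> ?thesis"
      then have "x\<^sup>2 > 0" "y\<^sup>2 > 0" by simp_all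
      with h show False by linarith
    qed
    with h show "(x = 0 \<and> (y = 1 \<or> y = -1)) \<or> (y = 0 \<and> (x = 1 \<or> x = -1))"
      by (auto simp: power2_eq_1_iff)
  qed auto
  have "grid_adj (a, b) (c, d) \<longleftrightarrow> (real a - real c)\<^sup>2 + (real b - real d)\<^sup>2 = 1"
    by (simp add: grid_adj_def dist_Pair_Pair dist_real_def)
  also have "\<dots> \<longleftrightarrow> real_of_int ((int a - int c)\<^sup>2 + (int b - int d)\<^sup>2) = real_of_int 1"
    by simp
  also have "\<dots> \<longleftrightarrow> (int a - int c)\<^sup>2 + (int b - int d)\<^sup>2 = 1"
    by (simp only: of_int_eq_iff)
  finally show ?thesis
    unfolding sq by auto
qed

lemma max_min_percolating_attained:
  "\<exists>A. min_percolating (grid_verts m n) grid_adj 2 A \<and> card A = max_min_percolating m n"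
  and max_min_percolating_upper:
  "min_percolating (grid_verts m n) grid_adj 2 A \<Longrightarrow> card A \<le> max_min_percolating m n"
proof -
  let ?V = "grid_verts m n"
  let ?S = "{card A | A. min_percolating ?V grid_adj 2 A}"
  have "finite ?V" by (simp add: grid_verts_def)
  then have "finite (card ` Pow ?V)" by simp
  moreover have "?S \<subseteq> card ` Pow ?V"
    by (auto simp: min_percolating_def percolates_def)
  ultimately have fin: "finite ?S" by (rule rev_finite_subset)
  have "percolates ?V grid_adj 2 ?V"
    by (auto simp: percolates_def intro: exI[of _ 0])
  moreover have "finite (Collect (percolates ?V grid_adj 2))"
    by (rule finite_subset[of _ "Pow ?V"]) (use \<open>finite ?V\<close> in \<open>auto simp: percolates_def\<close>)
  ultimately obtain M where "percolates ?V grid_adj 2 M"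
    and "\<forall>B\<in>Collect (percolates ?V grid_adj 2). B \<subseteq> M \<longrightarrow> M = B"
    using finite_has_minimal[of "Collect (percolates ?V grid_adj 2)"] by auto
  then have "min_percolating ?V grid_adj 2 M"
    by (auto simp: min_percolating_def)
  then have "?S \<noteq> {}" by blast
  with fin have "Max ?S \<in> ?S" by (rule Max_in)
  then show "\<exists>A. min_percolating ?V grid_adj 2 A \<and> card A = max_min_percolating m n"
    by (auto simp: max_min_percolating_def)
  show "card A \<le> max_min_percolating m n" if "min_percolating ?V grid_adj 2 A"
    unfolding max_min_percolating_def using fin that by (intro Max_ge) auto
qed

end

theory Submission
  imports Defs "HOL-Real_Asymp.Real_Asymp"
begin

text \<open>A finite closed set is a disjoint union of rectangles at pairwise distance at least three, and a
  percolating set is minimal iff no site lies in the closure of the others.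

  Upper bound: to an \<open>a\<close> by \<open>b\<close> rectangle assign the weight \<open>(a + 2) * (b + 2)\<close>, the area of its
  enlargement by one. A minimal set spanning a rectangle splits into \<open>B\<close> and \<open>C\<close> that span
  rectangles within distance two, where no proper subset of \<open>C\<close> comes that close to the rectangle of
  \<open>B\<close>. Either \<open>C\<close> is a single site, or the two rectangles are in diagonal position. In the second case
  two opposite corners of the enlarged hull, of area at least three each, stay uncovered, which pays
  for the 6 that an induction on the number of sites loses; the overlap of the two enlarged
  rectangles is paid for by a stronger estimate for \<open>C\<close>, which holds because its proper subsets avoid
  a quadrant. Rectangles with two or three rows are treated by counting sites in columns.

  Lower bound: a column with two of every three sites spans itself without redundancy, and three more
  sites make it interact with its right-hand neighbours only when it is complete. Such a module
  and its rotated copy form a pair with contacts on either side. Pairs are chained with period 10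
  along a descending staircase, first in twos and then all of these, so that the staircase descends
  by only one row in 20 columns. In a \<open>p\<close> by \<open>q\<close> rectangle with \<open>p \<le> q\<close> this has density about
  \<open>(2 / 15) * (19 / 20) > 4 / 33\<close>, and the construction is padded to the exact size of the
  grid.\<close>

section \<open>Closed sets and rectangles\<close>

definition d1 :: "int \<times> int \<Rightarrow> int \<times> int \<Rightarrow> int" where
  "d1 p q = \<bar>fst p - fst q\<bar> + \<bar>snd p - snd q\<bar>"

definition nclosed :: "(int \<times> int) set \<Rightarrow> bool" where
  "nclosed S \<longleftrightarrow>
     (\<forall>p u v. u \<in> S \<longrightarrow> v \<in> S \<longrightarrow> u \<noteq> v \<longrightarrow> d1 p u = 1 \<longrightarrow> d1 p v = 1 \<longrightarrow> p \<in> S)"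

definition cl :: "(int \<times> int) set \<Rightarrow> (int \<times> int) set" where
  "cl A = \<Inter>{S. A \<subseteq> S \<and> nclosed S}"

definition far :: "(int \<times> int) set \<Rightarrow> (int \<times> int) set \<Rightarrow> bool" where
  "far S T \<longleftrightarrow> (\<forall>p\<in>S. \<forall>q\<in>T. 3 \<le> d1 p q)"

definition rect :: "int \<Rightarrow> int \<Rightarrow> int \<Rightarrow> int \<Rightarrow> (int \<times> int) set" where
  "rect a b c d = {a..b} \<times> {c..d}"

definition indep :: "(int \<times> int) set \<Rightarrow> bool" where
  "indep A \<longleftrightarrow> (\<forall>v\<in>A. v \<notin> cl (A - {v}))"

lemma d1_commute: "d1 p q = d1 q p"
  by (simp add: d1_def abs_minus_commute)

lemma d1_triangle: "d1 p r \<le> d1 p q + d1 q r"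
  by (simp add: d1_def)

lemma d1_Pair [simp]: "d1 (a, b) (c, d) = \<bar>a - c\<bar> + \<bar>b - d\<bar>"
  by (simp add: d1_def)

lemma mem_rect [simp]: "(x, y) \<in> rect a b c d \<longleftrightarrow> a \<le> x \<and> x \<le> b \<and> c \<le> y \<and> y \<le> d"
  by (auto simp: rect_def)

lemma nclosedD:
  "nclosed S \<Longrightarrow> u \<in> S \<Longrightarrow> v \<in> S \<Longrightarrow> u \<noteq> v \<Longrightarrow> d1 p u = 1 \<Longrightarrow> d1 p v = 1 \<Longrightarrow> p \<in> S"
  unfolding nclosed_def by blast

lemma subset_cl: "A \<subseteq> cl A"
  by (auto simp: cl_def)

lemma cl_least: "A \<subseteq> S \<Longrightarrow> nclosed S \<Longrightarrow> cl A \<subseteq> S"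
  by (auto simp: cl_def)

lemma nclosed_cl: "nclosed (cl A)"
  unfolding cl_def nclosed_def by blast

lemma cl_mono: "A \<subseteq> B \<Longrightarrow> cl A \<subseteq> cl B"
  using subset_cl[of B] by (intro cl_least nclosed_cl) blast

lemma cl_subset_cl: "A \<subseteq> cl B \<Longrightarrow> cl A \<subseteq> cl B"
  by (intro cl_least nclosed_cl)

lemma cl_nclosed: "nclosed S \<Longrightarrow> cl S = S"
  using cl_least[of S S] subset_cl[of S] by blast

lemma nclosed_empty [simp]: "nclosed {}"
  by (simp add: nclosed_def)

lemma cl_empty [simp]: "cl {} = {}"
  by (simp add: cl_nclosed)

lemma nclosed_Times:
  assumes I: "\<And>x y z. x \<in> I \<Longrightarrow> z \<in> I \<Longrightarrow> x \<le> y \<Longrightarrow> y \<le> z \<Longrightarrow> y \<in> I"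
    and J: "\<And>x y z. x \<in> J \<Longrightarrow> z \<in> J \<Longrightarrow> x \<le> y \<Longrightarrow> y \<le> z \<Longrightarrow> y \<in> J"
  shows "nclosed (I \<times> J)"
  unfolding nclosed_def
proof (intro allI impI)
  fix p u v
  assume uv: "u \<in> I \<times> J" "v \<in> I \<times> J" "u \<noteq> v" "d1 p u = 1" "d1 p v = 1"
  obtain x y where p: "p = (x, y)" by fastforce
  obtain a b where u: "u = (a, b)" by fastforce
  obtain c d where v: "v = (c, d)" by fastforce
  have 1: "\<bar>x - a\<bar> + \<bar>y - b\<bar> = 1" "\<bar>x - c\<bar> + \<bar>y - d\<bar> = 1" "a \<noteq> c \<or> b \<noteq> d"
    using uv by (auto simp: p u v)
  then have "(x = a \<or> x = c \<or> (a \<le> x \<and> x \<le> c) \<or> (c \<le> x \<and> x \<le> a)) \<and>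
    (y = b \<or> y = d \<or> (b \<le> y \<and> y \<le> d) \<or> (d \<le> y \<and> y \<le> b))"
    by (smt (verit))
  moreover have "a \<in> I" "c \<in> I" "b \<in> J" "d \<in> J" using uv by (auto simp: u v)
  ultimately have "x \<in> I" "y \<in> J" using I J by blast+
  then show "p \<in> I \<times> J" by (simp add: p)
qed

lemma nclosed_rect: "nclosed (rect a b c d)"
  unfolding rect_def by (rule nclosed_Times) auto

lemma nclosed_singleton: "nclosed {p}"
proof -
  have "{p} = rect (fst p) (fst p) (snd p) (snd p)" by (auto simp: rect_def)
  then show ?thesis using nclosed_rect by metis
qed

lemma cl_singleton [simp]: "cl {p} = {p}"
  by (simp add: cl_nclosed nclosed_singleton)

lemma far_commute: "far S T \<longleftrightarrow> far T S"
  unfolding far_def using d1_commute by metis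

lemma far_mono: "far S T \<Longrightarrow> S' \<subseteq> S \<Longrightarrow> T' \<subseteq> T \<Longrightarrow> far S' T'"
  unfolding far_def by blast

lemma far_empty [simp]: "far {} T" "far S {}"
  by (auto simp: far_def)

lemma far_Un [simp]:
  "far (S \<union> T) U \<longleftrightarrow> far S U \<and> far T U" "far U (S \<union> T) \<longleftrightarrow> far U S \<and> far U T"
  by (auto simp: far_def)

lemma far_disjoint: "far S T \<Longrightarrow> S \<inter> T = {}"
  unfolding far_def d1_def by fastforce

lemma nclosed_Un_far:
  assumes "nclosed S" "nclosed T" "far S T"
  shows "nclosed (S \<union> T)"
  unfolding nclosed_def
proof (intro allI impI)
  fix p u v
  assume uv: "u \<in> S \<union> T" "v \<in> S \<union> T" "u \<noteq> v" "d1 p u = 1" "d1 p v = 1"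
  have "d1 u v \<le> 2" using d1_triangle[of u v p] uv d1_commute[of u p] by simp
  then have "\<not> (u \<in> S \<and> v \<in> T)" "\<not> (u \<in> T \<and> v \<in> S)"
    using assms(3) d1_commute[of u v] unfolding far_def by force+
  then show "p \<in> S \<union> T" using uv nclosedD assms(1,2) by blast
qed

lemma nclosed_Union_far:
  assumes "\<And>B. B \<in> F \<Longrightarrow> nclosed B" "\<And>B C. B \<in> F \<Longrightarrow> C \<in> F \<Longrightarrow> B \<noteq> C \<Longrightarrow> far B C"
  shows "nclosed (\<Union>F)"
  unfolding nclosed_def
proof (intro allI impI)
  fix p u v
  assume uv: "u \<in> \<Union>F" "v \<in> \<Union>F" "u \<noteq> v" "d1 p u = 1" "d1 p v = 1"
  then obtain B C where BC: "B \<in> F" "C \<in> F" "u \<in> B" "v \<in> C" by blast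
  have "d1 u v \<le> 2" using d1_triangle[of u v p] uv d1_commute[of u p] by simp
  then have "B = C" using assms(2)[OF BC(1,2)] BC unfolding far_def by force
  then show "p \<in> \<Union>F" using uv BC nclosedD[OF assms(1)[OF BC(1)], of u v p] by blast
qed

lemma d1_isometry_image:
  assumes f: "bij f" "\<And>p q. d1 (f p) (f q) = d1 p q"
  shows nclosed_image: "nclosed (f ` S) \<longleftrightarrow> nclosed S"
    and cl_image: "cl (f ` A) = f ` cl A"
    and far_image: "far (f ` S) (f ` T) \<longleftrightarrow> far S T"
    and indep_image: "indep (f ` A) \<longleftrightarrow> indep A"
proof -
  have inj: "inj f" using f(1) bij_is_inj by blast
  have st: "nclosed (f ` S) \<longleftrightarrow> nclosed S" for S
  proof
    assume s: "nclosed (f ` S)"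
    show "nclosed S" unfolding nclosed_def
    proof (intro allI impI)
      fix p u v
      assume "u \<in> S" "v \<in> S" "u \<noteq> v" "d1 p u = 1" "d1 p v = 1"
      then have "f p \<in> f ` S" using nclosedD[OF s, of "f u" "f v" "f p"] f(2) inj
        by (auto simp: inj_eq)
      then show "p \<in> S" using inj by (simp add: inj_image_mem_iff)
    qed
  next
    assume s: "nclosed S"
    show "nclosed (f ` S)" unfolding nclosed_def
    proof (intro allI impI)
      fix p u v
      assume a: "u \<in> f ` S" "v \<in> f ` S" "u \<noteq> v" "d1 p u = 1" "d1 p v = 1"
      obtain p' where p: "p = f p'" using f(1) by (metis bij_pointE)
      obtain u' v' where "u = f u'" "v = f v'" "u' \<in> S" "v' \<in> S" using a by blast
      then have "p' \<in> S" using nclosedD[OF s, of u' v' p'] a f(2) p by auto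
      then show "p \<in> f ` S" using p by blast
    qed
  qed
  show "nclosed (f ` S) \<longleftrightarrow> nclosed S" by (rule st)
  show clf: "cl (f ` A) = f ` cl A" for A
  proof
    show "cl (f ` A) \<subseteq> f ` cl A"
      using subset_cl[of A] st[of "cl A"] nclosed_cl by (intro cl_least) auto
    have "A \<subseteq> f -` cl (f ` A)" using subset_cl[of "f ` A"] by auto
    moreover have "f ` (f -` cl (f ` A)) = cl (f ` A)"
      using f(1) by (simp add: bij_is_surj surj_image_vimage_eq)
    then have "nclosed (f -` cl (f ` A))" using st[of "f -` cl (f ` A)"] nclosed_cl by simp
    ultimately have "cl A \<subseteq> f -` cl (f ` A)" by (rule cl_least)
    then show "f ` cl A \<subseteq> cl (f ` A)" by auto
  qed
  show "far (f ` S) (f ` T) \<longleftrightarrow> far S T" unfolding far_def using f(2) by auto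
  show "indep (f ` A) \<longleftrightarrow> indep A"
  proof -
    have "f ` A - {f v} = f ` (A - {v})" for v using inj by (auto simp: inj_eq)
    then show ?thesis unfolding indep_def using clf inj by (auto simp: inj_image_mem_iff)
  qed
qed

lemma extend_right:
  assumes T: "nclosed T" and b: "rect a b c d \<subseteq> T" "a \<le> b" and p: "(x, y) \<in> T" "c \<le> y" "y \<le> d"
    and x: "b < x" "x \<le> b + 2"
  shows "rect a x c d \<subseteq> T"
proof -
  have ext: "rect a (b' + 1) c d \<subseteq> T"
    if b': "rect a b' c d \<subseteq> T" "a \<le> b'" and p': "(b' + 1, y) \<in> T" for b'
  proof -
    have up: "(b' + 1, z) \<in> T" if "y \<le> z" "z \<le> d" for z
      using that
    proof (induction z rule: int_ge_induct)
      case (step z)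
      have "(b', z + 1) \<in> T" using b' step p by auto
      moreover have "(b' + 1, z) \<in> T" using step by auto
      ultimately show ?case by (rule nclosedD[OF T]) auto
    qed (use p' in auto)
    have down: "(b' + 1, z) \<in> T" if "z \<le> y" "c \<le> z" for z
      using that
    proof (induction z rule: int_le_induct)
      case (step z)
      have "(b', z - 1) \<in> T" using b' step p by auto
      moreover have "(b' + 1, z) \<in> T" using step by auto
      ultimately show ?case by (rule nclosedD[OF T]) auto
    qed (use p' in auto)
    show ?thesis
    proof
      fix q assume "q \<in> rect a (b' + 1) c d"
      then obtain u v where q: "q = (u, v)" "a \<le> u" "u \<le> b' + 1" "c \<le> v" "v \<le> d"
        by (cases q) auto
      show "q \<in> T"
      proof (cases "u \<le> b'")
        case True then show ?thesis using b' q by auto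
      next
        case False
        then have "u = b' + 1" using q by auto
        then show ?thesis using up[of v] down[of v] q by fastforce
      qed
    qed
  qed
  consider "x = b + 1" | "x = b + 2" using x by linarith
  then show ?thesis
  proof cases
    case 1 then show ?thesis using ext[of b] b p by simp
  next
    case 2
    have "(b, y) \<in> T" using b p by auto
    then have "(b + 1, y) \<in> T" using nclosedD[OF T _ p(1), of "(b, y)"] 2 by auto
    from ext[OF b this] ext[of "b + 1"] b p 2 show ?thesis by (simp add: add.assoc)
  qed
qed

definition flipx :: "int \<times> int \<Rightarrow> int \<times> int" where "flipx p = (- fst p, snd p)"
definition flipy :: "int \<times> int \<Rightarrow> int \<times> int" where "flipy p = (fst p, - snd p)"

lemma flipx_Pair [simp]: "flipx (x, y) = (- x, y)" by (simp add: flipx_def)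
lemma flipy_Pair [simp]: "flipy (x, y) = (x, - y)" by (simp add: flipy_def)

lemma bij_flipx: "bij flipx" by (rule involuntory_imp_bij) (simp add: flipx_def)
lemma bij_flipy: "bij flipy" by (rule involuntory_imp_bij) (simp add: flipy_def)
lemma bij_prod_swap: "bij (prod.swap :: int \<times> int \<Rightarrow> int \<times> int)" by (rule involuntory_imp_bij) simp

lemma d1_flipx: "d1 (flipx p) (flipx q) = d1 p q" by (simp add: d1_def flipx_def)
lemma d1_flipy: "d1 (flipy p) (flipy q) = d1 p q" by (simp add: d1_def flipy_def)
lemma d1_swap: "d1 (prod.swap p) (prod.swap q) = d1 p q" by (simp add: d1_def)

lemma flipx_rect [simp]: "flipx ` rect a b c d = rect (- b) (- a) c d"
proof -
  have "(x, y) \<in> flipx ` rect a b c d" if "(x, y) \<in> rect (- b) (- a) c d" for x y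
    using that by (intro image_eqI[of _ _ "(- x, y)"]) auto
  then show ?thesis by (auto simp: rect_def)
qed

lemma flipy_rect [simp]: "flipy ` rect a b c d = rect a b (- d) (- c)"
proof -
  have "(x, y) \<in> flipy ` rect a b c d" if "(x, y) \<in> rect a b (- d) (- c)" for x y
    using that by (intro image_eqI[of _ _ "(x, - y)"]) auto
  then show ?thesis by (auto simp: rect_def)
qed

lemma swap_rect [simp]: "prod.swap ` rect a b c d = rect c d a b"
  by (auto simp: rect_def)

lemma extend_left:
  assumes T: "nclosed T" and b: "rect a b c d \<subseteq> T" "a \<le> b" and p: "(x, y) \<in> T" "c \<le> y" "y \<le> d"
    and x: "x < a" "a - 2 \<le> x"
  shows "rect x b c d \<subseteq> T"
proof -
  note i = d1_isometry_image[OF bij_flipx d1_flipx]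
  have 1: "nclosed (flipx ` T)" using T i(1) by blast
  have 2: "rect (- b) (- a) c d \<subseteq> flipx ` T" using image_mono[OF b(1), of flipx] by simp
  have 3: "(- x, y) \<in> flipx ` T" using p(1) by force
  have "rect (- b) (- x) c d \<subseteq> flipx ` T"
    by (rule extend_right[OF 1 2 _ 3]) (use b p x in auto)
  then have "flipx ` rect x b c d \<subseteq> flipx ` T" by simp
  then show ?thesis using inj_image_subset_iff[OF bij_is_inj[OF bij_flipx]] by blast
qed

lemma extend_up:
  assumes T: "nclosed T" and b: "rect a b c d \<subseteq> T" "c \<le> d" and p: "(x, y) \<in> T" "a \<le> x" "x \<le> b"
    and y: "d < y" "y \<le> d + 2"
  shows "rect a b c y \<subseteq> T"
proof -
  note i = d1_isometry_image[OF bij_prod_swap d1_swap]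
  have 1: "nclosed (prod.swap ` T)" using T i(1) by blast
  have 2: "rect c d a b \<subseteq> prod.swap ` T" using image_mono[OF b(1), of prod.swap] by simp
  have 3: "(y, x) \<in> prod.swap ` T" using p(1) by force
  have "rect c y a b \<subseteq> prod.swap ` T"
    by (rule extend_right[OF 1 2 _ 3]) (use b p y in auto)
  then have "prod.swap ` rect a b c y \<subseteq> prod.swap ` T" by simp
  then show ?thesis using inj_image_subset_iff[OF bij_is_inj[OF bij_prod_swap]] by blast
qed

lemma extend_down:
  assumes T: "nclosed T" and b: "rect a b c d \<subseteq> T" "c \<le> d" and p: "(x, y) \<in> T" "a \<le> x" "x \<le> b"
    and y: "y < c" "c - 2 \<le> y"
  shows "rect a b y d \<subseteq> T"
proof -
  note i = d1_isometry_image[OF bij_prod_swap d1_swap]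
  have 1: "nclosed (prod.swap ` T)" using T i(1) by blast
  have 2: "rect c d a b \<subseteq> prod.swap ` T" using image_mono[OF b(1), of prod.swap] by simp
  have 3: "(y, x) \<in> prod.swap ` T" using p(1) by force
  have "rect y d a b \<subseteq> prod.swap ` T"
    by (rule extend_left[OF 1 2 _ 3]) (use b p y in auto)
  then have "prod.swap ` rect a b y d \<subseteq> prod.swap ` T" by simp
  then show ?thesis using inj_image_subset_iff[OF bij_is_inj[OF bij_prod_swap]] by blast
qed

lemma nclosed_hull_point:
  assumes T: "nclosed T" and b: "rect a b c d \<subseteq> T" "q \<in> rect a b c d" and p: "(x, y) \<in> T"
    and near: "d1 q (x, y) \<le> 2"
  shows "rect (min a x) (max b x) (min c y) (max d y) \<subseteq> T"
proof -
  obtain u v where q: "q = (u, v)" by fastforce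
  have uv: "a \<le> u" "u \<le> b" "c \<le> v" "v \<le> d" "\<bar>u - x\<bar> + \<bar>v - y\<bar> \<le> 2"
    using b(2) near by (auto simp: q)
  then have ab: "a \<le> b" "c \<le> d" by auto
  have corner: "(b, d) \<in> T" "(b, c) \<in> T" "(a, d) \<in> T" "(a, c) \<in> T" using b ab by auto
  consider (in_x) "a \<le> x" "x \<le> b" | (in_y) "c \<le> y" "y \<le> d"
    | (ru) "x = b + 1" "y = d + 1" | (rd) "x = b + 1" "y = c - 1"
    | (lu) "x = a - 1" "y = d + 1" | (ld) "x = a - 1" "y = c - 1"
    using uv by (smt (verit))
  then show ?thesis
  proof cases
    case in_x
    consider "y < c" | "c \<le> y" "y \<le> d" | "d < y" by linarith
    then show ?thesis
    proof cases
      case 1 then show ?thesis using extend_down[OF T b(1) ab(2) p in_x] uv in_x by auto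
    next
      case 2 then show ?thesis using in_x b by (simp add: min_def max_def)
    next
      case 3 then show ?thesis using extend_up[OF T b(1) ab(2) p in_x] uv in_x by auto
    qed
  next
    case in_y
    consider "x < a" | "a \<le> x" "x \<le> b" | "b < x" by linarith
    then show ?thesis
    proof cases
      case 1 then show ?thesis using extend_left[OF T b(1) ab(1) p in_y] uv in_y by auto
    next
      case 2 then show ?thesis using in_y b by (simp add: min_def max_def)
    next
      case 3 then show ?thesis using extend_right[OF T b(1) ab(1) p in_y] uv in_y by auto
    qed
  next
    case ru
    have "(b + 1, d) \<in> T" using nclosedD[OF T corner(1) p] ru by auto
    from extend_right[OF T b(1) ab(1) this] have 1: "rect a (b + 1) c d \<subseteq> T" using ab by auto
    have "rect a (b + 1) c y \<subseteq> T" by (rule extend_up[OF T 1 ab(2) p]) (use ru ab in auto)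
    then show ?thesis using ru ab by simp
  next
    case rd
    have "(b + 1, c) \<in> T" using nclosedD[OF T corner(2) p] rd by auto
    from extend_right[OF T b(1) ab(1) this] have 1: "rect a (b + 1) c d \<subseteq> T" using ab by auto
    have "rect a (b + 1) y d \<subseteq> T" by (rule extend_down[OF T 1 ab(2) p]) (use rd ab in auto)
    then show ?thesis using rd ab by simp
  next
    case lu
    have "(a - 1, d) \<in> T" using nclosedD[OF T corner(3) p] lu by auto
    from extend_left[OF T b(1) ab(1) this] have 1: "rect (a - 1) b c d \<subseteq> T" using ab by auto
    have "rect (a - 1) b c y \<subseteq> T" by (rule extend_up[OF T 1 ab(2) p]) (use lu ab in auto)
    then show ?thesis using lu ab by simp
  next
    case ld
    have "(a - 1, c) \<in> T" using nclosedD[OF T corner(4) p] ld by auto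
    from extend_left[OF T b(1) ab(1) this] have 1: "rect (a - 1) b c d \<subseteq> T" using ab by auto
    have "rect (a - 1) b y d \<subseteq> T" by (rule extend_down[OF T 1 ab(2) p]) (use ld ab in auto)
    then show ?thesis using ld ab by simp
  qed
qed

lemma nclosed_rect_walk:
  assumes T: "nclosed T" "rect a2 b2 c2 d2 \<subseteq> T" and q: "(u, v) \<in> rect a2 b2 c2 d2"
  shows "rect a b c d \<subseteq> T \<Longrightarrow> (x, y) \<in> rect a b c d \<Longrightarrow> (x, y) \<in> rect a2 b2 c2 d2 \<Longrightarrow>
    \<exists>a' b' c' d'. a' \<le> a \<and> b \<le> b' \<and> c' \<le> c \<and> d \<le> d' \<and> rect a' b' c' d' \<subseteq> T \<and> (u, v) \<in> rect a' b' c' d'"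
proof (induction "nat (\<bar>x - u\<bar> + \<bar>y - v\<bar>)" arbitrary: a b c d x y rule: less_induct)
  case less
  show ?case
  proof (cases "x = u \<and> y = v")
    case True
    then show ?thesis using less.prems by blast
  next
    case False
    obtain x' y' where xy': "\<bar>x' - u\<bar> + \<bar>y' - v\<bar> < \<bar>x - u\<bar> + \<bar>y - v\<bar>"
      "\<bar>x - x'\<bar> + \<bar>y - y'\<bar> = 1" "(x', y') \<in> rect a2 b2 c2 d2"
    proof -
      consider "x < u" | "u < x" | "y < v" | "v < y" using False by linarith
      then show ?thesis
      proof cases
        case 1 then show ?thesis using that[of "x + 1" y] less.prems q by auto
      next
        case 2 then show ?thesis using that[of "x - 1" y] less.prems q by auto
      next
        case 3 then show ?thesis using that[of x "y + 1"] less.prems q by auto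
      next
        case 4 then show ?thesis using that[of x "y - 1"] less.prems q by auto
      qed
    qed
    have b: "rect (min a x') (max b x') (min c y') (max d y') \<subseteq> T"
      by (rule nclosed_hull_point[OF T(1) less.prems(1,2)]) (use T(2) xy' in auto)
    have "(x', y') \<in> rect (min a x') (max b x') (min c y') (max d y')" by simp
    from less.hyps[OF _ b this xy'(3)] xy'
    show ?thesis by fastforce
  qed
qed

lemma nclosed_hull_rect:
  assumes T: "nclosed T" and b: "rect a b c d \<subseteq> T" and b2: "rect a2 b2 c2 d2 \<subseteq> T"
    and near: "\<not> far (rect a b c d) (rect a2 b2 c2 d2)"
  shows "rect (min a a2) (max b b2) (min c c2) (max d d2) \<subseteq> T"
proof -
  obtain q x y where q: "q \<in> rect a b c d" "(x, y) \<in> rect a2 b2 c2 d2" "d1 q (x, y) \<le> 2"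
    using near unfolding far_def by force
  have 1: "rect (min a x) (max b x) (min c y) (max d y) \<subseteq> T"
    by (rule nclosed_hull_point[OF T b q(1)]) (use b2 q in auto)
  have "(a2, c2) \<in> rect a2 b2 c2 d2" using q by auto
  from nclosed_rect_walk[OF T b2 this 1 _ q(2)]
  obtain a' b' c' d' where 2: "a' \<le> min a x" "max b x \<le> b'" "c' \<le> min c y" "max d y \<le> d'"
    "rect a' b' c' d' \<subseteq> T" "(a2, c2) \<in> rect a' b' c' d'"
    by auto
  have "(b2, d2) \<in> rect a2 b2 c2 d2" "(a2, c2) \<in> rect a2 b2 c2 d2" using q by auto
  from nclosed_rect_walk[OF T b2 this(1) 2(5,6) this(2)]
  obtain a3 b3 c3 d3 where 3: "a3 \<le> a'" "b' \<le> b3" "c3 \<le> c'" "d' \<le> d3"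
    "rect a3 b3 c3 d3 \<subseteq> T" "(b2, d2) \<in> rect a3 b3 c3 d3"
    by auto
  have "rect (min a a2) (max b b2) (min c c2) (max d d2) \<subseteq> rect a3 b3 c3 d3"
    using 2 3 by (auto simp: rect_def)
  then show ?thesis using 3(5) by blast
qed

lemma indep_subset: "indep A \<Longrightarrow> B \<subseteq> A \<Longrightarrow> indep B"
  unfolding indep_def using cl_mono[of "B - {v}" "A - {v}" for v] by blast

lemma indepD: "indep A \<Longrightarrow> v \<in> A \<Longrightarrow> B \<subseteq> A \<Longrightarrow> v \<notin> B \<Longrightarrow> v \<notin> cl B"
  unfolding indep_def using cl_mono[of B "A - {v}"] by blast

section \<open>Chains of modules\<close>

abbreviation lenv :: "int \<Rightarrow> int \<Rightarrow> (int \<times> int) set" where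
  "lenv X1 Y1 \<equiv> {..X1 - 2} \<times> {Y1 + 1..}"

abbreviation renv :: "int \<Rightarrow> int \<Rightarrow> (int \<times> int) set" where
  "renv X2 Y2 \<equiv> {X2 + 2..} \<times> {..Y2 - 1}"

abbreviation needed :: "bool \<Rightarrow> bool \<Rightarrow> (int \<times> int) set \<Rightarrow> int \<Rightarrow> int \<Rightarrow> int \<Rightarrow> int \<Rightarrow> int \<times> int \<Rightarrow> bool" where
  "needed lf rf A X1 X2 Y1 Y2 v \<equiv>
     (\<exists>S. nclosed S \<and> S \<subseteq> rect X1 X2 Y1 Y2 \<and> v \<notin> S \<and> A - {v} \<subseteq> S \<and>
          (lf \<longrightarrow> far S (lenv X1 Y1)) \<and> (rf \<longrightarrow> far S (renv X2 Y2)))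
     \<or> (lf \<and> fst v = X1 \<and> A - {v} \<subseteq> {X1 + 1..} \<times> UNIV)
     \<or> (rf \<and> fst v = X2 \<and> A - {v} \<subseteq> {..X2 - 1} \<times> UNIV)"

text \<open>A module spans its rectangle, and without any one of its sites the rest stays so small that
  it interacts neither with the modules to its left, which lie in \<open>lenv\<close>, nor with those to its
  right, which lie in \<open>renv\<close>. The last two disjuncts of \<open>needed\<close> are for the sites whose only
  role is to make contact on one side: without such a site the module may still merge with its
  neighbours on the other side. The flags tell on which sides there are neighbours.\<close>

definition good ::
  "bool \<Rightarrow> bool \<Rightarrow> (int \<times> int) set \<Rightarrow> int \<Rightarrow> int \<Rightarrow> int \<Rightarrow> int \<Rightarrow> bool" where
  "good lf rf A X1 X2 Y1 Y2 \<longleftrightarrow>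
     X1 \<le> X2 \<and> Y1 \<le> Y2 \<and> A \<subseteq> rect X1 X2 Y1 Y2 \<and> rect X1 X2 Y1 Y2 \<subseteq> cl A \<and>
     (\<forall>v\<in>A. needed lf rf A X1 X2 Y1 Y2 v)"

lemma good_cases:
  assumes g: "good lf rf A X1 X2 Y1 Y2" and v: "v \<in> A"
  obtains (B) S where "nclosed S" "S \<subseteq> rect X1 X2 Y1 Y2" "v \<notin> S" "A - {v} \<subseteq> S"
      "lf \<longrightarrow> far S (lenv X1 Y1)" "rf \<longrightarrow> far S (renv X2 Y2)"
    | (L) lf "fst v = X1" "A - {v} \<subseteq> {X1 + 1..} \<times> UNIV"
    | (R) rf "fst v = X2" "A - {v} \<subseteq> {..X2 - 1} \<times> UNIV"
proof -
  have "needed lf rf A X1 X2 Y1 Y2 v"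
    using g v unfolding good_def by (elim conjE) (erule (1) bspec)
  then show thesis
    by (elim disjE exE conjE) (erule B L R; assumption)+
qed

lemma farI: "(\<And>x y u v. (x, y) \<in> S \<Longrightarrow> (u, v) \<in> T \<Longrightarrow> 3 \<le> \<bar>x - u\<bar> + \<bar>y - v\<bar>) \<Longrightarrow> far S T"
  unfolding far_def d1_def by auto

lemma farD: "far S T \<Longrightarrow> (x, y) \<in> S \<Longrightarrow> (u, v) \<in> T \<Longrightarrow> 3 \<le> \<bar>x - u\<bar> + \<bar>y - v\<bar>"
  unfolding far_def d1_def by force

lemma finite_rect: "finite (rect a b c d)"
  by (simp add: rect_def)

theorem good_chain:
  fixes A :: "nat \<Rightarrow> (int \<times> int) set" and X1 X2 Y1 Y2 :: "nat \<Rightarrow> int" and n :: nat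
  assumes n: "0 < n"
    and good: "\<And>i. i \<le> n \<Longrightarrow> good (0 < i) (i < n) (A i) (X1 i) (X2 i) (Y1 i) (Y2 i)"
    and X: "\<And>i. i < n \<Longrightarrow> X1 (Suc i) = X2 i + 2"
    and Y: "\<And>i. i < n \<Longrightarrow> Y1 (Suc i) < Y1 i" "\<And>i. i < n \<Longrightarrow> Y2 (Suc i) < Y2 i"
    and overlap: "\<And>i. i < n \<Longrightarrow> Y1 i \<le> Y2 (Suc i)"
  shows "\<exists>M. good lf rf M (X1 0 - of_bool lf) (X2 n + of_bool rf) (Y1 n - of_bool lf) (Y2 0 + of_bool rf)
    \<and> (\<Sum>i\<le>n. card (A i)) \<le> card M"
proof -
  define U where "U = (\<Union>i\<le>n. A i)"
  define gl where "gl = (X1 0 - 1, Y1 n - 1)"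
  define gr where "gr = (X2 n + 1, Y2 0 + 1)"
  define G where "G = (if lf then {gl} else {}) \<union> (if rf then {gr} else {})"
  let ?R = "rect (X1 0 - of_bool lf) (X2 n + of_bool rf) (Y1 n - of_bool lf) (Y2 0 + of_bool rf)"
  have XY: "X1 i \<le> X2 i" "Y1 i \<le> Y2 i" "A i \<subseteq> rect (X1 i) (X2 i) (Y1 i) (Y2 i)"
    "rect (X1 i) (X2 i) (Y1 i) (Y2 i) \<subseteq> cl (A i)" if "i \<le> n" for i
    using good[OF that] unfolding good_def by auto
  have less: "X2 i + 2 \<le> X1 j \<and> X2 i + 2 \<le> X2 j \<and> X1 i + 2 \<le> X1 j \<and> Y1 j + 1 \<le> Y1 i \<and> Y2 j + 1 \<le> Y2 i"
    if "i < j" "j \<le> n" for i j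
    using that
  proof (induction j)
    case (Suc j)
    show ?case
    proof (cases "i = j")
      case True
      then show ?thesis using X[of j] Y[of j] XY[of j] XY[of "Suc j"] Suc by auto
    next
      case False
      then show ?thesis using Suc X[of j] Y[of j] XY[of j] XY[of "Suc j"] by auto
    qed
  qed simp
  have le: "X1 i \<le> X1 j \<and> X2 i \<le> X2 j \<and> Y1 j \<le> Y1 i \<and> Y2 j \<le> Y2 i" if "i \<le> j" "j \<le> n" for i j
    using less[of i j] that XY[of i] XY[of j] by (cases "i = j") auto
  have n0: "X2 0 + 2 \<le> X1 n" "X1 0 + 2 \<le> X1 n" "X2 0 + 2 \<le> X2 n" "Y1 n + 1 \<le> Y1 0" "Y2 n + 1 \<le> Y2 0"
    "X1 0 \<le> X2 0" "X1 n \<le> X2 n" "Y1 0 \<le> Y2 0" "Y1 n \<le> Y2 n"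
    using less[of 0 n] n XY[of 0] XY[of n] by auto
  have core: "rect (X1 0) (X2 i) (Y1 i) (Y2 0) \<subseteq> cl (\<Union>i\<le>n. A i)" if "i \<le> n" for i
    using that
  proof (induction i)
    case 0
    then show ?case using XY(4)[of 0] cl_mono[of "A 0" "\<Union>i\<le>n. A i"] by fastforce
  next
    case (Suc i)
    have 1: "rect (X1 0) (X2 i) (Y1 i) (Y2 0) \<subseteq> cl (\<Union>i\<le>n. A i)" using Suc by simp
    have 2: "rect (X1 (Suc i)) (X2 (Suc i)) (Y1 (Suc i)) (Y2 (Suc i)) \<subseteq> cl (\<Union>i\<le>n. A i)"
      using XY(4)[OF Suc.prems] cl_mono[of "A (Suc i)" "\<Union>i\<le>n. A i"] Suc.prems by blast
    have o: "Y1 i \<le> Y2 (Suc i)" "Y1 (Suc i) < Y1 i" "Y2 (Suc i) < Y2 i" "X1 (Suc i) = X2 i + 2"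
      using overlap[of i] Y[of i] X[of i] Suc.prems by auto
    have o2: "Y2 (Suc i) < Y2 0" "X1 0 \<le> X2 i" "X1 (Suc i) \<le> X2 (Suc i)" "X2 i \<le> X2 (Suc i)" "Y1 i \<le> Y2 0"
      using le[of 0 "Suc i"] le[of 0 i] XY[of 0] XY[of i] XY[of "Suc i"] less[of 0 "Suc i"] Suc.prems o by auto
    have "(X2 i, Y2 (Suc i)) \<in> rect (X1 0) (X2 i) (Y1 i) (Y2 0)"
      "(X1 (Suc i), Y2 (Suc i)) \<in> rect (X1 (Suc i)) (X2 (Suc i)) (Y1 (Suc i)) (Y2 (Suc i))"
      using o o2 XY[of "Suc i"] Suc.prems by auto
    then have "\<not> far (rect (X1 0) (X2 i) (Y1 i) (Y2 0)) (rect (X1 (Suc i)) (X2 (Suc i)) (Y1 (Suc i)) (Y2 (Suc i)))"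
      using farD o(4) by fastforce
    from nclosed_hull_rect[OF nclosed_cl 1 2 this] show ?case
      using o o2 by (simp add: min_def max_def split: if_splits)
  qed
  have sub: "U \<subseteq> rect (X1 0) (X2 n) (Y1 n) (Y2 0)"
  proof
    fix p assume "p \<in> U"
    then obtain i where i: "i \<le> n" "p \<in> A i" unfolding U_def by blast
    then show "p \<in> rect (X1 0) (X2 n) (Y1 n) (Y2 0)"
      using XY(3)[OF i(1)] le[of 0 i] le[of i n] unfolding rect_def by fastforce
  qed
  have closure: "?R \<subseteq> cl (U \<union> G)"
  proof -
    have 0: "rect (X1 0) (X2 n) (Y1 n) (Y2 0) \<subseteq> cl (U \<union> G)"
      using core[of n] cl_mono[of U "U \<union> G"] unfolding U_def by blast
    have 1: "rect (X1 0 - of_bool lf) (X2 n) (Y1 n - of_bool lf) (Y2 0) \<subseteq> cl (U \<union> G)"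
    proof (cases lf)
      case True
      have "(X1 0 - 1, Y1 n - 1) \<in> cl (U \<union> G)" using subset_cl True by (force simp: G_def gl_def)
      from nclosed_hull_point[OF nclosed_cl 0 _ this, of "(X1 0, Y1 n)"] show ?thesis
        using n0 True by (simp add: min_def max_def split: if_splits)
    qed (use 0 in simp)
    show ?thesis
    proof (cases rf)
      case True
      have "(X2 n + 1, Y2 0 + 1) \<in> cl (U \<union> G)" using subset_cl True by (force simp: G_def gr_def)
      from nclosed_hull_point[OF nclosed_cl 1 _ this, of "(X2 n, Y2 0)"] show ?thesis
        using n0 True by (auto simp: min_def max_def split: if_splits)
    qed (use 1 in simp)
  qed
  have main: "\<exists>S. nclosed S \<and> S \<subseteq> ?R \<and> v \<notin> S \<and> (U \<union> G) - {v} \<subseteq> S \<and>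
         (lf \<longrightarrow> far S (lenv (X1 0 - of_bool lf) (Y1 n - of_bool lf))) \<and>
         (rf \<longrightarrow> far S (renv (X2 n + of_bool rf) (Y2 0 + of_bool rf)))"
    if v: "v \<in> U" for v
  proof -
    obtain D where D: "nclosed D" "v \<notin> D" "U - {v} \<subseteq> D" and
      Dp: "\<And>x y. (x, y) \<in> D \<Longrightarrow> X1 0 \<le> x \<and> x \<le> X2 n \<and> Y1 n \<le> y \<and> y \<le> Y2 0 \<and>
        (X1 0 + 2 \<le> x \<or> Y1 n + 1 \<le> y) \<and> (x \<le> X2 n - 2 \<or> y \<le> Y2 0 - 1)"
    proof -
      obtain i where i: "i \<le> n" "v \<in> A i" using v unfolding U_def by blast
      have v1: "v \<in> rect (X1 i) (X2 i) (Y1 i) (Y2 i)" using XY(3) i by blast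
      define LL where "LL = (if i = 0 then {} else rect (X1 0) (X2 (i - 1)) (Y1 (i - 1)) (Y2 0))"
      define RR where "RR = (if i = n then {} else rect (X1 (i + 1)) (X2 n) (Y1 n) (Y2 (i + 1)))"
      have LLp: "X1 0 \<le> x \<and> x \<le> X1 i - 2 \<and> x \<le> X2 n - 2 \<and> y \<le> Y2 0 \<and> Y1 i + 1 \<le> y \<and> Y1 n + 1 \<le> y"
        if "(x, y) \<in> LL" for x y
        using that less[of "i - 1" i] le[of i n] less[of "i - 1" n] i unfolding LL_def
        by (auto split: if_splits)
      have RRp: "x \<le> X2 n \<and> X2 i + 2 \<le> x \<and> X1 0 + 2 \<le> x \<and> Y1 n \<le> y \<and> y \<le> Y2 i - 1 \<and> y \<le> Y2 0 - 1"
        if "(x, y) \<in> RR" for x y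
        using that less[of i "i + 1"] le[of 0 i] less[of 0 "i + 1"] i unfolding RR_def
        by (auto split: if_splits)
      have cov: "A j \<subseteq> LL \<union> RR" if j: "j \<le> n" "j \<noteq> i" for j
      proof (cases "j < i")
        case True
        then have "j \<le> i - 1" "i - 1 \<le> n" using i by auto
        from le[OF this] have "rect (X1 j) (X2 j) (Y1 j) (Y2 j) \<subseteq> LL"
          unfolding LL_def using True le[of 0 j] i by (auto simp: rect_def)
        then show ?thesis using XY(3)[OF j(1)] by blast
      next
        case False
        then have "i < j" using j by simp
        then have "rect (X1 j) (X2 j) (Y1 j) (Y2 j) \<subseteq> RR"
          unfolding RR_def using le[of "i + 1" j] le[of j n] i j by (auto simp: rect_def)
        then show ?thesis using XY(3)[OF j(1)] by blast
      qed
      have covU: "U - {v} \<subseteq> LL \<union> RR \<union> (A i - {v})"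
        unfolding U_def using cov by blast
      have ncl: "nclosed LL" "nclosed RR" unfolding LL_def RR_def by (auto simp: nclosed_rect)
      have LR: "far LL RR"
        using LLp RRp XY[OF i(1)] by (intro farI) force
      have vLR: "v \<notin> LL" "v \<notin> RR" using v1 LLp RRp by (cases v; fastforce)+
      have i_cases: "X1 0 + 2 \<le> X1 i \<or> i = 0" "X2 i \<le> X2 n - 2 \<or> i = n" "Y1 n + 1 \<le> Y1 i \<or> i = n" "Y2 i \<le> Y2 0 - 1 \<or> i = 0"
        using less[of 0 i] less[of i n] i by force+
      have bnd: "X1 0 \<le> X1 i" "X2 i \<le> X2 n" "Y1 n \<le> Y1 i" "Y2 i \<le> Y2 0"
        using le[of 0 i] le[of i n] i by auto
      show thesis
      proof (cases rule: good_cases[OF good[OF i(1)] i(2)])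
        case (1 S)
        note B = this
        have fL: "far LL S"
        proof (cases "i = 0")
          case False
          have "LL \<subseteq> lenv (X1 i) (Y1 i)" using LLp by fastforce
          then show ?thesis using B(5) False far_mono far_commute by blast
        qed (simp add: LL_def)
        have fR: "far S RR"
        proof (cases "i = n")
          case False
          have "RR \<subseteq> renv (X2 i) (Y2 i)" using RRp by fastforce
          then show ?thesis using B(6) False i far_mono[of S _ S RR] by auto
        qed (simp add: RR_def)
        have Sp: "X1 i \<le> x \<and> x \<le> X2 i \<and> Y1 i \<le> y \<and> y \<le> Y2 i" if "(x, y) \<in> S" for x y
          using B(2) that by auto
        show thesis
        proof (rule that[of "(LL \<union> S) \<union> RR"])
          show "nclosed ((LL \<union> S) \<union> RR)"
            using ncl B(1) fL fR LR by (intro nclosed_Un_far) auto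
          show "v \<notin> LL \<union> S \<union> RR" using vLR B by blast
          show "U - {v} \<subseteq> LL \<union> S \<union> RR" using covU B(4) by blast
          show "X1 0 \<le> x \<and> x \<le> X2 n \<and> Y1 n \<le> y \<and> y \<le> Y2 0 \<and>
            (X1 0 + 2 \<le> x \<or> Y1 n + 1 \<le> y) \<and> (x \<le> X2 n - 2 \<or> y \<le> Y2 0 - 1)"
            if xy: "(x, y) \<in> LL \<union> S \<union> RR" for x y
          proof -
            consider "(x, y) \<in> LL" | "(x, y) \<in> S" | "(x, y) \<in> RR" using xy by blast
            then show ?thesis
            proof cases
              case 1 then show ?thesis using LLp[of x y] n0 by auto
            next
              case 2 then show ?thesis using Sp[of x y] bnd i_cases n by auto
            next
              case 3 then show ?thesis using RRp[of x y] n0 by auto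
            qed
          qed
        qed
      next
        case 2
        note L = this
        define Q where "Q = rect (X1 i + 1) (X2 n) (Y1 n) (Y2 i)"
        have "far LL Q" using LLp by (intro farI) (force simp: Q_def)
        moreover have "v \<notin> Q" using L(2) by (cases v) (auto simp: Q_def)
        moreover have "RR \<subseteq> Q" using RRp le[of i n] XY[OF i(1)] unfolding Q_def by fastforce
        moreover have "A i - {v} \<subseteq> Q"
          using L(3) XY(3)[OF i(1)] bnd unfolding Q_def by (fastforce simp: rect_def)
        moreover have "nclosed Q" by (simp add: Q_def nclosed_rect)
        moreover have "X1 0 \<le> x \<and> x \<le> X2 n \<and> Y1 n \<le> y \<and> y \<le> Y2 0 \<and>
            (X1 0 + 2 \<le> x \<or> Y1 n + 1 \<le> y) \<and> (x \<le> X2 n - 2 \<or> y \<le> Y2 0 - 1)"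
            if xy: "(x, y) \<in> LL \<union> Q" for x y
        proof -
          consider "(x, y) \<in> LL" | "(x, y) \<in> Q" using xy by blast
          then show ?thesis
          proof cases
            case 1 then show ?thesis using LLp[of x y] n0 by auto
          next
            case 2 then show ?thesis using bnd i_cases L unfolding Q_def by auto
          qed
        qed
        ultimately show thesis
          using that[of "LL \<union> Q"] nclosed_Un_far ncl vLR covU by blast
      next
        case 3
        note R = this
        define Q where "Q = rect (X1 0) (X2 i - 1) (Y1 i) (Y2 0)"
        have "far Q RR" using RRp by (intro farI) (force simp: Q_def)
        moreover have "v \<notin> Q" using R(2) by (cases v) (auto simp: Q_def)
        moreover have "LL \<subseteq> Q" using LLp le[of 0 i] XY[OF i(1)] unfolding Q_def by fastforce
        moreover have "A i - {v} \<subseteq> Q"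
          using R(3) XY(3)[OF i(1)] bnd unfolding Q_def by (fastforce simp: rect_def)
        moreover have "nclosed Q" by (simp add: Q_def nclosed_rect)
        moreover have "X1 0 \<le> x \<and> x \<le> X2 n \<and> Y1 n \<le> y \<and> y \<le> Y2 0 \<and>
            (X1 0 + 2 \<le> x \<or> Y1 n + 1 \<le> y) \<and> (x \<le> X2 n - 2 \<or> y \<le> Y2 0 - 1)"
            if xy: "(x, y) \<in> Q \<union> RR" for x y
        proof -
          consider "(x, y) \<in> Q" | "(x, y) \<in> RR" using xy by blast
          then show ?thesis
          proof cases
            case 1 then show ?thesis using bnd i_cases R unfolding Q_def by auto
          next
            case 2 then show ?thesis using RRp[of x y] n0 by auto
          qed
        qed
        ultimately show thesis
          using that[of "Q \<union> RR"] nclosed_Un_far ncl vLR covU by blast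
      qed
    qed
    have v2: "v \<in> rect (X1 0) (X2 n) (Y1 n) (Y2 0)" using sub v by blast
    have vG: "v \<notin> G" using v2 by (auto simp: G_def gl_def gr_def)
    have nG: "nclosed G"
    proof -
      have "far {gl} {gr}" using n0 by (intro farI) (auto simp: gl_def gr_def)
      then show ?thesis unfolding G_def
        using nclosed_Un_far[of "{gl}" "{gr}"] nclosed_singleton by auto
    qed
    have "far D {gl}" "far D {gr}"
      by (intro farI; use Dp in \<open>force simp: gl_def gr_def\<close>)+
    then have fDG: "far D G" unfolding G_def by auto
    have nDG: "nclosed (D \<union> G)" using D nG fDG nclosed_Un_far by blast
    have sDG: "D \<union> G \<subseteq> ?R"
      using Dp n0 by (fastforce simp: G_def gl_def gr_def split: if_splits)
    have f1: "far (D \<union> G) (lenv (X1 0 - of_bool lf) (Y1 n - of_bool lf))" if lf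
      using Dp n0 that by (intro farI) (fastforce simp: G_def gl_def gr_def split: if_splits)
    have f2: "far (D \<union> G) (renv (X2 n + of_bool rf) (Y2 0 + of_bool rf))" if rf
      using Dp n0 that by (intro farI) (fastforce simp: G_def gl_def gr_def split: if_splits)
    show ?thesis
      using nDG sDG f1 f2 D vG by (intro exI[of _ "D \<union> G"]) auto
  qed
  have "G \<subseteq> ?R" using n0 by (auto simp: G_def gl_def gr_def split: if_splits)
  moreover have "rect (X1 0) (X2 n) (Y1 n) (Y2 0) \<subseteq> ?R" by (auto simp: rect_def)
  ultimately have sub': "U \<union> G \<subseteq> ?R" using sub by blast
  have kinds: "(lf \<and> fst v = X1 0 - of_bool lf \<and> (U \<union> G) - {v} \<subseteq> {X1 0 - of_bool lf + 1..} \<times> UNIV)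
        \<or> (rf \<and> fst v = X2 n + of_bool rf \<and> (U \<union> G) - {v} \<subseteq> {..X2 n + of_bool rf - 1} \<times> UNIV)"
    if v: "v \<in> G" for v
  proof -
    consider "v = gl" lf | "v = gr" rf using v by (auto simp: G_def split: if_splits)
    then show ?thesis
    proof cases
      case 1
      then have "(U \<union> G) - {v} \<subseteq> {X1 0 - of_bool lf + 1..} \<times> UNIV"
        using sub n0 unfolding G_def by (fastforce simp: gl_def gr_def rect_def split: if_splits)
      then show ?thesis using 1 by (simp add: gl_def)
    next
      case 2
      then have "(U \<union> G) - {v} \<subseteq> {..X2 n + of_bool rf - 1} \<times> UNIV"
        using sub n0 unfolding G_def by (fastforce simp: gl_def gr_def rect_def split: if_splits)
      then show ?thesis using 2 by (simp add: gr_def)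
    qed
  qed
  have "good lf rf (U \<union> G) (X1 0 - of_bool lf) (X2 n + of_bool rf) (Y1 n - of_bool lf) (Y2 0 + of_bool rf)"
    unfolding good_def
  proof (intro conjI ballI)
    fix v assume "v \<in> U \<union> G"
    then consider "v \<in> U" | "v \<in> G" by blast
    then show "needed lf rf (U \<union> G) (X1 0 - of_bool lf) (X2 n + of_bool rf) (Y1 n - of_bool lf) (Y2 0 + of_bool rf) v"
      by cases (rule disjI1, erule main, rule disjI2, erule kinds)
  qed (use closure sub' n0 in auto)
  moreover have "(\<Sum>i\<le>n. card (A i)) \<le> card (U \<union> G)"
  proof -
    have fin: "finite (A i)" if "i \<le> n" for i
      using XY(3)[OF that] finite_rect finite_subset by blast
    have dis: "A i \<inter> A j = {}" if "i < j" "j \<le> n" for i j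
      using XY(3)[of i] XY(3)[of j] less[OF that] that by (fastforce simp: rect_def)
    have "A i \<inter> A j = {}" if "i \<le> n" "j \<le> n" "i \<noteq> j" for i j
      using dis[of i j] dis[of j i] that by (cases "i < j") auto
    then have "card U = (\<Sum>i\<le>n. card (A i))"
      unfolding U_def using fin by (intro card_UN_disjoint) auto
    moreover have "finite (U \<union> G)" using sub' finite_rect finite_subset by blast
    ultimately show ?thesis using card_mono[of "U \<union> G" U] by simp
  qed
  ultimately show ?thesis by blast
qed

section \<open>Large minimal sets\<close>

lemma goodD:
  assumes "good lf rf A X1 X2 Y1 Y2"
  shows "X1 \<le> X2" "Y1 \<le> Y2" "A \<subseteq> rect X1 X2 Y1 Y2" "rect X1 X2 Y1 Y2 \<subseteq> cl A"
  using assms by (simp_all add: good_def)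

lemma bij_rotate: "bij (\<lambda>(x, y). (a - x, b - y) :: int \<times> int)"
  by (rule involuntory_imp_bij) auto

lemma bij_translate: "bij (\<lambda>(x, y). (x + a, y + b) :: int \<times> int)"
  by (rule bij_betw_byWitness[where f' = "\<lambda>(x, y). (x - a, y - b)"]) auto

lemma good_image:
  fixes f :: "int \<times> int \<Rightarrow> int \<times> int"
  assumes f: "bij f" "\<And>p q. d1 (f p) (f q) = d1 p q"
    and g: "good lf rf A X1 X2 Y1 Y2"
    and R: "f ` rect X1 X2 Y1 Y2 = rect X1' X2' Y1' Y2'" and le: "X1' \<le> X2'" "Y1' \<le> Y2'"
    and env: "lf' \<Longrightarrow> lenv X1' Y1' = f ` E1" "rf' \<Longrightarrow> renv X2' Y2' = f ` E2"
    and E: "\<And>S. (lf \<longrightarrow> far S (lenv X1 Y1)) \<Longrightarrow> (rf \<longrightarrow> far S (renv X2 Y2)) \<Longrightarrow>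
       (lf' \<longrightarrow> far S E1) \<and> (rf' \<longrightarrow> far S E2)"
    and k: "\<And>v. (lf \<and> fst v = X1 \<and> A - {v} \<subseteq> {X1 + 1..} \<times> UNIV)
        \<or> (rf \<and> fst v = X2 \<and> A - {v} \<subseteq> {..X2 - 1} \<times> UNIV) \<Longrightarrow>
       (lf' \<and> fst (f v) = X1' \<and> f ` (A - {v}) \<subseteq> {X1' + 1..} \<times> UNIV)
        \<or> (rf' \<and> fst (f v) = X2' \<and> f ` (A - {v}) \<subseteq> {..X2' - 1} \<times> UNIV)"
  shows "good lf' rf' (f ` A) X1' X2' Y1' Y2'"
proof -
  note i = d1_isometry_image[OF f]
  have inj: "inj f" using f(1) bij_is_inj by blast
  have *: "needed lf' rf' (f ` A) X1' X2' Y1' Y2' (f v)" if v: "v \<in> A" for v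
  proof -
    have fA: "f ` A - {f v} = f ` (A - {v})" using inj by (auto simp: inj_eq)
    show ?thesis
    proof (cases rule: good_cases[OF g v])
      case (1 S)
      note B = this
      have "nclosed (f ` S)" "f ` S \<subseteq> rect X1' X2' Y1' Y2'" "f v \<notin> f ` S" "f ` A - {f v} \<subseteq> f ` S"
        using B(1) i(1) image_mono[OF B(2), of f] R B(3) inj image_mono[OF B(4), of f]
        by (simp_all add: inj_image_mem_iff fA)
      moreover have "(lf' \<longrightarrow> far (f ` S) (f ` E1)) \<and> (rf' \<longrightarrow> far (f ` S) (f ` E2))"
        using E[OF B(5,6)] i(3) by blast
      ultimately show ?thesis by (intro disjI1 exI[of _ "f ` S"]) (simp add: env)
    next
      case 2
      from k[OF disjI1[OF conjI[OF this(1) conjI[OF this(2,3)]]]] show ?thesis unfolding fA by (rule disjI2)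
    next
      case 3
      from k[OF disjI2[OF conjI[OF this(1) conjI[OF this(2,3)]]]] show ?thesis unfolding fA by (rule disjI2)
    qed
  qed
  show ?thesis unfolding good_def
  proof (intro conjI ballI)
    show "f ` A \<subseteq> rect X1' X2' Y1' Y2'" using image_mono[OF goodD(3)[OF g], of f] R by simp
    show "rect X1' X2' Y1' Y2' \<subseteq> cl (f ` A)" using image_mono[OF goodD(4)[OF g], of f] R i(2) by simp
    fix w assume "w \<in> f ` A"
    then obtain v where "v \<in> A" "w = f v" by blast
    then show "needed lf' rf' (f ` A) X1' X2' Y1' Y2' w"
      using * by simp
  qed (use le in auto)
qed

lemma good_translate:
  assumes "good lf rf A X1 X2 Y1 Y2"
  shows "good lf rf ((\<lambda>(x, y). (x + a, y + b)) ` A) (X1 + a) (X2 + a) (Y1 + b) (Y2 + b)"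
proof -
  have img: "(\<lambda>(x, y). (x + a, y + b)) ` (I \<times> J) = (\<lambda>x. x + a) ` I \<times> (\<lambda>y. y + b) ` J" for I J :: "int set"
    by force
  have half: "(\<lambda>x. x + a) ` {..c} = {..c + a}" "(\<lambda>x. x + a) ` {c..} = {c + a..}" for a c :: int
    by (simp_all add: image_add_atMost image_add_atLeast add.commute[of _ a])
  have R: "(\<lambda>(x, y). (x + a, y + b)) ` rect X1 X2 Y1 Y2 = rect (X1 + a) (X2 + a) (Y1 + b) (Y2 + b)"
    unfolding rect_def img by (simp add: image_add_atLeastAtMost')
  have ord: "X1 \<le> X2" "Y1 \<le> Y2" using goodD[OF assms] by auto
  show ?thesis
  proof (rule good_image[OF bij_translate _ assms R])
    show "{..X1 + a - 2} \<times> {Y1 + b + 1..} = (\<lambda>(x, y). (x + a, y + b)) ` (lenv X1 Y1)"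
      "{X2 + a + 2..} \<times> {..Y2 + b - 1} = (\<lambda>(x, y). (x + a, y + b)) ` (renv X2 Y2)"
      by (simp_all add: img half algebra_simps)
  qed (use ord in \<open>fastforce simp: d1_def\<close>)+
qed

lemma good_rotate:
  assumes "good lf rf A X1 X2 Y1 Y2"
  shows "good rf lf ((\<lambda>(x, y). (a - x, b - y)) ` A) (a - X2) (a - X1) (b - Y2) (b - Y1)"
proof -
  have img: "(\<lambda>(x, y). (a - x, b - y)) ` (I \<times> J) = (\<lambda>x. a - x) ` I \<times> (\<lambda>y. b - y) ` J" for I J :: "int set"
    by force
  have half: "(\<lambda>x. a - x) ` {..c} = {a - c..}" "(\<lambda>x. a - x) ` {c..} = {..a - c}" for a c :: int
    by simp_all
  have R: "(\<lambda>(x, y). (a - x, b - y)) ` rect X1 X2 Y1 Y2 = rect (a - X2) (a - X1) (b - Y2) (b - Y1)"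
    unfolding rect_def img by simp
  have ord: "X1 \<le> X2" "Y1 \<le> Y2" using goodD[OF assms] by auto
  show ?thesis
  proof (rule good_image[OF bij_rotate _ assms R])
    show "{..a - X2 - 2} \<times> {b - Y2 + 1..} = (\<lambda>(x, y). (a - x, b - y)) ` (renv X2 Y2)"
      "{a - X1 + 2..} \<times> {..b - Y1 - 1} = (\<lambda>(x, y). (a - x, b - y)) ` (lenv X1 Y1)"
      by (simp_all add: img half algebra_simps)
  qed (use ord in \<open>fastforce simp: d1_def\<close>)+
qed

definition column_sites :: "int \<Rightarrow> (int \<times> int) set" where
  "column_sites j = {0} \<times> {y. 0 \<le> y \<and> y \<le> 3 * j + 1 \<and> y mod 3 \<noteq> 2}"

text \<open>The site \<open>(- 1, - 1)\<close> widens the column from its bottom end. The widening arrives at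
  \<open>(- 1, 3 * j + 3)\<close> only if the column is complete, and only then is the contact site
  \<open>(1, 3 * j + 4)\<close> absorbed.\<close>

definition column_module :: "int \<Rightarrow> (int \<times> int) set" where
  "column_module j = column_sites j \<union> {(- 1, - 1), (- 1, 3 * j + 3), (1, 3 * j + 4)}"

lemma column_sites_span:
  assumes "0 \<le> j" "column_sites j \<subseteq> T" "nclosed T"
  shows "rect 0 0 0 (3 * j + 1) \<subseteq> T"
proof -
  have *: "rect 0 0 0 (3 * i + 1) \<subseteq> T" if "0 \<le> i" "i \<le> j" for i
    using that
  proof (induction i rule: int_ge_induct)
    case base
    have "(0, 0) \<in> T" "(0, 1) \<in> T" using assms by (auto simp: column_sites_def)
    moreover have "{0..1} = {0, 1::int}" by auto
    ultimately show ?case by (auto simp: rect_def)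
  next
    case (step i)
    have T: "(0, y) \<in> T" if "0 \<le> y" "y \<le> 3 * j + 1" "y mod 3 \<noteq> 2" for y
      using assms(2) that by (auto simp: column_sites_def)
    have s: "(0, 3 * i + 3) \<in> T" "(0, 3 * i + 4) \<in> T"
      by (rule T; use step in presburger)+
    have 1: "rect 0 0 0 (3 * i + 3) \<subseteq> T"
      by (rule extend_up[OF assms(3) _ _ s(1), of _ _ _ "3 * i + 1"]) (use step in auto)
    have "rect 0 0 0 (3 * i + 4) \<subseteq> T"
      by (rule extend_up[OF assms(3) 1 _ s(2)]) (use step in auto)
    then show ?case by (simp add: algebra_simps)
  qed
  show ?thesis using *[of j] assms by simp
qed

lemma column_sites_card:
  assumes "0 \<le> j"
  shows "2 * nat (j + 1) \<le> card (column_sites j)"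
proof -
  let ?f = "\<lambda>(i, e). (0 :: int, 3 * i + e :: int)"
  have "inj_on ?f ({0..j} \<times> {0, 1})" by (auto simp: inj_on_def) presburger+
  then have "card (?f ` ({0..j} \<times> {0, 1})) = 2 * nat (j + 1)"
    by (simp add: card_image card_cartesian_product)
  moreover have "?f ` ({0..j} \<times> {0, 1}) \<subseteq> column_sites j"
    by (auto simp: column_sites_def)
  moreover have "finite (column_sites j)"
    by (rule finite_subset[of _ "rect 0 0 0 (3 * j + 1)"]) (auto simp: column_sites_def rect_def)
  ultimately show ?thesis using card_mono by metis
qed

lemma good_column_module:
  assumes j: "0 \<le> j"
  shows "good False True (column_module j) (- 1) 1 (- 1) (3 * j + 4)"
proof -
  let ?A = "column_module j" and ?R = "rect (- 1) 1 (- 1) (3 * j + 4)"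
  let ?g = "(- 1, 3 * j + 3)" and ?h = "(1, 3 * j + 4)"
  have sub: "?A \<subseteq> ?R" using j by (auto simp: column_module_def column_sites_def)
  have span: "?R \<subseteq> cl ?A"
  proof -
    have A: "?A \<subseteq> cl ?A" by (rule subset_cl)
    have 1: "rect 0 0 0 (3 * j + 1) \<subseteq> cl ?A"
      by (rule column_sites_span[OF j _ nclosed_cl]) (use A in \<open>auto simp: column_module_def\<close>)
    have "(- 1, - 1) \<in> cl ?A" using A by (auto simp: column_module_def)
    from nclosed_hull_point[OF nclosed_cl 1 _ this, of "(0, 0)"]
    have 2: "rect (- 1) 0 (- 1) (3 * j + 1) \<subseteq> cl ?A" using j by simp
    have "(- 1, 3 * j + 3) \<in> cl ?A" using A by (auto simp: column_module_def)
    from nclosed_hull_point[OF nclosed_cl 2 _ this, of "(- 1, 3 * j + 1)"]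
    have 3: "rect (- 1) 0 (- 1) (3 * j + 3) \<subseteq> cl ?A" using j by simp
    have "(1, 3 * j + 4) \<in> cl ?A" using A by (auto simp: column_module_def)
    from nclosed_hull_point[OF nclosed_cl 3 _ this, of "(0, 3 * j + 3)"]
    show ?thesis using j by simp
  qed
  have B: "\<exists>S. nclosed S \<and> S \<subseteq> ?R \<and> v \<notin> S \<and> ?A - {v} \<subseteq> S \<and> far S ({1 + 2..} \<times> {..3 * j + 4 - 1})"
    if S: "nclosed S" "\<And>x y. (x, y) \<in> S \<Longrightarrow> - 1 \<le> x \<and> x \<le> 0 \<and> - 1 \<le> y \<and> y \<le> 3 * j + 3 \<and> (y \<le> 3 * j + 1 \<or> x = - 1)"
      "v \<notin> S" "?A - {v, ?h} \<subseteq> S" "v \<noteq> ?h" for S v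
  proof -
    have "far S {?h}" by (intro farI) (use S(2) in force)
    then have "nclosed (S \<union> {?h})" using S(1) nclosed_singleton nclosed_Un_far by blast
    moreover have "far (S \<union> {?h}) ({1 + 2..} \<times> {..3 * j + 4 - 1})"
      by (intro farI) (use S(2) in force)
    moreover have "S \<union> {?h} \<subseteq> ?R" using S(2) j by force
    ultimately show ?thesis using S by (intro exI[of _ "S \<union> {?h}"]) auto
  qed
  have B2: "\<exists>S. nclosed S \<and> S \<subseteq> ?R \<and> v \<notin> S \<and> ?A - {v} \<subseteq> S \<and> far S ({1 + 2..} \<times> {..3 * j + 4 - 1})"
    if S: "nclosed S" "\<And>x y. (x, y) \<in> S \<Longrightarrow> - 1 \<le> x \<and> x \<le> 0 \<and> - 1 \<le> y \<and> y \<le> 3 * j + 1 \<and> (y \<le> 3 * j \<or> x = 0)"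
      "v \<notin> S" "?A - {v, ?g, ?h} \<subseteq> S" "v \<noteq> ?h" "v \<noteq> ?g" for S v
  proof (rule B[of "S \<union> {?g}"])
    have "far S {?g}" by (intro farI) (use S(2) in force)
    then show "nclosed (S \<union> {?g})" using S(1) nclosed_singleton nclosed_Un_far by blast
    show "- 1 \<le> x \<and> x \<le> 0 \<and> - 1 \<le> y \<and> y \<le> 3 * j + 3 \<and> (y \<le> 3 * j + 1 \<or> x = - 1)" if "(x, y) \<in> S \<union> {?g}" for x y
      using that S(2)[of x y] j by auto
  qed (use S in auto)
  have "(\<exists>S. nclosed S \<and> S \<subseteq> ?R \<and> v \<notin> S \<and> ?A - {v} \<subseteq> S \<and> far S ({1 + 2..} \<times> {..3 * j + 4 - 1}))
    \<or> (fst v = 1 \<and> ?A - {v} \<subseteq> {..1 - 1} \<times> UNIV)" if v: "v \<in> ?A" for v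
  proof -
    consider (h) "v = ?h" | (g) "v = ?g" | (b) "v = (- 1, - 1)"
      | (c) y where "v = (0, y)" "0 \<le> y" "y \<le> 3 * j + 1" "y mod 3 \<noteq> 2"
      using v by (auto simp: column_module_def column_sites_def)
    then show ?thesis
    proof cases
      case h
      then show ?thesis by (auto simp: column_module_def column_sites_def)
    next
      case g
      show ?thesis
        by (rule disjI1, rule B[of "rect (- 1) 0 (- 1) (3 * j + 1)"])
          (use g j in \<open>auto simp: nclosed_rect column_module_def column_sites_def\<close>)
    next
      case b
      show ?thesis
        by (rule disjI1, rule B2[of "rect 0 0 0 (3 * j + 1)"])
          (use b j in \<open>auto simp: nclosed_rect column_module_def column_sites_def\<close>)
    next
      case c
      consider "y = 0" | "y \<noteq> 0" "y mod 3 = 0" | "y mod 3 = 1" using c by linarith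
      then show ?thesis
      proof cases
        case 1
        have "far {(- 1, - 1)} (rect 0 0 1 (3 * j + 1))" by (intro farI) auto
        then have "nclosed ({(- 1, - 1)} \<union> rect 0 0 1 (3 * j + 1))"
          using nclosed_rect nclosed_singleton nclosed_Un_far by blast
        then show ?thesis using 1 c j
          by (intro disjI1 B2[of "{(- 1, - 1)} \<union> rect 0 0 1 (3 * j + 1)"])
             (auto simp: column_module_def column_sites_def)
      next
        case 2
        have "far (rect (- 1) 0 (- 1) (y - 2)) (rect 0 0 (y + 1) (3 * j + 1))" by (intro farI) auto
        then have n: "nclosed (rect (- 1) 0 (- 1) (y - 2) \<union> rect 0 0 (y + 1) (3 * j + 1))"
          using nclosed_rect nclosed_Un_far by blast
        have gap: "z \<le> y - 2 \<or> y + 1 \<le> z" if "z mod 3 \<noteq> 2" "z \<noteq> y" for z using 2 that by presburger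
        have y: "3 \<le> y" using 2 c by presburger
        have "?A - {v, ?g, ?h} \<subseteq> rect (- 1) 0 (- 1) (y - 2) \<union> rect 0 0 (y + 1) (3 * j + 1)"
        proof
          fix q assume "q \<in> ?A - {v, ?g, ?h}"
          then consider "q = (- 1, - 1)" | z where "q = (0, z)" "z \<noteq> y" "0 \<le> z" "z \<le> 3 * j + 1" "z mod 3 \<noteq> 2"
            using c(1) by (auto simp: column_module_def column_sites_def)
          then show "q \<in> rect (- 1) 0 (- 1) (y - 2) \<union> rect 0 0 (y + 1) (3 * j + 1)"
            by cases (use y gap in auto)
        qed
        then show ?thesis using 2 c j n y
          by (intro disjI1 B2[of "rect (- 1) 0 (- 1) (y - 2) \<union> rect 0 0 (y + 1) (3 * j + 1)"]) auto
      next
        case 3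
        have "far (rect (- 1) 0 (- 1) (y - 1)) (rect 0 0 (y + 2) (3 * j + 1))" by (intro farI) auto
        then have n: "nclosed (rect (- 1) 0 (- 1) (y - 1) \<union> rect 0 0 (y + 2) (3 * j + 1))"
          using nclosed_rect nclosed_Un_far by blast
        have gap: "z \<le> y - 1 \<or> y + 2 \<le> z" if "z mod 3 \<noteq> 2" "z \<noteq> y" for z using 3 that by presburger
        have y: "1 \<le> y" using 3 c by presburger
        have "?A - {v, ?g, ?h} \<subseteq> rect (- 1) 0 (- 1) (y - 1) \<union> rect 0 0 (y + 2) (3 * j + 1)"
        proof
          fix q assume "q \<in> ?A - {v, ?g, ?h}"
          then consider "q = (- 1, - 1)" | z where "q = (0, z)" "z \<noteq> y" "0 \<le> z" "z \<le> 3 * j + 1" "z mod 3 \<noteq> 2"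
            using c(1) by (auto simp: column_module_def column_sites_def)
          then show "q \<in> rect (- 1) 0 (- 1) (y - 1) \<union> rect 0 0 (y + 2) (3 * j + 1)"
            by cases (use y gap in auto)
        qed
        then show ?thesis using 3 c j n y
          by (intro disjI1 B2[of "rect (- 1) 0 (- 1) (y - 1) \<union> rect 0 0 (y + 2) (3 * j + 1)"]) auto
      qed
    qed
  qed
  then show ?thesis unfolding good_def using sub span j by (intro conjI ballI) simp_all
qed

lemma pair_module_exists:
  assumes j: "0 \<le> j"
  shows "\<exists>M. good lf rf M (- 1 - of_bool lf) (5 + of_bool rf) (- 3 - of_bool lf) (3 * j + 4 + of_bool rf)
    \<and> 4 * nat (j + 1) \<le> card M"
proof -
  let ?P = "column_module j"
  define Q where "Q = (\<lambda>(x, y). (4 - x, 3 * j + 1 - y)) ` ?P"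
  have P: "good False True ?P (- 1) 1 (- 1) (3 * j + 4)" using good_column_module[OF j] .
  have Q: "good True False Q 3 5 (- 3) (3 * j + 2)"
    using good_rotate[OF P, of 4 "3 * j + 1"] by (simp add: Q_def algebra_simps)
  have finP: "finite ?P" using goodD(3)[OF P] finite_rect finite_subset by blast
  have "card (column_sites j) \<le> card ?P"
    by (rule card_mono[OF finP]) (auto simp: column_module_def)
  then have cP: "2 * nat (j + 1) \<le> card ?P" using column_sites_card[OF j] by linarith
  have cQ: "card Q = card ?P"
    unfolding Q_def by (rule card_image) (use bij_is_inj[OF bij_rotate] inj_on_subset in blast)
  define A where "A i = (if i = 0 then ?P else Q)" for i :: nat
  define X1 where "X1 i = (if i = 0 then - 1 else 3 :: int)" for i :: nat
  define X2 where "X2 i = (if i = 0 then 1 else 5 :: int)" for i :: nat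
  define Y1 where "Y1 i = (if i = 0 then - 1 else - 3 :: int)" for i :: nat
  define Y2 where "Y2 i = (if i = 0 then 3 * j + 4 else 3 * j + 2 :: int)" for i :: nat
  have "\<exists>M. good lf rf M (X1 0 - of_bool lf) (X2 1 + of_bool rf) (Y1 1 - of_bool lf) (Y2 0 + of_bool rf)
    \<and> (\<Sum>i\<le>1. card (A i)) \<le> card M"
  proof (rule good_chain)
    fix i :: nat assume "i \<le> 1"
    then consider "i = 0" | "i = 1" by linarith
    then show "good (0 < i) (i < 1) (A i) (X1 i) (X2 i) (Y1 i) (Y2 i)"
      by cases (use P Q in \<open>simp_all add: A_def X1_def X2_def Y1_def Y2_def\<close>)
  qed (use j in \<open>auto simp: X1_def X2_def Y1_def Y2_def\<close>)
  moreover have "{..1::nat} = {0, 1}" by auto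
  ultimately obtain M where M: "good lf rf M (- 1 - of_bool lf) (5 + of_bool rf) (- 3 - of_bool lf) (3 * j + 4 + of_bool rf)"
    "card ?P + card Q \<le> card M"
    by (auto simp: A_def X1_def X2_def Y1_def Y2_def)
  then show ?thesis using cP cQ by (intro exI[of _ M]) auto
qed

lemma repeat_modules:
  fixes w p :: int and g :: "nat \<Rightarrow> int"
  assumes M: "\<And>lf rf. \<exists>M. good lf rf M (X1 - of_bool lf) (X2 + of_bool rf) (Y1 - of_bool lf) (Y2 + of_bool rf) \<and> c \<le> card M"
    and n: "0 < n" and p: "p = X2 - X1 + 4" and g: "\<And>i. i < n \<Longrightarrow> g i < g (Suc i)" "g 0 = 0"
    "\<And>i. i < n \<Longrightarrow> g (Suc i) - g i \<le> Y2 - Y1"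
  shows "\<exists>M. good lf rf M (X1 - of_bool lf) (X2 + n * p + of_bool rf) (Y1 - 1 - g n - of_bool lf) (Y2 + 1 + of_bool rf)
    \<and> Suc n * c \<le> card M"
proof -
  define m where "m i = (SOME M. good (0 < i) (i < n) M (X1 - of_bool (0 < i)) (X2 + of_bool (i < n)) (Y1 - of_bool (0 < i)) (Y2 + of_bool (i < n)) \<and> c \<le> card M)" for i
  have m: "good (0 < i) (i < n) (m i) (X1 - of_bool (0 < i)) (X2 + of_bool (i < n)) (Y1 - of_bool (0 < i)) (Y2 + of_bool (i < n))"
    "c \<le> card (m i)" for i
    using someI_ex[OF M[of "0 < i" "i < n"]] unfolding m_def by blast+
  define A where "A i = (\<lambda>(x, y). (x + int i * p, y + - g i)) ` m i" for i
  have cA: "c \<le> card (A i)" for i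
  proof -
    have "card (A i) = card (m i)"
      unfolding A_def by (rule card_image) (use bij_is_inj[OF bij_translate] inj_on_subset in blast)
    then show ?thesis using m(2) by simp
  qed
  have "\<exists>M. good lf rf M (X1 - of_bool (0 < (0::nat)) + int 0 * p - of_bool lf) (X2 + of_bool (n < n) + int n * p + of_bool rf)
      (Y1 - of_bool (0 < n) + - g n - of_bool lf) (Y2 + of_bool (0 < n) + - g 0 + of_bool rf)
    \<and> (\<Sum>i\<le>n. card (A i)) \<le> card M"
  proof (rule good_chain[OF n, where
      ?X1.0 = "\<lambda>i. X1 - of_bool (0 < i) + int i * p" and ?X2.0 = "\<lambda>i. X2 + of_bool (i < n) + int i * p" and
      ?Y1.0 = "\<lambda>i. Y1 - of_bool (0 < i) + - g i" and ?Y2.0 = "\<lambda>i. Y2 + of_bool (i < n) + - g i"])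
    fix i
    show "good (0 < i) (i < n) (A i) (X1 - of_bool (0 < i) + int i * p) (X2 + of_bool (i < n) + int i * p)
      (Y1 - of_bool (0 < i) + - g i) (Y2 + of_bool (i < n) + - g i)"
      unfolding A_def by (rule good_translate[OF m(1)])
  next
    fix i assume i: "i < n"
    show "X1 - of_bool (0 < Suc i) + int (Suc i) * p = X2 + of_bool (i < n) + int i * p + 2"
      using i by (simp add: p algebra_simps)
    show "Y1 - of_bool (0 < Suc i) + - g (Suc i) < Y1 - of_bool (0 < i) + - g i"
      "Y2 + of_bool (Suc i < n) + - g (Suc i) < Y2 + of_bool (i < n) + - g i"
      using g(1)[OF i] i by auto
    show "Y1 - of_bool (0 < i) + - g i \<le> Y2 + of_bool (Suc i < n) + - g (Suc i)"
      using g(3)[OF i] by (cases "0 < i"; cases "Suc i < n") auto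
  qed
  then obtain M where M: "good lf rf M (X1 - of_bool lf) (X2 + n * p + of_bool rf) (Y1 - 1 - g n - of_bool lf) (Y2 + 1 + of_bool rf)"
    "(\<Sum>i\<le>n. card (A i)) \<le> card M"
    using n g(2) by auto
  have "Suc n * c \<le> (\<Sum>i\<le>n. card (A i))"
    using sum_mono[of "{..n}" "\<lambda>_. c" "\<lambda>i. card (A i)"] cA by simp
  then show ?thesis using M by (intro exI[of _ M]) auto
qed

lemma group_module_exists:
  assumes j: "0 \<le> j"
  shows "\<exists>M. good lf rf M (- 1 - of_bool lf) (15 + of_bool rf) (- 5 - of_bool lf) (3 * j + 5 + of_bool rf)
    \<and> 8 * nat (j + 1) \<le> card M"
  using repeat_modules[OF pair_module_exists[OF j], of 1 10 int lf rf] j by (simp add: algebra_simps)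

lemma final_module_exists:
  assumes j: "0 \<le> j" and n: "0 < n" and e: "e \<le> (2 :: nat)"
  shows "\<exists>M. good False True M (- 1) (20 * int n + 16) (- 6 - int n - int e) (3 * j + 7)
    \<and> Suc n * (8 * nat (j + 1)) \<le> card M"
proof -
  define g where "g i = (if i = n then int (i + e) else int i)" for i
  from repeat_modules[OF group_module_exists[OF j], of n 20 g False True] show ?thesis
    using n e j by (auto simp: g_def algebra_simps)
qed

text \<open>The invariant keeps the whole ray of future padding sites inside the closed set.\<close>

definition paddable :: "(int \<times> int) set \<Rightarrow> int \<Rightarrow> int \<Rightarrow> int \<Rightarrow> int \<Rightarrow> int \<Rightarrow> bool" where
  "paddable A X1 X2 Y1 Y2 y \<longleftrightarrow> X1 \<le> X2 \<and> Y1 \<le> y \<and> y \<le> Y2 \<and> A \<subseteq> rect X1 X2 Y1 Y2 \<and> rect X1 X2 Y1 Y2 \<subseteq> cl A \<and>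
     (\<forall>v\<in>A. \<exists>S. nclosed S \<and> v \<notin> S \<and> A - {v} \<subseteq> S \<and> {X2 + 2..} \<times> {y} \<subseteq> S)"

lemma nclosed_ray: "nclosed ({x..} \<times> {y})"
  by (rule nclosed_Times) auto

lemma good_paddable:
  assumes "good False True A X1 X2 Y1 Y2" "Y1 < Y2"
  shows "paddable A X1 X2 Y1 Y2 (Y2 - 1)"
proof -
  have "\<exists>S. nclosed S \<and> v \<notin> S \<and> A - {v} \<subseteq> S \<and> {X2 + 2..} \<times> {Y2 - 1} \<subseteq> S" if v: "v \<in> A" for v
  proof (cases rule: good_cases[OF assms(1) v])
    case (1 S)
    have "far S ({X2 + 2..} \<times> {Y2 - 1})" by (rule far_mono[of S "renv X2 Y2"]) (use 1(6) in auto)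
    then have "nclosed (S \<union> {X2 + 2..} \<times> {Y2 - 1})" using 1(1) nclosed_ray nclosed_Un_far by blast
    moreover have "v \<notin> {X2 + 2..} \<times> {Y2 - 1}" using goodD(3)[OF assms(1)] v by (auto simp: rect_def)
    ultimately show ?thesis using 1 by (intro exI[of _ "S \<union> {X2 + 2..} \<times> {Y2 - 1}"]) auto
  next
    case 3
    let ?S = "rect X1 (X2 - 1) Y1 Y2 \<union> {X2 + 2..} \<times> {Y2 - 1}"
    have "far (rect X1 (X2 - 1) Y1 Y2) ({X2 + 2..} \<times> {Y2 - 1})" by (intro farI) auto
    then have "nclosed ?S" using nclosed_rect nclosed_ray nclosed_Un_far by blast
    moreover have "v \<notin> ?S" using 3 by (cases v) auto
    moreover have "A - {v} \<subseteq> ?S" using 3(3) goodD(3)[OF assms(1)] by (fastforce simp: rect_def)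
    ultimately show ?thesis by blast
  qed simp
  then show ?thesis unfolding paddable_def using goodD[OF assms(1)] assms(2) by auto
qed

lemma paddable_step:
  assumes p: "paddable A X1 X2 Y1 Y2 y" and e: "e = 2 \<or> e = 3"
  shows "paddable (A \<union> {X2 + 2..X2 + e} \<times> {y}) X1 (X2 + e) Y1 Y2 y"
proof -
  let ?A = "A \<union> {X2 + 2..X2 + e} \<times> {y}"
  have a: "X1 \<le> X2" "Y1 \<le> y" "y \<le> Y2" "A \<subseteq> rect X1 X2 Y1 Y2" "rect X1 X2 Y1 Y2 \<subseteq> cl A"
    using p unfolding paddable_def by auto
  have "\<exists>S. nclosed S \<and> v \<notin> S \<and> ?A - {v} \<subseteq> S \<and> {X2 + e + 2..} \<times> {y} \<subseteq> S" if v: "v \<in> ?A" for v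
  proof (cases "v \<in> A")
    case True
    then obtain S where S: "nclosed S" "v \<notin> S" "A - {v} \<subseteq> S" "{X2 + 2..} \<times> {y} \<subseteq> S"
      using p unfolding paddable_def by blast
    have ray: "{X2 + 2..X2 + e} \<times> {y} \<subseteq> {X2 + 2..} \<times> {y}" "{X2 + e + 2..} \<times> {y} \<subseteq> {X2 + 2..} \<times> {y}"
      using e by auto
    have "?A - {v} \<subseteq> S" using S(3) subset_trans[OF ray(1) S(4)] by auto
    then show ?thesis using S(1,2) subset_trans[OF ray(2) S(4)] by (intro exI[of _ S]) simp
  next
    case False
    then obtain x where x: "v = (x, y)" "X2 + 2 \<le> x" "x \<le> X2 + e" using v by auto
    define l where "l = (if x = X2 + 2 then X2 else X2 + 2)"
    let ?S = "rect X1 l Y1 Y2 \<union> {l + 3..} \<times> {y}"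
    have "far (rect X1 l Y1 Y2) ({l + 3..} \<times> {y})" by (intro farI) auto
    then have "nclosed ?S" using nclosed_rect nclosed_ray nclosed_Un_far by blast
    moreover have l: "X2 \<le> l" "l < x" "x < l + 3" "l \<le> X2 + 2" using x e by (auto simp: l_def)
    moreover from l(1) have "rect X1 X2 Y1 Y2 \<subseteq> rect X1 l Y1 Y2" by (auto simp: rect_def)
    moreover have "z \<le> l \<or> l + 3 \<le> z" if "X2 + 2 \<le> z" "z \<le> X2 + e" "z \<noteq> x" for z
      using that x e by (auto simp: l_def)
    ultimately show ?thesis using a x e by (intro exI[of _ ?S]) (auto simp: l_def)
  qed
  moreover have "rect X1 (X2 + e) Y1 Y2 \<subseteq> cl ?A"
  proof -
    have "rect X1 X2 Y1 Y2 \<subseteq> cl ?A" using a(5) cl_mono[of A ?A] by blast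
    moreover have w: "(X2 + 2, y) \<in> cl ?A" "(X2 + e, y) \<in> cl ?A" using subset_cl[of ?A] e by auto
    ultimately have r2: "rect X1 (X2 + 2) Y1 Y2 \<subseteq> cl ?A"
      by (intro extend_right[OF nclosed_cl, of X1 X2 Y1 Y2 _ "X2 + 2"]) (use a in auto)
    show ?thesis
    proof (cases "e = 2")
      case True
      then show ?thesis using r2 by simp
    next
      case False
      then have "e = 3" using e by simp
      then show ?thesis using a w(2) r2
        by (intro extend_right[OF nclosed_cl, of X1 "X2 + 2" Y1 Y2 _ "X2 + e" y]) auto
    qed
  qed
  moreover have "?A \<subseteq> rect X1 (X2 + e) Y1 Y2" using a e by (fastforce simp: rect_def)
  ultimately show ?thesis unfolding paddable_def using a e by auto
qed

lemma paddable_extend: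
  assumes p: "paddable A X1 X2 Y1 Y2 y"
  shows "2 \<le> d \<Longrightarrow> \<exists>A'. A \<subseteq> A' \<and> paddable A' X1 (X2 + int d) Y1 Y2 y"
proof (induction d rule: less_induct)
  case (less d)
  consider "d = 2" | "d = 3" | "4 \<le> d" using less.prems by linarith
  then show ?case
  proof cases
    case 1 then show ?thesis using paddable_step[OF p, of 2] by auto
  next
    case 2 then show ?thesis using paddable_step[OF p, of 3] by (intro exI[of _ "A \<union> {X2 + 2..X2 + 3} \<times> {y}"]) auto
  next
    case 3
    then have "d - 2 < d" "2 \<le> d - 2" by auto
    from less.IH[OF this] obtain A' where A': "A \<subseteq> A'" "paddable A' X1 (X2 + int (d - 2)) Y1 Y2 y"
      by blast
    have "paddable (A' \<union> {X2 + int d..X2 + int d} \<times> {y}) X1 (X2 + int d) Y1 Y2 y"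
      using paddable_step[OF A'(2), of 2] 3 by (simp add: of_nat_diff)
    then show ?thesis using A'(1) by blast
  qed
qed

lemma paddable_indep:
  assumes "paddable A X1 X2 Y1 Y2 y"
  shows "indep A" "cl A = rect X1 X2 Y1 Y2"
proof -
  show "indep A" unfolding indep_def
  proof
    fix v assume "v \<in> A"
    then obtain S where "nclosed S" "v \<notin> S" "A - {v} \<subseteq> S" using assms unfolding paddable_def by blast
    then show "v \<notin> cl (A - {v})" using cl_least by blast
  qed
  show "cl A = rect X1 X2 Y1 Y2"
    using assms cl_least[OF _ nclosed_rect, of A X1 X2 Y1 Y2] unfolding paddable_def by auto
qed

theorem large_minimal_set:
  fixes p q :: nat
  assumes pq: "p \<le> q" and p: "40 \<le> p"
  shows "\<exists>A. indep A \<and> cl A = rect 1 (int p) 1 (int q) \<and> 4 * real p * real q / 33 - 5 * real q \<le> real (card A)"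
proof -
  define K where "K = p div 20"
  have K: "2 \<le> K" "20 * K \<le> p" "p \<le> 20 * K + 19" unfolding K_def using p by linarith+
  define r where "r = q - 13 - K"
  define j where "j = r div 3"
  define e where "e = r mod 3"
  have r: "r = 3 * j + e" "e \<le> 2" unfolding j_def e_def by (simp_all add: mult.commute)
  have q: "q = 3 * j + e + 13 + K" using r(1) pq p K unfolding r_def by linarith
  define d where "d = p + 2 - 20 * K"
  have d: "2 \<le> d" "p = 20 * K + d - 2" using K unfolding d_def by auto
  obtain M where M: "good False True M (- 1) (20 * int (K - 1) + 16) (- 6 - int (K - 1) - int e) (3 * int j + 7)"
    "Suc (K - 1) * (8 * nat (int j + 1)) \<le> card M"
    using final_module_exists[of "int j" "K - 1" e] K r by auto
  obtain A where A: "M \<subseteq> A" "paddable A (- 1) (20 * int (K - 1) + 16 + int d) (- 6 - int (K - 1) - int e) (3 * int j + 7) (3 * int j + 7 - 1)"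
    using paddable_extend[OF good_paddable[OF M(1)] d(1)] by auto
  let ?f = "\<lambda>(x, y). (x + 2, y + (7 + int (K - 1) + int e)) :: int \<times> int"
  let ?A = "?f ` A"
  have iso: "d1 (?f u) (?f v) = d1 u v" for u v by (cases u; cases v) simp
  note i = d1_isometry_image[OF bij_translate iso]
  have "indep ?A" using i(4) paddable_indep(1)[OF A(2)] by blast
  moreover have "cl ?A = rect 1 (int p) 1 (int q)"
  proof -
    have "?f ` rect a b c d = rect (a + 2) (b + 2) (c + (7 + int (K - 1) + int e)) (d + (7 + int (K - 1) + int e))" for a b c d
    proof -
      have "(x, y) \<in> ?f ` rect a b c d" if "(x, y) \<in> rect (a + 2) (b + 2) (c + (7 + int (K - 1) + int e)) (d + (7 + int (K - 1) + int e))" for x y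
        using that by (intro image_eqI[of _ _ "(x - 2, y - (7 + int (K - 1) + int e))"]) auto
      then show ?thesis by (auto simp: rect_def)
    qed
    moreover have "20 * int (K - 1) + 16 + int d + 2 = int p" "3 * int j + 7 + (7 + int (K - 1) + int e) = int q"
      using d q K by (simp_all add: of_nat_diff)
    ultimately show ?thesis using i(2)[of A] paddable_indep(2)[OF A(2)] by (simp add: of_nat_diff)
  qed
  moreover have "4 * real p * real q / 33 - 5 * real q \<le> real (card ?A)"
  proof -
    have "finite A" using A(2) finite_rect finite_subset unfolding paddable_def by blast
    then have "card M \<le> card A" using A(1) by (rule card_mono)
    moreover have "card ?A = card A"
      by (rule card_image) (use bij_is_inj[OF bij_translate] inj_on_subset in blast)
    moreover have "K * (8 * (j + 1)) \<le> card M" using M(2) K by (simp add: nat_add_distrib)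
    ultimately have "8 * K * (j + 1) \<le> card ?A" by (simp add: algebra_simps)
    then have "real (8 * K * (j + 1)) \<le> real (card ?A)" by (rule of_nat_mono)
    then have c: "8 * real K * (real j + 1) \<le> real (card ?A)" by (simp only: of_nat_mult of_nat_add of_nat_numeral of_nat_1)
    have a: "(real p - 19) / 20 \<le> real K" "real K \<le> real p / 20" using K by auto
    have b: "(real q - 12 - real p / 20) / 3 \<le> real j + 1" using q r(2) a(2) by auto
    have b': "(19 / 20 * real q - 12) / 3 \<le> real j + 1" using b pq by simp
    have "(real p - 19) / 20 * ((19 / 20 * real q - 12) / 3) \<le> real K * (real j + 1)"
      by (rule mult_mono[OF a(1) b']) (use p pq in auto)
    then have "8 * ((real p - 19) / 20 * ((19 / 20 * real q - 12) / 3)) \<le> real (card ?A)" using c by linarith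
    moreover have "8 * ((real p - 19) / 20 * ((19 / 20 * real q - 12) / 3)) =
      19 / 150 * (real p * real q) - 361 / 150 * real q - 8 / 5 * real p + 152 / 5"
      by (simp add: field_simps)
    moreover have "4 / 33 * (real p * real q) \<le> 19 / 150 * (real p * real q)" by (rule mult_right_mono) auto
    ultimately show ?thesis using pq by (simp add: field_simps)
  qed
  ultimately show ?thesis by blast
qed

section \<open>Components and their sites\<close>

lemma rect_eq_iff:
  assumes "a \<le> b" "c \<le> d"
  shows "rect a b c d = rect a' b' c' d' \<longleftrightarrow> a = a' \<and> b = b' \<and> c = c' \<and> d = d'"
proof
  assume eq: "rect a b c d = rect a' b' c' d'"
  have "(a, c) \<in> rect a' b' c' d'" "(b, d) \<in> rect a' b' c' d'" using assms unfolding eq[symmetric] by auto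
  moreover from this have "(a', c') \<in> rect a b c d" "(b', d') \<in> rect a b c d" unfolding eq by auto
  ultimately show "a = a' \<and> b = b' \<and> c = c' \<and> d = d'" by auto
qed auto

lemma rect_subset_iff:
  assumes "a \<le> b" "c \<le> d"
  shows "rect a b c d \<subseteq> rect a' b' c' d' \<longleftrightarrow> a' \<le> a \<and> b \<le> b' \<and> c' \<le> c \<and> d \<le> d'"
proof
  assume "rect a b c d \<subseteq> rect a' b' c' d'"
  moreover have "(a, c) \<in> rect a b c d" "(b, d) \<in> rect a b c d" using assms by auto
  ultimately have "(a, c) \<in> rect a' b' c' d'" "(b, d) \<in> rect a' b' c' d'" by blast+
  then show "a' \<le> a \<and> b \<le> b' \<and> c' \<le> c \<and> d \<le> d'" by auto
qed (auto simp: rect_def)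

definition gap :: "int \<Rightarrow> int \<Rightarrow> int \<Rightarrow> int \<Rightarrow> int" where
  "gap a b a' b' = max 0 (max (a' - b) (a - b'))"

lemma far_rect_iff:
  assumes "a \<le> b" "c \<le> d" "a' \<le> b'" "c' \<le> d'"
  shows "far (rect a b c d) (rect a' b' c' d') \<longleftrightarrow> 3 \<le> gap a b a' b' + gap c d c' d'"
proof
  have attain: "\<exists>x u. a \<le> x \<and> x \<le> b \<and> a' \<le> u \<and> u \<le> b' \<and> \<bar>x - u\<bar> = gap a b a' b'"
    if "a \<le> b" "a' \<le> b'" for a b a' b'
  proof -
    consider "b < a'" | "b' < a" | "a \<le> b'" "a' \<le> b" by linarith
    then show ?thesis
    proof cases
      case 1 then show ?thesis using that by (intro exI[of _ b] exI[of _ a']) (auto simp: gap_def)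
    next
      case 2 then show ?thesis using that by (intro exI[of _ a] exI[of _ b']) (auto simp: gap_def)
    next
      case 3 then show ?thesis using that
        by (intro exI[of _ "max a a'"] exI[of _ "max a a'"]) (auto simp: gap_def)
    qed
  qed
  assume f: "far (rect a b c d) (rect a' b' c' d')"
  obtain x u where x: "a \<le> x" "x \<le> b" "a' \<le> u" "u \<le> b'" "\<bar>x - u\<bar> = gap a b a' b'"
    using attain assms by blast
  obtain y v where y: "c \<le> y" "y \<le> d" "c' \<le> v" "v \<le> d'" "\<bar>y - v\<bar> = gap c d c' d'"
    using attain assms by blast
  have "3 \<le> d1 (x, y) (u, v)" using f x y unfolding far_def by (metis mem_rect)
  then show "3 \<le> gap a b a' b' + gap c d c' d'" using x y by simp
next
  assume g: "3 \<le> gap a b a' b' + gap c d c' d'"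
  show "far (rect a b c d) (rect a' b' c' d')"
    unfolding far_def
  proof (intro ballI)
    fix p q assume "p \<in> rect a b c d" "q \<in> rect a' b' c' d'"
    moreover obtain x y u v where "p = (x, y)" "q = (u, v)" by fastforce
    ultimately have "gap a b a' b' \<le> \<bar>x - u\<bar>" "gap c d c' d' \<le> \<bar>y - v\<bar>" "d1 p q = \<bar>x - u\<bar> + \<bar>y - v\<bar>"
      by (auto simp: gap_def)
    then show "3 \<le> d1 p q" using g by linarith
  qed
qed

lemma point_rect: "{(x, y)} = rect x x y y"
  by (auto simp: rect_def)

lemma far_point_rect_iff:
  assumes "a \<le> b" "c \<le> d"
  shows "far {(x, y)} (rect a b c d) \<longleftrightarrow> 3 \<le> gap x x a b + gap y y c d"
  unfolding point_rect using assms by (simp add: far_rect_iff)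

definition is_rect :: "(int \<times> int) set \<Rightarrow> bool" where
  "is_rect B \<longleftrightarrow> (\<exists>a b c d. a \<le> b \<and> c \<le> d \<and> B = rect a b c d)"

lemma is_rectI: "a \<le> b \<Longrightarrow> c \<le> d \<Longrightarrow> is_rect (rect a b c d)"
  unfolding is_rect_def by blast

lemma is_rectE:
  assumes "is_rect B"
  obtains a b c d where "a \<le> b" "c \<le> d" "B = rect a b c d"
  using assms unfolding is_rect_def by blast

lemma nclosed_is_rect: "is_rect B \<Longrightarrow> nclosed B"
  by (elim is_rectE) (simp add: nclosed_rect)

lemma is_rect_singleton: "is_rect {p}"
  using is_rectI[of "fst p" "fst p" "snd p" "snd p"] point_rect[of "fst p" "snd p"] by simp

lemma rect_hull_exists:
  assumes "is_rect B" "is_rect C" "\<not> far B C" "B \<subseteq> T" "C \<subseteq> T" "nclosed T"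
  shows "\<exists>H. is_rect H \<and> H \<subseteq> T \<and> B \<subseteq> H \<and> C \<subseteq> H"
proof -
  obtain a b c d where B: "a \<le> b" "c \<le> d" "B = rect a b c d" using assms(1) by (rule is_rectE)
  obtain a' b' c' d' where C: "a' \<le> b'" "c' \<le> d'" "C = rect a' b' c' d'" using assms(2) by (rule is_rectE)
  let ?H = "rect (min a a') (max b b') (min c c') (max d d')"
  have "?H \<subseteq> T" using nclosed_hull_rect[OF assms(6)] assms(3-5) unfolding B C by blast
  moreover have "B \<subseteq> ?H" "C \<subseteq> ?H" unfolding B C rect_def by auto
  moreover have "is_rect ?H" using B C by (intro is_rectI) auto
  ultimately show ?thesis by blast
qed

lemma rect_components:
  assumes "finite A"
  shows "\<exists>F. \<Union>F = cl A \<and> (\<forall>B\<in>F. is_rect B) \<and> (\<forall>B\<in>F. \<forall>C\<in>F. B \<noteq> C \<longrightarrow> far B C)"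
proof -
  define P where "P F \<longleftrightarrow> finite F \<and> A \<subseteq> \<Union>F \<and> \<Union>F \<subseteq> cl A \<and> (\<forall>B\<in>F. is_rect B)" for F
  have "P ((\<lambda>p. {p}) ` A)"
    unfolding P_def using assms subset_cl[of A] is_rect_singleton by auto
  then obtain F where F: "P F" and min: "\<And>G. P G \<Longrightarrow> card F \<le> card G"
    using ex_has_least_nat[of P _ card] by blast
  have FF: "finite F" "A \<subseteq> \<Union>F" "\<Union>F \<subseteq> cl A" "\<And>B. B \<in> F \<Longrightarrow> is_rect B"
    using F unfolding P_def by simp_all
  have far: "far B C" if BC: "B \<in> F" "C \<in> F" "B \<noteq> C" for B C
  proof (rule ccontr)
    assume nf: "\<not> far B C"
    note rect_hull_exists[OF FF(4)[OF BC(1)] FF(4)[OF BC(2)] nf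
        subset_trans[OF Union_upper[OF BC(1)] FF(3)] subset_trans[OF Union_upper[OF BC(2)] FF(3)] nclosed_cl]
    then
    obtain H where H: "is_rect H" "H \<subseteq> cl A" "B \<subseteq> H" "C \<subseteq> H" by (elim exE conjE)
    have "P (insert H (F - {B, C}))" unfolding P_def
    proof (intro conjI)
      show "A \<subseteq> \<Union>(insert H (F - {B, C}))"
      proof
        fix p assume "p \<in> A"
        then obtain D where D: "D \<in> F" "p \<in> D" using FF(2) by (meson UnionE subsetD)
        show "p \<in> \<Union>(insert H (F - {B, C}))"
        proof (cases "D = B \<or> D = C")
          case True
          then have "p \<in> H" using D H by (meson subsetD)
          then show ?thesis by simp
        next
          case False
          then show ?thesis using D by (intro UnionI[of D]) simp_all
        qed
      qed
      have "\<Union>(F - {B, C}) \<subseteq> \<Union>F" by (intro Union_mono) simp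
      then show "\<Union>(insert H (F - {B, C})) \<subseteq> cl A" using FF(3) H(2) by simp
      show "\<forall>D\<in>insert H (F - {B, C}). is_rect D" using H(1) FF(4) by simp
    qed (use FF in simp)
    then have "card F \<le> card (insert H (F - {B, C}))" by (rule min)
    moreover have "card (insert H (F - {B, C})) \<le> Suc (card (F - {B, C}))"
      using FF(1) by (simp add: card_insert_if)
    moreover have "card (F - {B, C}) = card F - 2" using BC FF(1) by (simp add: card_Diff_subset)
    moreover have "2 \<le> card F" using card_mono[of F "{B, C}"] FF(1) BC by auto
    ultimately show False by linarith
  qed
  have "nclosed (\<Union>F)" by (rule nclosed_Union_far[OF nclosed_is_rect[OF FF(4)] far])
  then have "\<Union>F = cl A" using FF cl_least[of A "\<Union>F"] by (intro subset_antisym)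
  then show ?thesis using FF far by (intro exI[of _ F]) simp
qed

lemma cl_component:
  assumes F: "\<Union>F = cl A" "\<And>B. B \<in> F \<Longrightarrow> nclosed B" "\<And>B C. B \<in> F \<Longrightarrow> C \<in> F \<Longrightarrow> B \<noteq> C \<Longrightarrow> far B C"
    and B: "B \<in> F"
  shows "cl (A \<inter> B) = B"
proof
  show sub: "cl (A \<inter> B) \<subseteq> B" using F(2)[OF B] by (intro cl_least) auto
  have "far (cl (A \<inter> B)) (\<Union>(F - {B}))"
    using F(3)[OF B] sub unfolding far_def by blast
  moreover have "nclosed (\<Union>(F - {B}))" using F by (intro nclosed_Union_far) auto
  ultimately have "nclosed (cl (A \<inter> B) \<union> \<Union>(F - {B}))" using nclosed_cl nclosed_Un_far by blast
  moreover have "A \<subseteq> cl (A \<inter> B) \<union> \<Union>(F - {B})"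
    using subset_cl[of A] subset_cl[of "A \<inter> B"] F(1) by blast
  ultimately have "\<Union>F \<subseteq> cl (A \<inter> B) \<union> \<Union>(F - {B})" using cl_least F(1) by metis
  moreover have "B \<inter> \<Union>(F - {B}) = {}" using F(3)[OF B] far_disjoint by blast
  ultimately show "B \<subseteq> cl (A \<inter> B)" using B by blast
qed

lemma swap_facts:
  "cl (prod.swap ` A) = prod.swap ` cl A" "far (prod.swap ` S) (prod.swap ` T) \<longleftrightarrow> far S T"
  "indep (prod.swap ` A) \<longleftrightarrow> indep A" "nclosed (prod.swap ` S) \<longleftrightarrow> nclosed S"
  using d1_isometry_image[OF bij_prod_swap d1_swap] by blast+

lemma flipx_facts:
  "cl (flipx ` A) = flipx ` cl A" "far (flipx ` S) (flipx ` T) \<longleftrightarrow> far S T"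
  "indep (flipx ` A) \<longleftrightarrow> indep A" "nclosed (flipx ` S) \<longleftrightarrow> nclosed S"
  using d1_isometry_image[OF bij_flipx d1_flipx] by blast+

lemma flipy_facts:
  "cl (flipy ` A) = flipy ` cl A" "far (flipy ` S) (flipy ` T) \<longleftrightarrow> far S T"
  "indep (flipy ` A) \<longleftrightarrow> indep A" "nclosed (flipy ` S) \<longleftrightarrow> nclosed S"
  using d1_isometry_image[OF bij_flipy d1_flipy] by blast+

lemma two_columns_hit:
  assumes R: "cl A = rect a b c d" "a \<le> b" "c \<le> d" and e: "a \<le> e + 1" "e \<le> b"
  shows "\<exists>x y. (x, y) \<in> A \<and> (x = e \<or> x = e + 1)"
proof (rule ccontr)
  assume no: "\<not> ?thesis"
  let ?L = "rect a (e - 1) c d" and ?R = "rect (e + 2) b c d"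
  have "A \<subseteq> ?L \<union> ?R" using subset_cl[of A] no unfolding R(1) by (fastforce simp: rect_def)
  moreover have "far ?L ?R" unfolding far_def d1_def rect_def by fastforce
  then have "nclosed (?L \<union> ?R)" using nclosed_rect nclosed_Un_far by blast
  ultimately have "rect a b c d \<subseteq> ?L \<union> ?R" using cl_least R(1) by metis
  moreover have "(max a e, c) \<in> rect a b c d \<or> (e + 1, c) \<in> rect a b c d" using R e by auto
  ultimately have "(max a e, c) \<in> ?L \<union> ?R \<or> (e + 1, c) \<in> ?L \<union> ?R" by blast
  then show False using e by auto
qed

lemma two_rows_hit:
  assumes R: "cl A = rect a b c d" "a \<le> b" "c \<le> d" and e: "c \<le> e + 1" "e \<le> d"
  shows "\<exists>x y. (x, y) \<in> A \<and> (y = e \<or> y = e + 1)"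
proof -
  have "cl (prod.swap ` A) = rect c d a b" using R by (simp add: swap_facts)
  from two_columns_hit[OF this R(3,2) e] show ?thesis by force
qed

lemma side_hit:
  assumes R: "cl A = rect a b c d" "a \<le> b" "c \<le> d"
  shows "\<exists>y. (a, y) \<in> A" "\<exists>y. (b, y) \<in> A" "\<exists>x. (x, c) \<in> A" "\<exists>x. (x, d) \<in> A"
proof -
  have A: "A \<subseteq> rect a b c d" using subset_cl[of A] R by simp
  show "\<exists>y. (a, y) \<in> A" using two_columns_hit[OF R, of "a - 1"] R A by fastforce
  show "\<exists>y. (b, y) \<in> A" using two_columns_hit[OF R, of b] R A by fastforce
  show "\<exists>x. (x, c) \<in> A" using two_rows_hit[OF R, of "c - 1"] R A by fastforce
  show "\<exists>x. (x, d) \<in> A" using two_rows_hit[OF R, of d] R A by fastforce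
qed

lemma line_point:
  assumes R: "cl A = rect a b c c" and x: "a \<le> x" "x \<le> b" "(x, c) \<notin> A"
  shows "(x - 1, c) \<in> A" "(x + 1, c) \<in> A"
proof -
  have A: "A \<subseteq> rect a b c c" using subset_cl[of A] R by simp
  have ab: "a \<le> b" using x by simp
  obtain u v where "(u, v) \<in> A" "u = x - 1 \<or> u = x" using two_columns_hit[OF R ab, of "x - 1"] x by auto
  then show "(x - 1, c) \<in> A" using A x by force
  obtain u v where "(u, v) \<in> A" "u = x \<or> u = x + 1" using two_columns_hit[OF R ab, of x] x by auto
  then show "(x + 1, c) \<in> A" using A x by force
qed

lemma line_with_point_thick:
  assumes X: "cl X = rect s1 s2 t t" "finite X" "2 \<le> card X" and w: "wy \<noteq> t" "s1 \<le> s2"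
    and near: "\<not> far {(wx, wy)} (rect s1 s2 t t)"
  shows "\<exists>D u1 u2 v1 v2. D \<subseteq> insert (wx, wy) X \<and> card D \<le> 3 \<and> cl D = rect u1 u2 v1 v2 \<and> u1 < u2 \<and> v1 < v2"
proof -
  have sub: "X \<subseteq> rect s1 s2 t t" using subset_cl[of X] X by simp
  have s12: "s1 < s2"
  proof (rule ccontr)
    assume "\<not> s1 < s2"
    then have "X \<subseteq> {(s1, t)}" using sub by (auto simp: rect_def)
    then have "card X \<le> card {(s1, t)}" by (intro card_mono) auto
    then show False using X by simp
  qed
  obtain x where x: "s1 \<le> x" "x \<le> s2" "\<bar>wx - x\<bar> + \<bar>wy - t\<bar> \<le> 2"
    using near unfolding far_def by (auto simp: rect_def)
  obtain b1 b2 where b: "(b1, t) \<in> X" "(b2, t) \<in> X" "b1 < b2" "b2 \<le> b1 + 2" "b1 \<le> x" "x \<le> b2"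
  proof (cases "(x, t) \<in> X")
    case True
    consider "x < s2" "(x + 1, t) \<in> X" | "x < s2" "(x + 1, t) \<notin> X"
      | "s1 < x" "(x - 1, t) \<in> X" | "s1 < x" "(x - 1, t) \<notin> X" using s12 x by linarith
    then show thesis
    proof cases
      case 1 then show ?thesis using that[of x "x + 1"] True by auto
    next
      case 2
      then have "(x + 1 + 1, t) \<in> X" using line_point(2)[OF X(1), of "x + 1"] x by auto
      then show ?thesis using that[of x "x + 2"] True by (auto simp: add.assoc)
    next
      case 3 then show ?thesis using that[of "x - 1" x] True by auto
    next
      case 4
      then have "(x - 1 - 1, t) \<in> X" using line_point(1)[OF X(1), of "x - 1"] x by auto
      then show ?thesis using that[of "x - 2" x] True by auto
    qed
  next
    case False
    then show thesis using that[of "x - 1" "x + 1"] line_point[OF X(1)] x by auto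
  qed
  define D where "D = {(b1, t), (b2, t), (wx, wy)}"
  have D: "D \<subseteq> cl D" by (rule subset_cl)
  have 1: "rect b1 b2 t t \<subseteq> cl D"
  proof -
    have "rect b1 b1 t t \<subseteq> cl D" using D by (auto simp: D_def rect_def)
    from nclosed_hull_point[OF nclosed_cl this, of "(b1, t)" b2 t] D b
    show ?thesis by (simp add: D_def)
  qed
  have "(wx, wy) \<in> cl D" using D by (simp add: D_def)
  from nclosed_hull_point[OF nclosed_cl 1 _ this, of "(x, t)"]
  have 2: "rect (min b1 wx) (max b2 wx) (min t wy) (max t wy) \<subseteq> cl D"
    using b x by (simp add: abs_minus_commute)
  have 3: "cl D \<subseteq> rect (min b1 wx) (max b2 wx) (min t wy) (max t wy)"
    by (intro cl_least nclosed_rect) (use b in \<open>auto simp: D_def\<close>)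
  have "card D \<le> 3" unfolding D_def by (simp add: card_insert_if)
  moreover have "D \<subseteq> insert (wx, wy) X" using b by (auto simp: D_def)
  moreover have "min b1 wx < max b2 wx" "min t wy < max t wy" using b w by auto
  ultimately show ?thesis using 2 3 by blast
qed

section \<open>Splitting a minimal set\<close>

definition splitting :: "(int \<times> int) set \<Rightarrow> (int \<times> int) set \<Rightarrow> (int \<times> int) set \<Rightarrow>
    int \<Rightarrow> int \<Rightarrow> int \<Rightarrow> int \<Rightarrow> int \<Rightarrow> int \<Rightarrow> int \<Rightarrow> int \<Rightarrow> bool" where
  "splitting A B C s1 s2 t1 t2 p1 p2 q1 q2 \<longleftrightarrow>
     A = B \<union> C \<and> B \<inter> C = {} \<and> B \<noteq> {} \<and> C \<noteq> {} \<and>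
     cl B = rect s1 s2 t1 t2 \<and> s1 \<le> s2 \<and> t1 \<le> t2 \<and> cl C = rect p1 p2 q1 q2 \<and> p1 \<le> p2 \<and> q1 \<le> q2 \<and>
     gap p1 p2 s1 s2 + gap q1 q2 t1 t2 \<le> 2 \<and>
     cl A = rect (min s1 p1) (max s2 p2) (min t1 q1) (max t2 q2) \<and>
     (\<forall>D. D \<subset> C \<longrightarrow> far (cl D) (rect s1 s2 t1 t2))"

lemma cl_Un_rect:
  assumes B: "cl B = rect s1 s2 t1 t2" and C: "cl C = rect p1 p2 q1 q2"
    and near: "\<not> far (rect s1 s2 t1 t2) (rect p1 p2 q1 q2)"
  shows "cl (B \<union> C) = rect (min s1 p1) (max s2 p2) (min t1 q1) (max t2 q2)"
proof
  have "rect s1 s2 t1 t2 \<subseteq> cl (B \<union> C)" "rect p1 p2 q1 q2 \<subseteq> cl (B \<union> C)"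
    using cl_mono[of B "B \<union> C"] cl_mono[of C "B \<union> C"] B C by auto
  from nclosed_hull_rect[OF nclosed_cl this near]
  show "rect (min s1 p1) (max s2 p2) (min t1 q1) (max t2 q2) \<subseteq> cl (B \<union> C)" .
  have "B \<subseteq> rect s1 s2 t1 t2" "C \<subseteq> rect p1 p2 q1 q2" using subset_cl[of B] subset_cl[of C] B C by auto
  moreover have "rect s1 s2 t1 t2 \<subseteq> rect (min s1 p1) (max s2 p2) (min t1 q1) (max t2 q2)"
    "rect p1 p2 q1 q2 \<subseteq> rect (min s1 p1) (max s2 p2) (min t1 q1) (max t2 q2)"
    by (auto simp: rect_def)
  ultimately show "cl (B \<union> C) \<subseteq> rect (min s1 p1) (max s2 p2) (min t1 q1) (max t2 q2)"
    by (intro cl_least nclosed_rect Un_least) (auto elim: subset_trans)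
qed

lemma gap_commute: "gap a b a' b' = gap a' b' a b"
  by (simp add: gap_def max.commute)

lemma splitting_exists:
  assumes fin: "finite A" and ind: "indep A" and R: "is_rect (cl A)" and B: "B \<subset> A" "B \<noteq> {}"
    and S: "cl B = rect s1 s2 t1 t2" "s1 \<le> s2" "t1 \<le> t2"
    and max: "\<And>B'. B \<subset> B' \<Longrightarrow> B' \<subset> A \<Longrightarrow> is_rect (cl B') \<Longrightarrow> False"
  shows "\<exists>C p1 p2 q1 q2. splitting A B C s1 s2 t1 t2 p1 p2 q1 q2"
proof -
  obtain x1 x2 y1 y2 where x: "x1 \<le> x2" "y1 \<le> y2" "cl A = rect x1 x2 y1 y2" using R by (rule is_rectE)
  have near: "\<not> far (cl (A - B)) (cl B)"
  proof
    assume f: "far (cl (A - B)) (cl B)"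
    then have "nclosed (cl (A - B) \<union> cl B)" using nclosed_cl nclosed_Un_far by blast
    moreover have "A \<subseteq> cl (A - B) \<union> cl B" using subset_cl[of B] subset_cl[of "A - B"] by blast
    ultimately have cA: "cl A \<subseteq> cl (A - B) \<union> cl B" by (intro cl_least)
    obtain v where v: "v \<in> A" "v \<notin> B" using B by blast
    have "v \<notin> cl B" using indepD[OF ind v(1) _ v(2)] B by blast
    moreover have "v \<in> cl A" using v subset_cl by blast
    ultimately have ne: "rect s1 s2 t1 t2 \<noteq> rect x1 x2 y1 y2" using S x by metis
    have "rect s1 s2 t1 t2 \<subseteq> rect x1 x2 y1 y2" using cl_mono[of B A] B S x by auto
    then have le: "x1 \<le> s1" "s2 \<le> x2" "y1 \<le> t1" "t2 \<le> y2" using rect_subset_iff S by auto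
    obtain p q where pq: "p \<in> rect x1 x2 y1 y2" "p \<notin> rect s1 s2 t1 t2" "q \<in> rect s1 s2 t1 t2" "d1 p q = 1"
    proof -
      consider "x1 < s1" | "s2 < x2" | "y1 < t1" | "t2 < y2" using ne le by fastforce
      then show thesis
      proof cases
        case 1 then show ?thesis using that[of "(s1 - 1, t1)" "(s1, t1)"] S le by auto
      next
        case 2 then show ?thesis using that[of "(s2 + 1, t1)" "(s2, t1)"] S le by auto
      next
        case 3 then show ?thesis using that[of "(s1, t1 - 1)" "(s1, t1)"] S le by auto
      next
        case 4 then show ?thesis using that[of "(s1, t2 + 1)" "(s1, t2)"] S le by auto
      qed
    qed
    then have "p \<in> cl (A - B)" "q \<in> cl B" using cA x S by auto
    then have "3 \<le> d1 p q" using f unfolding far_def by blast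
    then show False using pq(4) by simp
  qed
  define P where "P C \<longleftrightarrow> C \<subseteq> A - B \<and> \<not> far (cl C) (cl B)" for C
  have "P (A - B)" unfolding P_def using near by simp
  then obtain C where C: "P C" and min: "\<And>D. P D \<Longrightarrow> card C \<le> card D"
    using ex_has_least_nat[of P _ card] by blast
  have CA: "C \<subseteq> A" "C \<inter> B = {}" "\<not> far (cl C) (cl B)" using C unfolding P_def by auto
  have finC: "finite C" using fin CA finite_subset by blast
  have "C \<noteq> {}" using CA(3) by auto
  have proper: "far (cl D) (cl B)" if "D \<subset> C" for D
  proof (rule ccontr)
    assume "\<not> far (cl D) (cl B)"
    then have "P D" using that C unfolding P_def by auto
    then have "card C \<le> card D" by (rule min)
    then show False using psubset_card_mono[OF finC that] by simp
  qed
  obtain F where FF: "\<Union>F = cl C" "\<forall>T\<in>F. is_rect T" "\<forall>T\<in>F. \<forall>U\<in>F. T \<noteq> U \<longrightarrow> far T U"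
    using rect_components[OF finC] by (elim exE conjE)
  have F: "\<Union>F = cl C" "\<And>T. T \<in> F \<Longrightarrow> is_rect T" "\<And>T U. T \<in> F \<Longrightarrow> U \<in> F \<Longrightarrow> T \<noteq> U \<Longrightarrow> far T U"
    using FF by simp_all
  obtain T where T: "T \<in> F" "\<not> far T (cl B)"
    using CA(3) unfolding F(1)[symmetric] far_def by blast
  have cT: "cl (C \<inter> T) = T"
    by (rule cl_component[OF F(1) nclosed_is_rect[OF F(2)] F(3) T(1)])
  have "C \<inter> T = C"
  proof (rule ccontr)
    assume "C \<inter> T \<noteq> C"
    then have "C \<inter> T \<subset> C" by blast
    from proper[OF this] show False using T(2) cT by simp
  qed
  then have "is_rect (cl C)" using cT F(2) T by simp
  then obtain p1 p2 q1 q2 where p: "p1 \<le> p2" "q1 \<le> q2" "cl C = rect p1 p2 q1 q2" by (rule is_rectE)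
  have g: "gap p1 p2 s1 s2 + gap q1 q2 t1 t2 \<le> 2"
    using CA(3) far_rect_iff[OF p(1,2) S(2,3)] p S by simp
  have hull: "cl (B \<union> C) = rect (min s1 p1) (max s2 p2) (min t1 q1) (max t2 q2)"
    by (rule cl_Un_rect[OF S(1) p(3)]) (use CA(3) S(1) p(3) far_commute in metis)
  have "is_rect (cl (B \<union> C))" unfolding hull using p S by (intro is_rectI) auto
  then have "A = B \<union> C" using max[of "B \<union> C"] B CA \<open>C \<noteq> {}\<close> by blast
  then show ?thesis
    unfolding splitting_def using CA \<open>C \<noteq> {}\<close> B S p g hull proper by (intro exI[of _ C] exI) auto
qed

lemma line_near_thick:
  assumes C: "cl C = rect p1 p2 q q" and near: "gap p1 p2 s1 s2 + gap q q t1 t2 \<le> 2"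
    and le: "p1 \<le> p2" "s1 \<le> s2" "t1 \<le> t2"
    and far: "\<And>w. w \<in> C \<Longrightarrow> far {w} (rect s1 s2 t1 t2)"
  shows "s1 = s2 \<and> p1 < s1 \<and> s1 < p2 \<and> gap q q t1 t2 = 2"
proof -
  have fw: "3 \<le> gap x x s1 s2 + gap q q t1 t2" if "(x, q) \<in> C" for x
    using far[OF that] far_point_rect_iff le by simp
  obtain x where x: "p1 \<le> x" "x \<le> p2" "gap x x s1 s2 = gap p1 p2 s1 s2"
  proof -
    consider "p2 < s1" | "s2 < p1" | "p1 \<le> s2" "s1 \<le> p2" by linarith
    then show thesis
    proof cases
      case 1 then show ?thesis using that[of p2] le by (auto simp: gap_def)
    next
      case 2 then show ?thesis using that[of p1] le by (auto simp: gap_def)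
    next
      case 3 then show ?thesis using that[of "max p1 s1"] le by (auto simp: gap_def)
    qed
  qed
  have "(x, q) \<notin> C" using fw[of x] x near by auto
  from line_point[OF C x(1,2) this] have n: "(x - 1, q) \<in> C" "(x + 1, q) \<in> C" by auto
  have "C \<subseteq> rect p1 p2 q q" using subset_cl[of C] C by simp
  then have "p1 < x" "x < p2" using n by auto
  moreover have "gap x x s1 s2 < gap (x - 1) (x - 1) s1 s2" "gap x x s1 s2 < gap (x + 1) (x + 1) s1 s2"
    using fw[OF n(1)] fw[OF n(2)] x near by auto
  then have "s1 = x \<and> s2 = x" using le unfolding gap_def by (smt (verit))
  moreover from this have "gap x x s1 s2 = 0" "gap (x - 1) (x - 1) s1 s2 = 1" by (auto simp: gap_def)
  ultimately show ?thesis using fw[OF n(1)] x near by auto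
qed

lemma line_near_thick_vertical:
  assumes C: "cl C = rect p p q1 q2" and near: "gap p p s1 s2 + gap q1 q2 t1 t2 \<le> 2"
    and le: "q1 \<le> q2" "s1 \<le> s2" "t1 \<le> t2"
    and far: "\<And>w. w \<in> C \<Longrightarrow> far {w} (rect s1 s2 t1 t2)"
  shows "t1 = t2 \<and> q1 < t1 \<and> t1 < q2 \<and> gap p p s1 s2 = 2"
proof -
  have "cl (prod.swap ` C) = rect q1 q2 p p" using C by (simp add: swap_facts)
  moreover have "far {w} (rect t1 t2 s1 s2)" if "w \<in> prod.swap ` C" for w
  proof -
    obtain v where "v \<in> C" "w = prod.swap v" using \<open>w \<in> prod.swap ` C\<close> by blast
    then show ?thesis using far[of v] swap_facts(2)[of "{v}" "rect s1 s2 t1 t2"] by simp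
  qed
  ultimately show ?thesis using line_near_thick[of "prod.swap ` C" q1 q2 p t1 t2 s1 s2] near le by simp
qed

lemma vertical_line_with_point_thick:
  assumes X: "cl X = rect s s t1 t2" "finite X" "2 \<le> card X" and w: "wx \<noteq> s" "t1 \<le> t2"
    and near: "\<not> far {(wx, wy)} (rect s s t1 t2)"
  shows "\<exists>D u1 u2 v1 v2. D \<subseteq> insert (wx, wy) X \<and> card D \<le> 3 \<and> cl D = rect u1 u2 v1 v2 \<and> u1 < u2 \<and> v1 < v2"
proof -
  have "cl (prod.swap ` X) = rect t1 t2 s s" using X by (simp add: swap_facts)
  moreover have "finite (prod.swap ` X)" "2 \<le> card (prod.swap ` X)" using X by (auto simp: card_image)
  moreover have "\<not> far {(wy, wx)} (rect t1 t2 s s)"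
    using near swap_facts(2)[of "{(wx, wy)}" "rect s s t1 t2"] by simp
  ultimately obtain D u1 u2 v1 v2 where D: "D \<subseteq> insert (wy, wx) (prod.swap ` X)" "card D \<le> 3"
    "cl D = rect u1 u2 v1 v2" "u1 < u2" "v1 < v2"
    using line_with_point_thick[of "prod.swap ` X" t1 t2 s wx wy] w by blast
  have "prod.swap ` D \<subseteq> insert (wx, wy) X" using D(1) by (auto dest!: subsetD)
  moreover have "card (prod.swap ` D) \<le> 3" using D(2) by (simp add: card_image)
  moreover have "cl (prod.swap ` D) = rect v1 v2 u1 u2" using D(3) by (simp add: swap_facts)
  ultimately show ?thesis using D(4,5) by blast
qed

lemma near_site_rows:
  assumes C: "cl C = rect p1 p2 q1 q2" "p1 \<le> p2" "q1 \<le> q2" and S: "s1 < s2" "t1 \<le> q1" "q2 \<le> t2"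
    and near: "gap p1 p2 s1 s2 \<le> 2"
  shows "\<exists>w\<in>C. \<not> far {w} (rect s1 s2 t1 t2)"
proof -
  have sub: "C \<subseteq> rect p1 p2 q1 q2" using subset_cl[of C] C by simp
  have *: "\<exists>w\<in>C. \<not> far {w} (rect s1 s2 t1 t2)" if "(x, y) \<in> C" "gap x x s1 s2 \<le> 2" for x y
  proof -
    have y: "q1 \<le> y" "y \<le> q2" using sub that by auto
    then have "gap y y t1 t2 = 0" using S by (auto simp: gap_def)
    then have "\<not> far {(x, y)} (rect s1 s2 t1 t2)" using far_point_rect_iff[of s1 s2 t1 t2 x y] that S C y by auto
    then show ?thesis using that by blast
  qed
  consider "s1 \<le> p1" | "p2 \<le> s2" | "p1 < s1" "s2 < p2" by linarith
  then show ?thesis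
  proof cases
    case 1
    obtain y where "(p1, y) \<in> C" using side_hit(1)[OF C] by blast
    then show ?thesis by (rule *) (use 1 near C S in \<open>auto simp: gap_def\<close>)
  next
    case 2
    obtain y where "(p2, y) \<in> C" using side_hit(2)[OF C] by blast
    then show ?thesis by (rule *) (use 2 near C S in \<open>auto simp: gap_def\<close>)
  next
    case 3
    obtain x y where "(x, y) \<in> C" "x = s1 \<or> x = s1 + 1" using two_columns_hit[OF C, of s1] 3 S by auto
    then show ?thesis by (intro *[of x y]) (use S in \<open>auto simp: gap_def\<close>)
  qed
qed

lemma near_site_columns:
  assumes C: "cl C = rect p1 p2 q1 q2" "p1 \<le> p2" "q1 \<le> q2" and S: "t1 < t2" "s1 \<le> p1" "p2 \<le> s2"
    and near: "gap q1 q2 t1 t2 \<le> 2"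
  shows "\<exists>w\<in>C. \<not> far {w} (rect s1 s2 t1 t2)"
proof -
  have "cl (prod.swap ` C) = rect q1 q2 p1 p2" using C by (simp add: swap_facts)
  from near_site_rows[OF this C(3,2) S near] obtain v where v: "v \<in> C" "\<not> far {prod.swap v} (rect t1 t2 s1 s2)"
    by blast
  then show ?thesis using swap_facts(2)[of "{v}" "rect s1 s2 t1 t2"] by auto
qed

lemma maximal_proper_subset:
  assumes "finite A" "B0 \<subset> A" "\<Phi> B0"
  obtains B where "B \<subset> A" "\<Phi> B" "\<And>B'. B \<subset> B' \<Longrightarrow> B' \<subset> A \<Longrightarrow> \<not> \<Phi> B'"
proof -
  have "finite {B. B \<subset> A \<and> \<Phi> B}" by (rule finite_subset[of _ "Pow A"]) (use assms in auto)
  moreover have "{B. B \<subset> A \<and> \<Phi> B} \<noteq> {}" using assms by blast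
  ultimately have "\<exists>B\<in>{B. B \<subset> A \<and> \<Phi> B}. \<forall>B'\<in>{B. B \<subset> A \<and> \<Phi> B}. B \<subseteq> B' \<longrightarrow> B = B'"
    by (rule finite_has_maximal)
  then obtain B where B: "B \<subset> A" "\<Phi> B" and max: "\<forall>B'\<in>{B. B \<subset> A \<and> \<Phi> B}. B \<subseteq> B' \<longrightarrow> B = B'"
    by auto
  show thesis
  proof (rule that[OF B])
    fix B' assume "B \<subset> B'" "B' \<subset> A"
    then show "\<not> \<Phi> B'" using bspec[OF max, of B'] by auto
  qed
qed

definition thick :: "(int \<times> int) set \<Rightarrow> bool" where
  "thick S \<longleftrightarrow> (\<exists>s1 s2 t1 t2. s1 < s2 \<and> t1 < t2 \<and> S = rect s1 s2 t1 t2)"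

lemma thick_rect_iff: "a \<le> b \<Longrightarrow> c \<le> d \<Longrightarrow> thick (rect a b c d) \<longleftrightarrow> a < b \<and> c < d"
  unfolding thick_def using rect_eq_iff[of a b c d] by auto

lemma card_le_3_if_thin:
  assumes fin: "finite A" and ind: "indep A" and R: "cl A = rect x1 x2 y1 y2" "x1 < x2" "y1 < y2"
    and thin: "\<And>D. D \<subset> A \<Longrightarrow> \<not> thick (cl D)"
  shows "card A \<le> 3"
proof (rule ccontr)
  assume c4: "\<not> card A \<le> 3"
  have big: "False" if "D \<subseteq> A" "card D \<le> 3" "cl D = rect u1 u2 v1 v2" "u1 < u2" "v1 < v2" for D u1 u2 v1 v2
  proof -
    have "D \<subset> A" using that c4 by auto
    then show False using thin[of D] that unfolding thick_def by blast
  qed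
  obtain v where v: "v \<in> A" using side_hit(1)[OF R(1)] R by fastforce
  have "{v} \<subset> A" using v c4 by auto
  moreover have "is_rect (cl {v})" by (simp add: is_rect_singleton)
  ultimately have "{v} \<subset> A \<and> ({v} \<noteq> {} \<and> is_rect (cl {v}))" by simp
  then obtain B where B: "B \<subset> A" "B \<noteq> {} \<and> is_rect (cl B)"
    "\<And>B'. B \<subset> B' \<Longrightarrow> B' \<subset> A \<Longrightarrow> \<not> (B' \<noteq> {} \<and> is_rect (cl B'))"
    using maximal_proper_subset[OF fin, of "{v}" "\<lambda>B. B \<noteq> {} \<and> is_rect (cl B)"] by blast
  obtain s1 s2 t1 t2 where S: "s1 \<le> s2" "t1 \<le> t2" "cl B = rect s1 s2 t1 t2" 
    using conjunct2[OF B(2)] by (rule is_rectE)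
  have "is_rect (cl A)" unfolding R(1) using R by (intro is_rectI) auto
  from splitting_exists[OF fin ind this B(1) _ S(3,1,2)] B
  obtain C p1 p2 q1 q2 where sp: "splitting A B C s1 s2 t1 t2 p1 p2 q1 q2" by blast
  then have AC: "A = B \<union> C" "B \<inter> C = {}" "C \<noteq> {}" "cl C = rect p1 p2 q1 q2" "p1 \<le> p2" "q1 \<le> q2"
    "gap p1 p2 s1 s2 + gap q1 q2 t1 t2 \<le> 2"
    and AR: "cl A = rect (min s1 p1) (max s2 p2) (min t1 q1) (max t2 q2)"
    and pr: "\<And>D. D \<subset> C \<Longrightarrow> far (cl D) (rect s1 s2 t1 t2)"
    unfolding splitting_def by blast+
  have Rm: "min s1 p1 < max s2 p2" "min t1 q1 < max t2 q2"
    using AR R rect_eq_iff[of x1 x2 y1 y2] by auto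
  have finBC: "finite B" "finite C" using fin AC by auto
  have "C \<subset> A" using AC B(2) by blast
  then have thinBC: "s1 = s2 \<or> t1 = t2" "p1 = p2 \<or> q1 = q2"
    using thin[OF B(1)] thin[of C] thick_rect_iff S AC by auto
  have CC: "C \<subseteq> rect p1 p2 q1 q2" "B \<subseteq> rect s1 s2 t1 t2" using subset_cl[of C] subset_cl[of B] AC S by auto
  show False
  proof (cases "card C \<le> 1")
    case True
    then have "card C = 1" using finBC AC(3) card_0_eq[of C] by linarith
    then obtain w where "C = {w}" by (auto simp: card_1_singleton_iff)
    then obtain wx wy where w: "C = {(wx, wy)}" by (cases w) auto
    have "rect wx wx wy wy = rect p1 p2 q1 q2" using AC(4) unfolding w point_rect by (simp add: cl_nclosed nclosed_rect)
    then have p: "p1 = wx" "p2 = wx" "q1 = wy" "q2 = wy" by (simp_all add: rect_eq_iff)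
    have cB: "2 \<le> card B" using c4 AC(1,2) w finBC card_Un_disjoint[of B C] by simp
    have near: "\<not> far {(wx, wy)} (rect s1 s2 t1 t2)"
      using AC(7) far_point_rect_iff[OF S(1,2)] unfolding p by simp
    from thinBC(1) show False
    proof
      assume t: "t1 = t2"
      then have "wy \<noteq> t1" using Rm p by auto
      moreover have "cl B = rect s1 s2 t1 t1" "\<not> far {(wx, wy)} (rect s1 s2 t1 t1)" using near S(3) t by simp_all
      ultimately obtain D u1 u2 v1 v2 where D: "D \<subseteq> insert (wx, wy) B" "card D \<le> 3" "cl D = rect u1 u2 v1 v2" "u1 < u2" "v1 < v2"
        using line_with_point_thick[of B s1 s2 t1 wy wx] finBC(1) cB S(1) by metis
      have "D \<subseteq> A" using D(1) AC(1) w by auto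
      then show False using big D(2-5) by metis
    next
      assume s: "s1 = s2"
      then have "wx \<noteq> s1" using Rm p by auto
      moreover have "cl B = rect s1 s1 t1 t2" "\<not> far {(wx, wy)} (rect s1 s1 t1 t2)" using near S(3) s by simp_all
      ultimately obtain D u1 u2 v1 v2 where D: "D \<subseteq> insert (wx, wy) B" "card D \<le> 3" "cl D = rect u1 u2 v1 v2" "u1 < u2" "v1 < v2"
        using vertical_line_with_point_thick[of B s1 t1 t2 wx wy] finBC(1) cB S(2) by metis
      have "D \<subseteq> A" using D(1) AC(1) w by auto
      then show False using big D(2-5) by metis
    qed
  next
    case False
    then have cC: "2 \<le> card C" by simp
    have fw: "far {w} (rect s1 s2 t1 t2)" if "w \<in> C" for w
    proof -
      have "{w} \<subset> C" using that False by auto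
      from pr[OF this] show ?thesis by simp
    qed
    from thinBC(2) show False
    proof
      assume q: "q1 = q2"
      have l: "s1 = s2" "p1 < s1" "s1 < p2" "gap q1 q1 t1 t2 = 2"
        using line_near_thick[of C p1 p2 q1 s1 s2 t1 t2] AC q S fw by auto
      obtain ty where ty: "(s1, ty) \<in> B" "\<bar>ty - q1\<bar> = 2"
      proof -
        consider "t1 = q1 + 2" | "t2 = q1 - 2" using l(4) S by (auto simp: gap_def max_def split: if_splits)
        then show thesis
        proof cases
          case 1
          obtain x where "(x, t1) \<in> B" using side_hit(3)[OF S(3,1,2)] by blast
          moreover from this have "x = s1" using subsetD[OF CC(2)] l(1) by fastforce
          ultimately show ?thesis using that[of t1] 1 by auto
        next
          case 2
          obtain x where "(x, t2) \<in> B" using side_hit(4)[OF S(3,1,2)] by blast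
          moreover from this have "x = s1" using subsetD[OF CC(2)] l(1) by fastforce
          ultimately show ?thesis using that[of t2] 2 by auto
        qed
      qed
      have "\<not> far {(s1, ty)} (rect p1 p2 q1 q1)"
        using far_point_rect_iff[of p1 p2 q1 q1 s1 ty] ty l by (auto simp: gap_def)
      moreover have "ty \<noteq> q1" using ty by auto
      moreover have "cl C = rect p1 p2 q1 q1" using AC(4) q by simp
      ultimately obtain D u1 u2 v1 v2 where D: "D \<subseteq> insert (s1, ty) C" "card D \<le> 3" "cl D = rect u1 u2 v1 v2" "u1 < u2" "v1 < v2"
        using line_with_point_thick[of C p1 p2 q1 ty s1] AC(5) finBC(2) cC by metis
      have "D \<subseteq> A" using D(1) AC(1) ty by auto
      then show False using big D(2-5) by metis
    next
      assume p: "p1 = p2"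
      have l: "t1 = t2" "q1 < t1" "t1 < q2" "gap p1 p1 s1 s2 = 2"
        using line_near_thick_vertical[of C p1 q1 q2 s1 s2 t1 t2] AC p S fw by auto
      obtain tx where tx: "(tx, t1) \<in> B" "\<bar>tx - p1\<bar> = 2"
      proof -
        consider "s1 = p1 + 2" | "s2 = p1 - 2" using l(4) S by (auto simp: gap_def max_def split: if_splits)
        then show thesis
        proof cases
          case 1
          obtain y where "(s1, y) \<in> B" using side_hit(1)[OF S(3,1,2)] by blast
          moreover from this have "y = t1" using subsetD[OF CC(2)] l(1) by fastforce
          ultimately show ?thesis using that[of s1] 1 by auto
        next
          case 2
          obtain y where "(s2, y) \<in> B" using side_hit(2)[OF S(3,1,2)] by blast
          moreover from this have "y = t1" using subsetD[OF CC(2)] l(1) by fastforce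
          ultimately show ?thesis using that[of s2] 2 by auto
        qed
      qed
      have "\<not> far {(tx, t1)} (rect p1 p1 q1 q2)"
        using far_point_rect_iff[of p1 p1 q1 q2 tx t1] tx l by (auto simp: gap_def)
      moreover have "tx \<noteq> p1" using tx by auto
      moreover have "cl C = rect p1 p1 q1 q2" using AC(4) p by simp
      ultimately obtain D u1 u2 v1 v2 where D: "D \<subseteq> insert (tx, t1) C" "card D \<le> 3" "cl D = rect u1 u2 v1 v2" "u1 < u2" "v1 < v2"
        using vertical_line_with_point_thick[of C p1 q1 q2 tx t1] AC(6) finBC(2) cC by metis
      have "D \<subseteq> A" using D(1) AC(1) tx by auto
      then show False using big D(2-5) by metis
    qed
  qed
qed

lemma gap_nonneg: "0 \<le> gap a b a' b'"
  by (simp add: gap_def)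

lemma splittingD:
  assumes "splitting A B C s1 s2 t1 t2 p1 p2 q1 q2"
  shows "A = B \<union> C" "B \<inter> C = {}" "B \<noteq> {}" "C \<noteq> {}"
    "cl B = rect s1 s2 t1 t2" "s1 \<le> s2" "t1 \<le> t2" "cl C = rect p1 p2 q1 q2" "p1 \<le> p2" "q1 \<le> q2"
    "gap p1 p2 s1 s2 + gap q1 q2 t1 t2 \<le> 2"
    "cl A = rect (min s1 p1) (max s2 p2) (min t1 q1) (max t2 q2)"
    "\<And>D. D \<subset> C \<Longrightarrow> far (cl D) (rect s1 s2 t1 t2)"
  using assms unfolding splitting_def by blast+

definition single_split :: "(int \<times> int) set \<Rightarrow> (int \<times> int) set \<Rightarrow> (int \<times> int) set \<Rightarrow>
    int \<Rightarrow> int \<Rightarrow> int \<Rightarrow> int \<Rightarrow> int \<Rightarrow> int \<Rightarrow> int \<Rightarrow> int \<Rightarrow> bool" where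
  "single_split A B C s1 s2 t1 t2 p1 p2 q1 q2 \<longleftrightarrow> splitting A B C s1 s2 t1 t2 p1 p2 q1 q2 \<and>
     p1 = p2 \<and> q1 = q2 \<and> C = {(p1, q1)} \<and> ((s1 < s2 \<and> t1 < t2) \<or> card B \<le> 2)"

definition corner_split :: "(int \<times> int) set \<Rightarrow> (int \<times> int) set \<Rightarrow> (int \<times> int) set \<Rightarrow>
    int \<Rightarrow> int \<Rightarrow> int \<Rightarrow> int \<Rightarrow> int \<Rightarrow> int \<Rightarrow> int \<Rightarrow> int \<Rightarrow> bool" where
  "corner_split A B C s1 s2 t1 t2 p1 p2 q1 q2 \<longleftrightarrow> splitting A B C s1 s2 t1 t2 p1 p2 q1 q2 \<and>
     2 \<le> card C \<and> s1 < s2 \<and> t1 < t2 \<and> p1 < p2 \<and> q1 < q2 \<and>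
     (s1 < p1 \<and> s2 < p2 \<or> p1 < s1 \<and> p2 < s2) \<and> (t1 < q1 \<and> t2 < q2 \<or> q1 < t1 \<and> q2 < t2)"

lemma single_splitI:
  assumes "splitting A B C s1 s2 t1 t2 p1 p2 q1 q2" "C = {w}" "(s1 < s2 \<and> t1 < t2) \<or> card B \<le> 2"
  shows "single_split A B C s1 s2 t1 t2 p1 p2 q1 q2"
proof -
  have "{w} = rect p1 p2 q1 q2" using splittingD(8)[OF assms(1)] assms(2) by simp
  then have "rect (fst w) (fst w) (snd w) (snd w) = rect p1 p2 q1 q2"
    using point_rect[of "fst w" "snd w"] by simp
  then have "p1 = fst w" "p2 = fst w" "q1 = snd w" "q2 = snd w" by (simp_all add: rect_eq_iff)
  then show ?thesis using assms unfolding single_split_def by simp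
qed

lemma splitting_swap:
  assumes sp: "splitting A B C s1 s2 t1 t2 p1 p2 q1 q2" and B: "card B = 1"
  shows "splitting A C B p1 p2 q1 q2 s1 s2 t1 t2"
proof -
  note d = splittingD[OF sp]
  have "D = {}" if "D \<subset> B" for D
    using that B by (auto simp: card_1_singleton_iff)
  then have e: "\<forall>D. D \<subset> B \<longrightarrow> far (cl D) (rect p1 p2 q1 q2)" using cl_empty far_empty(1) by metis
  have c: "A = C \<union> B" "C \<inter> B = {}" using d(1,2) by auto
  have g: "gap s1 s2 p1 p2 + gap t1 t2 q1 q2 \<le> 2" using d(11) by (simp add: gap_commute)
  have h: "cl A = rect (min p1 s1) (max p2 s2) (min q1 t1) (max q2 t2)"
    using d(12) by (simp add: min.commute max.commute)
  show ?thesis unfolding splitting_def by (intro conjI d(3-10) e c g h)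
qed

theorem split_exists:
  assumes fin: "finite A" and ind: "indep A" and R: "cl A = rect x1 x2 y1 y2" "x1 < x2" "y1 < y2"
  shows "\<exists>B C s1 s2 t1 t2 p1 p2 q1 q2.
    single_split A B C s1 s2 t1 t2 p1 p2 q1 q2 \<or> corner_split A B C s1 s2 t1 t2 p1 p2 q1 q2"
proof -
  have rA: "is_rect (cl A)" unfolding R(1) using R by (intro is_rectI) auto
  define full where "full S \<longleftrightarrow> (\<exists>s1 s2 t1 t2. s1 < s2 \<and> t1 < t2 \<and> S = rect s1 s2 t1 t2 \<and>
    (s1 = x1 \<and> s2 = x2 \<or> t1 = y1 \<and> t2 = y2))" for S
  have mono: "(full (cl B) \<longrightarrow> full (cl B')) \<and> (thick (cl B) \<longrightarrow> thick (cl B'))"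
    if BB: "B \<subset> B'" "B' \<subset> A" "is_rect (cl B')" for B B'
  proof -
    obtain u1 u2 v1 v2 where u: "u1 \<le> u2" "v1 \<le> v2" "cl B' = rect u1 u2 v1 v2" using BB(3) by (rule is_rectE)
    have "rect u1 u2 v1 v2 \<subseteq> rect x1 x2 y1 y2" using cl_mono[of B' A] BB R u by auto
    then have ux: "x1 \<le> u1" "u2 \<le> x2" "y1 \<le> v1" "v2 \<le> y2" using rect_subset_iff[OF u(1,2)] by auto
    have sub: "cl B \<subseteq> rect u1 u2 v1 v2" using cl_mono[of B B'] BB u by auto
    have *: "u1 \<le> s1 \<and> s2 \<le> u2 \<and> v1 \<le> t1 \<and> t2 \<le> v2" if "s1 < s2" "t1 < t2" "cl B = rect s1 s2 t1 t2" for s1 s2 t1 t2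
      using sub that rect_subset_iff[of s1 s2 t1 t2] by auto
    have "full (cl B')" if f: "full (cl B)"
    proof -
      obtain s1 s2 t1 t2 where s: "s1 < s2" "t1 < t2" "cl B = rect s1 s2 t1 t2" "s1 = x1 \<and> s2 = x2 \<or> t1 = y1 \<and> t2 = y2"
        using f unfolding full_def by (elim exE conjE)
      have "u1 < u2" "v1 < v2" using *[OF s(1-3)] s(1,2) by linarith+
      moreover have "u1 = x1 \<and> u2 = x2 \<or> v1 = y1 \<and> v2 = y2" using *[OF s(1-3)] s(4) ux by linarith
      ultimately show ?thesis unfolding full_def u(3)
        by (intro exI[of _ u1] exI[of _ u2] exI[of _ v1] exI[of _ v2] conjI refl)
    qed
    moreover have "thick (cl B')" if f: "thick (cl B)"
    proof -
      obtain s1 s2 t1 t2 where s: "s1 < s2" "t1 < t2" "cl B = rect s1 s2 t1 t2"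
        using f unfolding thick_def by (elim exE conjE)
      have "u1 < u2" "v1 < v2" using *[OF s(1-3)] s(1,2) by linarith+
      then show ?thesis unfolding thick_def u(3)
        by (intro exI[of _ u1] exI[of _ u2] exI[of _ v1] exI[of _ v2] conjI refl)
    qed
    ultimately show ?thesis by blast
  qed
  have ne: "B \<noteq> {}" if "cl B = rect s1 s2 t1 t2" "s1 \<le> s2" "t1 \<le> t2" for B s1 s2 t1 t2
  proof
    assume "B = {}"
    then have "rect s1 s2 t1 t2 = {}" using that by simp
    moreover have "(s1, t1) \<in> rect s1 s2 t1 t2" using that by simp
    ultimately show False by blast
  qed
  consider (full) B0 where "B0 \<subset> A" "full (cl B0)"
    | (thick) B0 where "B0 \<subset> A" "thick (cl B0)" "\<And>B. B \<subset> A \<Longrightarrow> \<not> full (cl B)"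
    | (thin) "\<And>B. B \<subset> A \<Longrightarrow> \<not> thick (cl B)"
    by blast
  then show ?thesis
  proof cases
    case full
    obtain B where B: "B \<subset> A" "full (cl B)" "\<And>B'. B \<subset> B' \<Longrightarrow> B' \<subset> A \<Longrightarrow> \<not> full (cl B')"
      using maximal_proper_subset[OF fin, of B0 "\<lambda>B. full (cl B)"] full by blast
    obtain s1 s2 t1 t2 where s: "s1 < s2" "t1 < t2" "cl B = rect s1 s2 t1 t2" "s1 = x1 \<and> s2 = x2 \<or> t1 = y1 \<and> t2 = y2"
      using B(2) unfolding full_def by (elim exE conjE)
    have le: "s1 \<le> s2" "t1 \<le> t2" using s by auto
    have "False" if "B \<subset> B'" "B' \<subset> A" "is_rect (cl B')" for B'
      using mono[OF that] B(2) B(3)[OF that(1,2)] by simp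
    from splitting_exists[OF fin ind rA B(1) ne[OF s(3) le] s(3) le this]
    have "\<exists>C p1 p2 q1 q2. splitting A B C s1 s2 t1 t2 p1 p2 q1 q2" by simp
    then obtain C p1 p2 q1 q2 where sp: "splitting A B C s1 s2 t1 t2 p1 p2 q1 q2" by (elim exE)
    note d = splittingD[OF sp]
    have x: "x1 = min s1 p1" "x2 = max s2 p2" "y1 = min t1 q1" "y2 = max t2 q2"
      using d(12) R rect_eq_iff[of x1 x2 y1 y2] by auto
    have "\<exists>w\<in>C. \<not> far {w} (rect s1 s2 t1 t2)"
      using s(4)
    proof
      assume "s1 = x1 \<and> s2 = x2"
      then have "s1 \<le> p1" "p2 \<le> s2" using x by linarith+
      moreover have "gap q1 q2 t1 t2 \<le> 2" using d(11) gap_nonneg[of p1 p2 s1 s2] by linarith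
      ultimately show ?thesis using near_site_columns[OF d(8-10) s(2)] by simp
    next
      assume "t1 = y1 \<and> t2 = y2"
      then have "t1 \<le> q1" "q2 \<le> t2" using x by linarith+
      moreover have "gap p1 p2 s1 s2 \<le> 2" using d(11) gap_nonneg[of q1 q2 t1 t2] by linarith
      ultimately show ?thesis using near_site_rows[OF d(8-10) s(1)] by simp
    qed
    then obtain w where w: "w \<in> C" "\<not> far {w} (rect s1 s2 t1 t2)" by blast
    then have "C = {w}" using d(13)[of "{w}"] by auto
    from single_splitI[OF sp this] s show ?thesis by blast
  next
    case thick
    obtain B where B: "B \<subset> A" "thick (cl B)" "\<And>B'. B \<subset> B' \<Longrightarrow> B' \<subset> A \<Longrightarrow> \<not> thick (cl B')"
      using maximal_proper_subset[OF fin, of B0 "\<lambda>B. thick (cl B)"] thick by blast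
    obtain s1 s2 t1 t2 where s: "s1 < s2" "t1 < t2" "cl B = rect s1 s2 t1 t2"
      using B(2) unfolding thick_def by (elim exE conjE)
    have le: "s1 \<le> s2" "t1 \<le> t2" using s by auto
    have "False" if "B \<subset> B'" "B' \<subset> A" "is_rect (cl B')" for B'
      using mono[OF that] B(2) B(3)[OF that(1,2)] by simp
    from splitting_exists[OF fin ind rA B(1) ne[OF s(3) le] s(3) le this]
    have "\<exists>C p1 p2 q1 q2. splitting A B C s1 s2 t1 t2 p1 p2 q1 q2" by simp
    then obtain C p1 p2 q1 q2 where sp: "splitting A B C s1 s2 t1 t2 p1 p2 q1 q2" by (elim exE)
    note d = splittingD[OF sp]
    have x: "x1 = min s1 p1" "x2 = max s2 p2" "y1 = min t1 q1" "y2 = max t2 q2"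
      using d(12) R rect_eq_iff[of x1 x2 y1 y2] by auto
    have finC: "finite C" using fin d(1) by auto
    show ?thesis
    proof (cases "card C \<le> 1")
      case True
      then have "card C = 1" using finC d(4) card_0_eq[of C] by linarith
      then obtain w where "C = {w}" by (auto simp: card_1_singleton_iff)
      from single_splitI[OF sp this] s show ?thesis by blast
    next
      case False
      have fw: "far {w} (rect s1 s2 t1 t2)" if "w \<in> C" for w
        using d(13)[of "{w}"] that False by (cases "C = {w}") auto
      have "q1 \<noteq> q2" using line_near_thick[of C p1 p2 q1 s1 s2 t1 t2] d s fw by auto
      moreover have "p1 \<noteq> p2" using line_near_thick_vertical[of C p1 q1 q2 s1 s2 t1 t2] d s fw by auto
      ultimately have pq: "p1 < p2" "q1 < q2" using d by auto
      have "C \<subset> A" using d(1-3) by blast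
      then have "\<not> full (cl C)" "\<not> full (cl B)" using thick(3) B(1) by blast+
      then have nf: "\<not> (s1 = x1 \<and> s2 = x2)" "\<not> (t1 = y1 \<and> t2 = y2)" "\<not> (p1 = x1 \<and> p2 = x2)" "\<not> (q1 = y1 \<and> q2 = y2)"
        unfolding full_def d(8) s(3) using pq s by blast+
      then have "(s1 < p1 \<and> s2 < p2 \<or> p1 < s1 \<and> p2 < s2) \<and> (t1 < q1 \<and> t2 < q2 \<or> q1 < t1 \<and> q2 < t2)"
        unfolding x by (auto simp: min_def max_def split: if_splits)
      then have "corner_split A B C s1 s2 t1 t2 p1 p2 q1 q2"
        unfolding corner_split_def using sp pq s False by simp
      then show ?thesis by blast
    qed
  next
    case thin
    have c3: "card A \<le> 3" by (rule card_le_3_if_thin[OF fin ind R thin])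
    obtain v where v: "v \<in> A" using side_hit(1)[OF R(1)] R by fastforce
    have "{v} \<subset> A"
    proof (rule ccontr)
      assume "\<not> {v} \<subset> A"
      then have "A = {v}" using v by auto
      then have "rect x1 x2 y1 y2 = {v}" using R by simp
      moreover have "(x1, y1) \<in> rect x1 x2 y1 y2" "(x2, y2) \<in> rect x1 x2 y1 y2" using R by auto
      ultimately show False using R by auto
    qed
    then obtain B where B: "B \<subset> A" "B \<noteq> {} \<and> is_rect (cl B)"
      "\<And>B'. B \<subset> B' \<Longrightarrow> B' \<subset> A \<Longrightarrow> \<not> (B' \<noteq> {} \<and> is_rect (cl B'))"
      using maximal_proper_subset[OF fin, of "{v}" "\<lambda>B. B \<noteq> {} \<and> is_rect (cl B)"] is_rect_singleton by auto
    obtain s1 s2 t1 t2 where S: "s1 \<le> s2" "t1 \<le> t2" "cl B = rect s1 s2 t1 t2"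
      using conjunct2[OF B(2)] by (rule is_rectE)
    have "False" if "B \<subset> B'" "B' \<subset> A" "is_rect (cl B')" for B'
      using B(3)[OF that(1,2)] that by auto
    from splitting_exists[OF fin ind rA B(1) conjunct1[OF B(2)] S(3,1,2) this]
    have "\<exists>C p1 p2 q1 q2. splitting A B C s1 s2 t1 t2 p1 p2 q1 q2" by simp
    then obtain C p1 p2 q1 q2 where sp: "splitting A B C s1 s2 t1 t2 p1 p2 q1 q2" by (elim exE)
    note d = splittingD[OF sp]
    have f: "finite B" "finite C" using fin d(1) by auto
    have sum: "card A = card B + card C" unfolding d(1) by (rule card_Un_disjoint) (use f d in auto)
    have pos: "1 \<le> card B" "1 \<le> card C" using f d(3,4) by (simp_all add: Suc_le_eq card_gt_0_iff)
    show ?thesis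
    proof (cases "card C = 1")
      case True
      then obtain w where "C = {w}" by (auto simp: card_1_singleton_iff)
      moreover have "card B \<le> 2" using sum c3 True by linarith
      ultimately show ?thesis using single_splitI[OF sp] by blast
    next
      case False
      then have "card B = 1" "card C \<le> 2" using sum c3 pos by auto
      then obtain w where "B = {w}" by (auto simp: card_1_singleton_iff)
      from single_splitI[OF splitting_swap[OF sp \<open>card B = 1\<close>] this] \<open>card C \<le> 2\<close> show ?thesis by blast
    qed
  qed
qed

section \<open>Two rows\<close>

lemma triple_free_card:
  fixes Z :: "int set"
  assumes "\<And>e. e - 1 \<in> Z \<Longrightarrow> e \<in> Z \<Longrightarrow> e + 1 \<in> Z \<Longrightarrow> False"
  shows "Z \<subseteq> {a..a + int n - 1} \<Longrightarrow> 3 * card Z \<le> 2 * n + 2"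
  using assms
proof (induction n arbitrary: Z rule: less_induct)
  case (less n)
  have fin: "finite Z" using less.prems(1) finite_subset by blast
  show ?case
  proof (cases "n < 3")
    case True
    have "card Z \<le> n" using card_mono[OF _ less.prems(1)] by simp
    then show ?thesis using True by linarith
  next
    case False
    let ?Y = "Z \<inter> {a..a + int (n - 3) - 1}" and ?T = "Z \<inter> {a + int n - 3, a + int n - 2, a + int n - 1}"
    have "\<not> {a + int n - 3, a + int n - 2, a + int n - 1} \<subseteq> Z"
      using less.prems(2)[of "a + int n - 2"] by (auto simp: algebra_simps)
    then have "?T \<subset> {a + int n - 3, a + int n - 2, a + int n - 1}" by blast
    then have "card ?T < card {a + int n - 3, a + int n - 2, a + int n - 1}" by (intro psubset_card_mono) auto
    then have T: "card ?T \<le> 2" by simp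
    have "3 * card ?Y \<le> 2 * (n - 3) + 2"
      by (rule less.IH) (use False less.prems(2) in auto)
    moreover have "Z \<subseteq> ?Y \<union> ?T"
    proof
      fix z assume z: "z \<in> Z"
      then have "a \<le> z" "z \<le> a + int n - 1" using less.prems(1) by auto
      then have "z \<le> a + int (n - 3) - 1 \<or> z = a + int n - 3 \<or> z = a + int n - 2 \<or> z = a + int n - 1"
        using False by linarith
      then show "z \<in> ?Y \<union> ?T" using z \<open>a \<le> z\<close> by auto
    qed
    then have "card Z \<le> card (?Y \<union> ?T)" using fin by (intro card_mono) auto
    then have "card Z \<le> card ?Y + card ?T" using card_Un_le[of ?Y ?T] by linarith
    ultimately show ?thesis using T False by linarith
  qed
qed

lemma redundant_column_site:
  assumes ind: "indep A" and R: "cl A = rect x1 x2 y1 y2" and B: "B \<subseteq> A" "cl B = rect c d y1 y2" "c \<le> d" "y1 \<le> y2"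
    and v: "v \<in> A" "d < fst v"
    and cov: "\<And>e. d \<le> e \<Longrightarrow> e < x2 \<Longrightarrow> \<exists>p\<in>A - {v}. fst p = e + 1 \<or> fst p = e + 2"
  shows False
proof -
  have BR: "B \<subseteq> rect c d y1 y2" using subset_cl[of B] B by simp
  have AR: "A \<subseteq> rect x1 x2 y1 y2" using subset_cl[of A] R by simp
  have vB: "v \<notin> B" using BR v(2) by (cases v) auto
  have *: "e \<le> x2 \<Longrightarrow> rect c e y1 y2 \<subseteq> cl (A - {v})" if "d \<le> e" for e
    using that
  proof (induction e rule: int_ge_induct)
    case base
    show ?case using cl_mono[of B "A - {v}"] B vB by auto
  next
    case (step e)
    obtain p where p: "p \<in> A - {v}" "fst p = e + 1 \<or> fst p = e + 2" using cov[of e] step by auto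
    obtain x y where xy: "p = (x, y)" by fastforce
    have 1: "rect c e y1 y2 \<subseteq> cl (A - {v})" using step by auto
    have "(x, y) \<in> cl (A - {v})" using p xy subset_cl[of "A - {v}"] by auto
    moreover have "y1 \<le> y" "y \<le> y2" using AR p xy by auto
    ultimately have "rect c x y1 y2 \<subseteq> cl (A - {v})"
      by (intro extend_right[OF nclosed_cl 1]) (use p xy step B in auto)
    moreover have "rect c (e + 1) y1 y2 \<subseteq> rect c x y1 y2" using p xy by (auto simp: rect_def)
    ultimately show ?case by blast
  qed
  have vR: "v \<in> rect x1 x2 y1 y2" using AR v by blast
  then have "d \<le> x2" using v(2) by (cases v) auto
  then have "rect c x2 y1 y2 \<subseteq> cl (A - {v})" using * by simp
  moreover have "v \<in> rect c x2 y1 y2" using vR v(2) B(3) by (cases v) auto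
  ultimately show False using ind v(1) unfolding indep_def by blast
qed

lemma right_columns:
  assumes fin: "finite A" and ind: "indep A" and R: "cl A = rect x1 x2 y1 y2" "x1 \<le> x2"
    and B: "B \<subseteq> A" "cl B = rect c d y1 y2" "c \<le> d" "y1 \<le> y2"
  defines "Z \<equiv> {p \<in> A. d < fst p}"
  shows "card Z = card (fst ` Z)" "fst ` Z \<subseteq> {d + 1..x2}"
    "\<And>e. e - 1 \<in> insert d (fst ` Z) \<Longrightarrow> e \<in> fst ` Z \<Longrightarrow> e + 1 \<in> fst ` Z \<Longrightarrow> False"
    "3 * int (card Z) \<le> 2 * (x2 - d) + 1" "x2 = d \<Longrightarrow> card Z = 0" "d \<le> x2"
proof -
  have AR: "A \<subseteq> rect x1 x2 y1 y2" using subset_cl[of A] R by simp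
  have "rect c d y1 y2 \<subseteq> rect x1 x2 y1 y2" using cl_mono[of B A] B R by auto
  then show dx: "d \<le> x2" using rect_subset_iff B by auto
  have "x1 \<le> d" using \<open>rect c d y1 y2 \<subseteq> rect x1 x2 y1 y2\<close> rect_subset_iff B by auto
  have hit: "\<exists>p\<in>A. fst p = e + 1 \<or> fst p = e + 2" if "d \<le> e" "e < x2" for e
    using two_columns_hit[OF R(1,2) B(4), of "e + 1"] that \<open>x1 \<le> d\<close> by force
  have inj: "inj_on fst Z"
  proof (rule inj_onI, rule ccontr)
    fix p v assume pv: "p \<in> Z" "v \<in> Z" "fst p = fst v" "p \<noteq> v"
    show False
    proof (rule redundant_column_site[OF ind R(1) B, of v])
      fix e assume "d \<le> e" "e < x2"
      then obtain q where "q \<in> A" "fst q = e + 1 \<or> fst q = e + 2" using hit by blast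
      then show "\<exists>p\<in>A - {v}. fst p = e + 1 \<or> fst p = e + 2"
        using pv unfolding Z_def by (cases "q = v") auto
    qed (use pv in \<open>auto simp: Z_def\<close>)
  qed
  then show cZ: "card Z = card (fst ` Z)" by (simp add: card_image)
  show sub: "fst ` Z \<subseteq> {d + 1..x2}" using AR unfolding Z_def by (fastforce simp: rect_def)
  show tf: False if e: "e - 1 \<in> insert d (fst ` Z)" "e \<in> fst ` Z" "e + 1 \<in> fst ` Z" for e
  proof -
    obtain v where v: "v \<in> Z" "fst v = e" using e by blast
    obtain w where w: "w \<in> Z" "fst w = e + 1" using e by force
    show False
    proof (rule redundant_column_site[OF ind R(1) B, of v])
      fix e' assume e': "d \<le> e'" "e' < x2"
      then obtain q where q: "q \<in> A" "fst q = e' + 1 \<or> fst q = e' + 2" using hit by blast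
      show "\<exists>p\<in>A - {v}. fst p = e' + 1 \<or> fst p = e' + 2"
      proof (cases "q = v")
        case False then show ?thesis using q by auto
      next
        case True
        then have "e = e' + 1 \<or> e = e' + 2" using q v by auto
        then consider "e' = e - 1" | "e' = e - 2" by linarith
        then show ?thesis
        proof cases
          case 1 then show ?thesis using w v unfolding Z_def by (intro bexI[of _ w]) auto
        next
          case 2
          then have "e - 1 \<in> fst ` Z" using e(1) e' by auto
          then obtain u where "u \<in> Z" "fst u = e - 1" by force
          then show ?thesis using 2 v unfolding Z_def by (intro bexI[of _ u]) auto
        qed
      qed
    qed (use v in \<open>auto simp: Z_def\<close>)
  qed
  have "3 * card (insert d (fst ` Z)) \<le> 2 * nat (x2 - d + 1) + 2"
  proof (rule triple_free_card[of _ d])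
    fix e assume e: "e - 1 \<in> insert d (fst ` Z)" "e \<in> insert d (fst ` Z)" "e + 1 \<in> insert d (fst ` Z)"
    then have "d \<le> e - 1" using sub by auto
    then show False using tf[of e] e by auto
  qed (use sub dx in auto)
  moreover have "d \<notin> fst ` Z" using sub by auto
  moreover have "finite (fst ` Z)" using fin unfolding Z_def by auto
  ultimately show "3 * int (card Z) \<le> 2 * (x2 - d) + 1" using cZ dx by simp
  show "card Z = 0" if "x2 = d" using sub that by (simp add: cZ)
qed

lemma left_columns:
  assumes fin: "finite A" and ind: "indep A" and R: "cl A = rect x1 x2 y1 y2" "x1 \<le> x2"
    and B: "B \<subseteq> A" "cl B = rect c d y1 y2" "c \<le> d" "y1 \<le> y2"
  defines "Z \<equiv> {p \<in> A. fst p < c}"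
  shows "card Z = card (fst ` Z)" "fst ` Z \<subseteq> {x1..c - 1}"
    "\<And>e. e - 1 \<in> fst ` Z \<Longrightarrow> e \<in> fst ` Z \<Longrightarrow> e + 1 \<in> fst ` Z \<Longrightarrow> False"
    "3 * int (card Z) \<le> 2 * (c - x1) + 1" "x1 = c \<Longrightarrow> card Z = 0" "x1 \<le> c"
proof -
  have inj: "inj flipx" using bij_flipx bij_is_inj by blast
  have "cl (flipx ` A) = rect (- x2) (- x1) y1 y2" "cl (flipx ` B) = rect (- d) (- c) y1 y2"
    using R B by (simp_all add: flipx_facts)
  note r = right_columns[OF _ _ this(1) _ _ this(2)]
  have Z: "{p \<in> flipx ` A. - c < fst p} = flipx ` Z" unfolding Z_def by (auto simp: flipx_def)
  have f: "fst ` flipx ` Z = uminus ` fst ` Z" by (auto simp: image_image flipx_def)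
  have cf: "card (flipx ` Z) = card Z" using inj by (simp add: card_image inj_on_subset)
  have cu: "card (uminus ` fst ` Z) = card (fst ` Z)" by (simp add: card_image)
  have m: "e \<in> uminus ` X \<longleftrightarrow> - e \<in> X" for e :: int and X by force
  note r' = r[unfolded Z f cf cu, simplified flipx_facts]
  have p: "finite (flipx ` A)" "indep A" "- x2 \<le> - x1" "flipx ` B \<subseteq> flipx ` A" "- d \<le> - c" "y1 \<le> y2"
    using fin ind R B by auto
  show "card Z = card (fst ` Z)" using r'(1) p by auto
  have "uminus ` fst ` Z \<subseteq> {- c + 1..- x1}" using r'(2) p by auto
  then have s: "- z \<in> {- c + 1..- x1}" if "z \<in> fst ` Z" for z using that by blast
  show "fst ` Z \<subseteq> {x1..c - 1}"
  proof
    fix z assume "z \<in> fst ` Z"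
    from s[OF this] show "z \<in> {x1..c - 1}" by auto
  qed
  show "False" if "e - 1 \<in> fst ` Z" "e \<in> fst ` Z" "e + 1 \<in> fst ` Z" for e
  proof -
    have "1 + e \<in> fst ` Z" using that(3) by (simp add: add.commute)
    then show False using r(3)[of "- e", unfolded Z f] p flipx_facts(3) that by (auto simp: m)
  qed
  show "3 * int (card Z) \<le> 2 * (c - x1) + 1" using r'(4) p by auto
  show "card Z = 0" if "x1 = c" using r'(5) p that by auto
  show "x1 \<le> c" using r'(6) p by auto
qed

lemma full_height_card:
  assumes fin: "finite A" and ind: "indep A" and R: "cl A = rect x1 x2 y1 y2" "x1 \<le> x2"
    and B: "B \<subseteq> A" "cl B = rect c d y1 y2" "c \<le> d" "y1 \<le> y2"
  shows "card A = card B + card {p \<in> A. d < fst p} + card {p \<in> A. fst p < c}"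
proof -
  have AR: "A \<subseteq> rect x1 x2 y1 y2" using subset_cl[of A] R by simp
  have BR: "B \<subseteq> rect c d y1 y2" using subset_cl[of B] B by simp
  let ?M = "{p \<in> A. c \<le> fst p \<and> fst p \<le> d}"
  have "?M \<subseteq> B"
  proof
    fix p assume p: "p \<in> ?M"
    then have "p \<in> rect c d y1 y2" using AR by (cases p) auto
    then show "p \<in> B" using indepD[OF ind, of p B] p B by auto
  qed
  moreover have "B \<subseteq> ?M" using B(1) BR by (auto simp: rect_def)
  ultimately have M: "?M = B" by blast
  have "A = (?M \<union> {p \<in> A. d < fst p}) \<union> {p \<in> A. fst p < c}" by auto
  then have "card A = card ((?M \<union> {p \<in> A. d < fst p}) \<union> {p \<in> A. fst p < c})" by simp
  also have "\<dots> = card (?M \<union> {p \<in> A. d < fst p}) + card {p \<in> A. fst p < c}"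
    using fin B(3) by (intro card_Un_disjoint) auto
  also have "card (?M \<union> {p \<in> A. d < fst p}) = card ?M + card {p \<in> A. d < fst p}"
    using fin by (intro card_Un_disjoint) auto
  finally show ?thesis unfolding M .
qed

lemma diagonal_pair:
  assumes ind: "indep A" and A: "(u, v) \<in> A" "(u + 1, v') \<in> A" "\<bar>v - v'\<bar> = 1"
  shows "cl {(u, v), (u + 1, v')} = rect u (u + 1) (min v v') (max v v')"
    "(u, v') \<notin> A" "(u + 1, v) \<notin> A"
proof -
  let ?D = "{(u, v), (u + 1, v')}"
  have D: "?D \<subseteq> cl ?D" by (rule subset_cl)
  have "rect u u v v \<subseteq> cl ?D" "(u + 1, v') \<in> cl ?D" using D by (auto simp: rect_def)
  from nclosed_hull_point[OF nclosed_cl this(1) _ this(2), of "(u, v)"] A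
  have "rect u (u + 1) (min v v') (max v v') \<subseteq> cl ?D" by simp
  moreover have "cl ?D \<subseteq> rect u (u + 1) (min v v') (max v v')"
    by (intro cl_least nclosed_rect) auto
  ultimately show eq: "cl ?D = rect u (u + 1) (min v v') (max v v')" by blast
  show "(u, v') \<notin> A"
  proof
    assume "(u, v') \<in> A"
    then have "(u, v') \<notin> cl ?D" by (rule indepD[OF ind]) (use A in auto)
    then show False unfolding eq by simp
  qed
  show "(u + 1, v) \<notin> A"
  proof
    assume "(u + 1, v) \<in> A"
    then have "(u + 1, v) \<notin> cl ?D" by (rule indepD[OF ind]) (use A in auto)
    then show False unfolding eq by simp
  qed
qed

lemma two_row_seed:
  assumes R: "cl A = rect x1 x2 y (y + 1)" "x1 \<le> x2"
  shows "\<exists>c. (c, y) \<in> A \<and> (c, y + 1) \<in> A \<or> (c, y) \<in> A \<and> (c + 1, y + 1) \<in> A \<or> (c, y + 1) \<in> A \<and> (c + 1, y) \<in> A"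
proof (rule ccontr)
  assume no: "\<not> ?thesis"
  have AR: "A \<subseteq> rect x1 x2 y (y + 1)" using subset_cl[of A] R by simp
  define L where "L z = {x. (x, z) \<in> A \<or> ((x - 1, z) \<in> A \<and> (x + 1, z) \<in> A)}" for z
  have gapL: "2 \<le> \<bar>x - x'\<bar>" if "(x, y) \<in> A" "(x', y + 1) \<in> A" for x x'
  proof (rule ccontr)
    assume "\<not> 2 \<le> \<bar>x - x'\<bar>"
    then consider "x = x'" | "x' = x + 1" | "x = x' + 1" by linarith
    then show False
    proof cases
      case 1 then show ?thesis using no that by blast
    next
      case 2 then show ?thesis using no that by blast
    next
      case 3 then show ?thesis using no that by blast
    qed
  qed
  have row: "nclosed (L z \<times> {z})" for z
    unfolding nclosed_def
  proof (intro allI impI)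
    fix p u v
    assume a: "u \<in> L z \<times> {z}" "v \<in> L z \<times> {z}" "u \<noteq> v" "d1 p u = 1" "d1 p v = 1"
    obtain px py where p: "p = (px, py)" by fastforce
    obtain ux where u: "u = (ux, z)" "ux \<in> L z" using a by auto
    obtain vx where v: "v = (vx, z)" "vx \<in> L z" using a by auto
    have "ux \<noteq> vx" "\<bar>px - ux\<bar> + \<bar>py - z\<bar> = 1" "\<bar>px - vx\<bar> + \<bar>py - z\<bar> = 1" using a by (auto simp: p u v)
    then have pz: "py = z" "(ux = px - 1 \<and> vx = px + 1) \<or> (ux = px + 1 \<and> vx = px - 1)" by (smt (verit))+
    then have "px - 1 \<in> L z" "px + 1 \<in> L z" using u v by auto
    then have "px \<in> L z" unfolding L_def by auto
    then show "p \<in> L z \<times> {z}" using p pz by simp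
  qed
  have "far (L y \<times> {y}) (L (y + 1) \<times> {y + 1})"
    unfolding far_def
  proof (intro ballI)
    fix p q assume "p \<in> L y \<times> {y}" "q \<in> L (y + 1) \<times> {y + 1}"
    then obtain x x' where p: "p = (x, y)" "x \<in> L y" and q: "q = (x', y + 1)" "x' \<in> L (y + 1)" by auto
    have half: "2 \<le> \<bar>x - t\<bar>" if t: "(t, y + 1) \<in> A" for t
    proof (cases "(x, y) \<in> A")
      case True then show ?thesis using gapL t by blast
    next
      case False
      then have "(x - 1, y) \<in> A" "(x + 1, y) \<in> A" using p(2) by (auto simp: L_def)
      then have "2 \<le> \<bar>x - 1 - t\<bar>" "2 \<le> \<bar>x + 1 - t\<bar>" using gapL t by blast+
      then show ?thesis by linarith
    qed
    have "2 \<le> \<bar>x - x'\<bar>"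
    proof (cases "(x', y + 1) \<in> A")
      case True then show ?thesis by (rule half)
    next
      case False
      then have "(x' - 1, y + 1) \<in> A" "(x' + 1, y + 1) \<in> A" using q(2) by (auto simp: L_def)
      then have "2 \<le> \<bar>x - (x' - 1)\<bar>" "2 \<le> \<bar>x - (x' + 1)\<bar>" using half by blast+
      then show ?thesis using half by linarith
    qed
    then show "3 \<le> d1 p q" using p q by simp
  qed
  then have "nclosed (L y \<times> {y} \<union> L (y + 1) \<times> {y + 1})" using row nclosed_Un_far by blast
  moreover have "A \<subseteq> L y \<times> {y} \<union> L (y + 1) \<times> {y + 1}"
  proof
    fix p assume p: "p \<in> A"
    obtain px py where q: "p = (px, py)" by fastforce
    then have "py = y \<or> py = y + 1" using AR p by auto
    then show "p \<in> L y \<times> {y} \<union> L (y + 1) \<times> {y + 1}" using p q by (auto simp: L_def)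
  qed
  ultimately have sub: "cl A \<subseteq> L y \<times> {y} \<union> L (y + 1) \<times> {y + 1}" by (intro cl_least)
  have x1: "(x1, y) \<in> cl A" "(x1, y + 1) \<in> cl A" unfolding R(1) using R(2) by auto
  have "x1 \<in> L y" "x1 \<in> L (y + 1)" using subsetD[OF sub x1(1)] subsetD[OF sub x1(2)] by auto
  then show False using \<open>far (L y \<times> {y}) (L (y + 1) \<times> {y + 1})\<close> unfolding far_def by force
qed

theorem two_row_bound:
  assumes fin: "finite A" and ind: "indep A" and R: "cl A = rect x1 x2 y (y + 1)" "x1 \<le> x2"
  shows "6 * int (card A) \<le> 4 * (x2 - x1 + 3)"
proof -
  have y: "y \<le> y + 1" by simp
  obtain c where "(c, y) \<in> A \<and> (c, y + 1) \<in> A \<or> (c, y) \<in> A \<and> (c + 1, y + 1) \<in> A \<or> (c, y + 1) \<in> A \<and> (c + 1, y) \<in> A"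
    using two_row_seed[OF R] by blast
  then consider (v) "(c, y) \<in> A" "(c, y + 1) \<in> A"
    | (d) z z' where "(c, z) \<in> A" "(c + 1, z') \<in> A" "z = y \<and> z' = y + 1 \<or> z = y + 1 \<and> z' = y" by auto
  then show ?thesis
  proof cases
    case v
    let ?B = "{(c, y), (c, y + 1)}"
    have Br: "?B = rect c c y (y + 1)" by (auto simp: rect_def)
    then have B: "?B \<subseteq> A" "cl ?B = rect c c y (y + 1)" "c \<le> c" using v by (auto simp: cl_nclosed nclosed_rect)
    let ?Z = "{p \<in> A. c < fst p}" and ?W = "{p \<in> A. fst p < c}"
    note r = right_columns[OF fin ind R B y] and l = left_columns[OF fin ind R B y]
    have AR: "A \<subseteq> rect x1 x2 y (y + 1)" using subset_cl[of A] R by simp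
    have no: "c + 1 \<notin> fst ` ?Z" "c - 1 \<notin> fst ` ?W"
    proof -
      have "(c + 1, z) \<notin> A" for z
      proof
        assume z: "(c + 1, z) \<in> A"
        then have "z = y \<or> z = y + 1" using AR by auto
        then show False using diagonal_pair(2)[OF ind v(2) z] diagonal_pair(2)[OF ind v(1) z] v by auto
      qed
      then show "c + 1 \<notin> fst ` ?Z" by auto
      have "(c - 1, z) \<notin> A" for z
      proof
        assume z: "(c - 1, z) \<in> A"
        then have "z = y \<or> z = y + 1" using AR by auto
        then show False using diagonal_pair(3)[OF ind z, of y] diagonal_pair(3)[OF ind z, of "y + 1"] v by auto
      qed
      then show "c - 1 \<notin> fst ` ?W" by auto
    qed
    have 1: "3 * int (card ?Z) \<le> 2 * (x2 - c)"
    proof (cases "x2 = c")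
      case True then show ?thesis using r(5) by simp
    next
      case False
      then have x2: "c < x2" using r(6) by simp
      have "3 * card (fst ` ?Z) \<le> 2 * nat (x2 - c - 1) + 2"
      proof (rule triple_free_card[of _ "c + 2"])
        show "False" if "e - 1 \<in> fst ` ?Z" "e \<in> fst ` ?Z" "e + 1 \<in> fst ` ?Z" for e
          using r(3)[of e] that by blast
        show "fst ` ?Z \<subseteq> {c + 2..c + 2 + int (nat (x2 - c - 1)) - 1}"
        proof
          fix z assume z: "z \<in> fst ` ?Z"
          then have "z \<noteq> c + 1" using no by blast
          moreover have "c + 1 \<le> z" "z \<le> x2" using r(2) z by auto
          ultimately show "z \<in> {c + 2..c + 2 + int (nat (x2 - c - 1)) - 1}" using x2 by simp
        qed
      qed
      then show ?thesis using r(1) x2 by simp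
    qed
    have 2: "3 * int (card ?W) \<le> 2 * (c - x1)"
    proof (cases "x1 = c")
      case True then show ?thesis using l(5) by simp
    next
      case False
      then have x1: "x1 < c" using l(6) by simp
      have "3 * card (fst ` ?W) \<le> 2 * nat (c - x1 - 1) + 2"
      proof (rule triple_free_card[of _ x1])
        show "False" if "e - 1 \<in> fst ` ?W" "e \<in> fst ` ?W" "e + 1 \<in> fst ` ?W" for e
          using l(3)[of e] that by blast
        show "fst ` ?W \<subseteq> {x1..x1 + int (nat (c - x1 - 1)) - 1}"
        proof
          fix z assume z: "z \<in> fst ` ?W"
          then have "z \<noteq> c - 1" using no by blast
          moreover have "x1 \<le> z" "z \<le> c - 1" using l(2) z by auto
          ultimately show "z \<in> {x1..x1 + int (nat (c - x1 - 1)) - 1}" using x1 by simp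
        qed
      qed
      then show ?thesis using l(1) x1 by simp
    qed
    show ?thesis using full_height_card[OF fin ind R B y] 1 2 by simp
  next
    case d
    let ?B = "{(c, z), (c + 1, z')}"
    have B: "?B \<subseteq> A" "cl ?B = rect c (c + 1) y (y + 1)" "c \<le> c + 1"
      using diagonal_pair(1)[OF ind d(1,2)] d by auto
    note r = right_columns(4)[OF fin ind R B y] and l = left_columns(4)[OF fin ind R B y]
    show ?thesis using full_height_card[OF fin ind R B y] r l by simp
  qed
qed

section \<open>Three rows\<close>

lemma cl_insert_point:
  assumes S: "cl X = rect a b c d" "a \<le> b" "c \<le> d" and near: "gap u u a b + gap v v c d \<le> 2"
  shows "cl (insert (u, v) X) = rect (min a u) (max b u) (min c v) (max d v)"
proof -
  have "cl {(u, v)} = rect u u v v" unfolding point_rect by (simp add: cl_nclosed nclosed_rect)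
  moreover have "\<not> far (rect a b c d) (rect u u v v)"
    using near far_rect_iff[OF S(2,3), of u u v v] by (simp add: gap_commute[of a] gap_commute[of c])
  ultimately have "cl (X \<union> {(u, v)}) = rect (min a u) (max b u) (min c v) (max d v)"
    by (rule cl_Un_rect[OF S(1)])
  then show ?thesis by simp
qed

lemma card_le_3: "card {p, q, r} \<le> 3"
  by (simp add: card_insert_if)

locale three_row_cap =
  fixes A B :: "(int \<times> int) set" and y r0 r2 t1 c d k :: int
  assumes ind: "indep A" and BA: "B \<subseteq> A" "finite B"
    and r: "(r0 = y \<and> r2 = y + 2 \<and> t1 = y) \<or> (r0 = y + 2 \<and> r2 = y \<and> t1 = y + 1)"
    and S: "cl B = rect c d t1 (t1 + 1)" and cd: "c \<le> d"
    and w: "(c + k, r2) \<in> A" "0 \<le> k" "c + k \<le> d"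
    and star: "\<And>X e f. X \<subseteq> insert (c + k, r2) B \<Longrightarrow> card X \<le> 3 \<Longrightarrow> cl X = rect e f y (y + 2) \<Longrightarrow>
      e \<le> f \<Longrightarrow> f - e \<le> 2 \<Longrightarrow> False"
begin

abbreviation "a i \<equiv> (c + i, r0) \<in> B"
abbreviation "b i \<equiv> (c + i, y + 1) \<in> B"

lemma vertical_far:
  assumes "a i" "b i" shows "\<not> \<bar>k - i\<bar> \<le> 1"
proof
  assume ki: "\<bar>k - i\<bar> \<le> 1"
  let ?X = "{(c + i, r0), (c + i, y + 1)}"
  have "?X = rect (c + i) (c + i) t1 (t1 + 1)" using r by (auto simp: rect_def)
  then have "cl ?X = rect (c + i) (c + i) t1 (t1 + 1)" using cl_nclosed nclosed_rect by simp
  then have "cl (insert (c + k, r2) ?X) = rect (min (c + i) (c + k)) (max (c + i) (c + k)) (min t1 r2) (max (t1 + 1) r2)"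
    by (rule cl_insert_point) (use r ki in \<open>auto simp: gap_def\<close>)
  moreover have "min t1 r2 = y" "max (t1 + 1) r2 = y + 2" using r by auto
  ultimately have "cl (insert (c + k, r2) ?X) = rect (min (c + i) (c + k)) (max (c + i) (c + k)) y (y + 2)" by simp
  then show False by (rule star[rotated 2]) (use assms ki card_le_3 in auto)
qed

lemma diagonal_far:
  assumes "(c + i, z) \<in> B" "(c + i + 1, z') \<in> B" "z = r0 \<and> z' = y + 1 \<or> z = y + 1 \<and> z' = r0"
  shows "\<not> (i - 1 \<le> k \<and> k \<le> i + 2)" "(c + i, z') \<notin> B" "(c + i + 1, z) \<notin> B"
proof -
  have zz: "\<bar>z - z'\<bar> = 1" using assms r by auto
  have BB: "(c + i, z) \<in> A" "(c + i + 1, z') \<in> A" using assms BA by auto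
  show "(c + i, z') \<notin> B" "(c + i + 1, z) \<notin> B" using diagonal_pair(2,3)[OF ind BB zz] BA by auto
  show "\<not> (i - 1 \<le> k \<and> k \<le> i + 2)"
  proof
    assume ki: "i - 1 \<le> k \<and> k \<le> i + 2"
    let ?X = "{(c + i, z), (c + i + 1, z')}"
    have "min z z' = t1" "max z z' = t1 + 1" using assms(3) r by auto
    then have "cl ?X = rect (c + i) (c + i + 1) t1 (t1 + 1)" using diagonal_pair(1)[OF ind BB zz] by simp
    then have "cl (insert (c + k, r2) ?X) = rect (min (c + i) (c + k)) (max (c + i + 1) (c + k)) (min t1 r2) (max (t1 + 1) r2)"
      by (rule cl_insert_point) (use r ki in \<open>auto simp: gap_def\<close>)
    moreover have "min t1 r2 = y" "max (t1 + 1) r2 = y + 2" using r by auto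
    ultimately have "cl (insert (c + k, r2) ?X) = rect (min (c + i) (c + k)) (max (c + i + 1) (c + k)) y (y + 2)" by simp
    then show False by (rule star[rotated 2]) (use assms ki card_le_3 in auto)
  qed
qed

lemma not_a_k: "\<not> a k"
proof
  assume "a k"
  let ?X = "{(c + k, r0)}"
  have "cl ?X = rect (c + k) (c + k) r0 r0" unfolding point_rect by (simp add: cl_nclosed nclosed_rect)
  then have "cl (insert (c + k, r2) ?X) = rect (min (c + k) (c + k)) (max (c + k) (c + k)) (min r0 r2) (max r0 r2)"
    by (rule cl_insert_point) (use r in \<open>auto simp: gap_def\<close>)
  moreover have "min r0 r2 = y" "max r0 r2 = y + 2" using r by auto
  ultimately have "cl (insert (c + k, r2) ?X) = rect (c + k) (c + k) y (y + 2)" by simp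
  then show False by (rule star[rotated 2]) (use \<open>a k\<close> in \<open>auto simp: card_insert_if\<close>)
qed

lemma not_b_k: "b (k + 1) \<Longrightarrow> \<not> b k" "b (k - 1) \<Longrightarrow> \<not> b k"
proof -
  have r2: "\<bar>r2 - (y + 1)\<bar> = 1" "\<bar>(y + 1) - r2\<bar> = 1" using r by auto
  show "\<not> b k" if "b (k + 1)"
  proof -
    have "(c + k + 1, y + 1) \<in> A" using that BA by (auto simp: add.assoc)
    from diagonal_pair(2)[OF ind w(1) this r2(1)] show ?thesis using BA by blast
  qed
  show "\<not> b k" if "b (k - 1)"
  proof -
    have "(c + k - 1, y + 1) \<in> A" "(c + k - 1 + 1, r2) \<in> A" using that BA w(1) by (auto simp: algebra_simps)
    from diagonal_pair(3)[OF ind this r2(2)] show ?thesis using BA by auto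
  qed
qed

lemma ends_hit: "a 0 \<or> b 0" "a (d - c) \<or> b (d - c)"
proof -
  have BS: "B \<subseteq> rect c d t1 (t1 + 1)" using subset_cl[of B] S by simp
  obtain z where z: "(c, z) \<in> B" using side_hit(1)[OF S cd] by auto
  then have "z = t1 \<or> z = t1 + 1" using BS by auto
  then show "a 0 \<or> b 0" using z r by (auto simp: algebra_simps)
  obtain z where z: "(d, z) \<in> B" using side_hit(2)[OF S cd] by auto
  then have "z = t1 \<or> z = t1 + 1" using BS by auto
  then show "a (d - c) \<or> b (d - c)" using z r by (auto simp: algebra_simps)
qed

lemma card_B: "card B = (\<Sum>i\<in>{0..d - c}. of_bool (a i) + of_bool (b i))"
proof -
  have BS: "B \<subseteq> rect c d t1 (t1 + 1)" using subset_cl[of B] S by simp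
  define Ra where "Ra = {i \<in> {0..d - c}. a i}"
  define Rb where "Rb = {i \<in> {0..d - c}. b i}"
  have eq: "B = (\<lambda>i. (c + i, r0)) ` Ra \<union> (\<lambda>i. (c + i, y + 1)) ` Rb"
  proof
    show "B \<subseteq> (\<lambda>i. (c + i, r0)) ` Ra \<union> (\<lambda>i. (c + i, y + 1)) ` Rb"
    proof
      fix p assume p: "p \<in> B"
      obtain u v where uv: "p = (u, v)" by fastforce
      then have "c \<le> u" "u \<le> d" "v = r0 \<or> v = y + 1" using BS p r by auto
      then show "p \<in> (\<lambda>i. (c + i, r0)) ` Ra \<union> (\<lambda>i. (c + i, y + 1)) ` Rb"
        using p uv by (auto simp: Ra_def Rb_def intro!: image_eqI[of _ _ "u - c"])
    qed
    show "(\<lambda>i. (c + i, r0)) ` Ra \<union> (\<lambda>i. (c + i, y + 1)) ` Rb \<subseteq> B" by (auto simp: Ra_def Rb_def)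
  qed
  have "card B = card ((\<lambda>i. (c + i, r0)) ` Ra) + card ((\<lambda>i. (c + i, y + 1)) ` Rb)"
  proof -
    have "finite Ra" "finite Rb" unfolding Ra_def Rb_def by (rule finite_subset[of _ "{0..d - c}"]; auto)+
    moreover have "r0 \<noteq> y + 1" using r by auto
    ultimately show ?thesis by (subst (1) eq, intro card_Un_disjoint) auto
  qed
  also have "card ((\<lambda>i. (c + i, r0)) ` Ra) = card Ra" by (rule card_image) (simp add: inj_on_def)
  also have "card ((\<lambda>i. (c + i, y + 1)) ` Rb) = card Rb" by (rule card_image) (simp add: inj_on_def)
  also have "card Ra = (\<Sum>i\<in>{0..d - c}. of_bool (a i))" unfolding Ra_def by (simp add: Int_def)
  also have "card Rb = (\<Sum>i\<in>{0..d - c}. of_bool (b i))" unfolding Rb_def by (simp add: Int_def)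
  finally show ?thesis by (simp add: sum.distrib)
qed

lemma diagonals:
  "a i \<and> b (i + 1) \<Longrightarrow> \<not> (i - 1 \<le> k \<and> k \<le> i + 2) \<and> \<not> b i \<and> \<not> a (i + 1)"
  "b i \<and> a (i + 1) \<Longrightarrow> \<not> (i - 1 \<le> k \<and> k \<le> i + 2) \<and> \<not> a i \<and> \<not> b (i + 1)"
  using diagonal_far[of i r0 "y + 1"] diagonal_far[of i "y + 1" r0] by (auto simp: add.assoc)

definition col :: "int \<Rightarrow> nat" where "col i = of_bool (a i) + of_bool (b i)"

lemma col_cases:
  "col i = 0 \<longleftrightarrow> \<not> a i \<and> \<not> b i" "col i = 2 \<longleftrightarrow> a i \<and> b i" "col i \<le> 2"
  unfolding col_def by (cases "a i"; cases "b i"; simp)+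

lemma col_pair: "col i + col (i + 1) \<le> 2"
proof -
  have "\<not> (a i \<and> b (i + 1) \<and> b i)" "\<not> (a i \<and> b (i + 1) \<and> a (i + 1))"
    "\<not> (b i \<and> a (i + 1) \<and> a i)" "\<not> (b i \<and> a (i + 1) \<and> b (i + 1))"
    using diagonals by blast+
  then show ?thesis unfolding col_def
    by (cases "a i"; cases "b i"; cases "a (i + 1)"; cases "b (i + 1)"; simp)
qed

lemma col_k_neighbours: "b k \<Longrightarrow> col (k + 1) = 0" "b k \<Longrightarrow> col (k - 1) = 0"
proof -
  assume bk: "b k"
  have "\<not> a (k + 1)" using diagonals(2)[of k] bk by auto
  then show "col (k + 1) = 0" using not_b_k(1) bk col_cases(1) by blast
  have "\<not> a (k - 1)" using diagonals(1)[of "k - 1"] bk by auto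
  then show "col (k - 1) = 0" using not_b_k(2) bk col_cases(1) by blast
qed

lemma col_k: "col k \<noteq> 0 \<longleftrightarrow> b k"
  using not_a_k by (simp add: col_cases)

lemma col_k_le: "col k \<le> 1" "col (k + 1) \<le> 1" "col (k - 1) \<le> 1"
proof -
  have *: "col i \<le> 1" if "\<bar>k - i\<bar> \<le> 1" for i
  proof -
    have "col i \<noteq> 2" using vertical_far[of i] col_cases(2)[of i] that by blast
    then show ?thesis using col_cases(3)[of i] by linarith
  qed
  show "col k \<le> 1" "col (k + 1) \<le> 1" "col (k - 1) \<le> 1" by (rule *; simp)+
qed

lemma col_ends: "col 0 \<noteq> 0" "col (d - c) \<noteq> 0"
  using ends_hit by (auto simp: col_cases)

lemma col_sum: "card B = (\<Sum>i\<in>{0..d - c}. col i)"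
  using card_B by (simp add: col_def)

lemma four_columns: "d = c + 3 \<Longrightarrow> card B \<noteq> 4"
proof
  assume d: "d = c + 3" and c4: "card B = 4"
  have "{0..3::int} = {0, 1, 2, 3}" by auto
  then have sum: "col 0 + col 1 + col 2 + col 3 = 4" using col_sum c4 d by simp
  have p: "col 0 + col 1 \<le> 2" "col 2 + col 3 \<le> 2" using col_pair[of 0] col_pair[of 2] by simp_all
  have e: "col 0 \<noteq> 0" "col 3 \<noteq> 0" using col_ends d by simp_all
  have k4: "k = 0 \<or> k = 1 \<or> k = 2 \<or> k = 3" using w d by linarith
  have n: "col k = 0 \<or> col (k + 1) = 0 \<and> col (k - 1) = 0" using col_k col_k_neighbours by blast
  show False using k4
  proof (elim disjE)
    assume k: "k = 0" show False using n sum p e col_k_le unfolding k by simp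
  next
    assume k: "k = 1" show False using n sum p e col_k_le unfolding k by simp
  next
    assume k: "k = 2" show False using n sum p e col_k_le unfolding k by simp
  next
    assume k: "k = 3" show False using n sum p e col_k_le unfolding k by simp
  qed
qed

lemma three_columns:
  assumes d: "d = c + 2" and c3: "card B = 3"
  shows "k = 2 \<and> b 2 \<or> k = 0 \<and> b 0"
proof -
  have "{0..2::int} = {0, 1, 2}" by auto
  then have sum: "col 0 + col 1 + col 2 = 3" using col_sum c3 d by simp
  have e: "col 0 \<noteq> 0" "col 2 \<noteq> 0" using col_ends d by simp_all
  have k4: "k = 0 \<or> k = 1 \<or> k = 2" using w d by linarith
  have n: "col k = 0 \<or> col (k + 1) = 0 \<and> col (k - 1) = 0" using col_k col_k_neighbours by blast
  show ?thesis using k4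
  proof (elim disjE)
    assume k: "k = 0" show ?thesis using e col_k k by simp
  next
    assume k: "k = 1" show ?thesis using n sum e col_k_le unfolding k by simp
  next
    assume k: "k = 2" show ?thesis using e col_k k by simp
  qed
qed

lemma three_columns_side_empty:
  assumes d: "d = c + 2" and c3: "card B = 3"
    and narrow: "\<And>X e f. X \<subseteq> A \<Longrightarrow> cl X = rect e f y (y + 2) \<Longrightarrow> e \<le> f \<Longrightarrow> 2 \<le> f - e"
  shows "(\<forall>z. y \<le> z \<and> z \<le> y + 2 \<longrightarrow> (d + 1, z) \<notin> A) \<or> (\<forall>z. y \<le> z \<and> z \<le> y + 2 \<longrightarrow> (c - 1, z) \<notin> A)"
proof -
  have rr: "\<bar>r2 - (y + 1)\<bar> = 1" "\<bar>(y + 1) - r2\<bar> = 1" "\<bar>r0 - (y + 1)\<bar> = 1" "\<bar>(y + 1) - r0\<bar> = 1" using r by auto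
  have rows: "z = r0 \<or> z = y + 1 \<or> z = r2" if "y \<le> z \<and> z \<le> y + 2" for z using that r by auto
  from three_columns[OF d c3] show ?thesis
  proof
    assume k: "k = 2 \<and> b 2"
    have b2: "(d, y + 1) \<in> A" "(d, r2) \<in> A" using k BA d w by auto
    have "(d + 1, z) \<notin> A" if z: "y \<le> z \<and> z \<le> y + 2" for z
    proof
      assume dz: "(d + 1, z) \<in> A"
      from rows[OF z] show False
      proof (elim disjE)
        assume [simp]: "z = r0"
        have "min (y + 1) r0 = t1" "max (y + 1) r0 = t1 + 1" using r by auto
        then have "cl {(d, y + 1), (d + 1, r0)} = rect d (d + 1) t1 (t1 + 1)"
          using diagonal_pair(1)[OF ind b2(1) dz] rr by simp
        then have "cl (insert (d, r2) {(d, y + 1), (d + 1, r0)}) = rect (min d d) (max (d + 1) d) (min t1 r2) (max (t1 + 1) r2)"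
          by (rule cl_insert_point) (use r in \<open>auto simp: gap_def\<close>)
        moreover have "min t1 r2 = y" "max (t1 + 1) r2 = y + 2" using r by auto
        ultimately have "cl (insert (d, r2) {(d, y + 1), (d + 1, r0)}) = rect d (d + 1) y (y + 2)" by simp
        then show False using narrow[of "insert (d, r2) {(d, y + 1), (d + 1, r0)}" d "d + 1"] b2 dz by auto
      next
        assume "z = y + 1"
        then show False using diagonal_pair(2)[OF ind b2(2) dz] rr b2 by auto
      next
        assume "z = r2"
        then show False using diagonal_pair(2)[OF ind b2(1) dz] rr b2 by auto
      qed
    qed
    then show ?thesis by blast
  next
    assume k: "k = 0 \<and> b 0"
    have b2: "(c - 1 + 1, y + 1) \<in> A" "(c - 1 + 1, r2) \<in> A" using k BA d w by auto
    have "(c - 1, z) \<notin> A" if z: "y \<le> z \<and> z \<le> y + 2" for z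
    proof
      assume dz: "(c - 1, z) \<in> A"
      from rows[OF z] show False
      proof (elim disjE)
        assume [simp]: "z = r0"
        have "min r0 (y + 1) = t1" "max r0 (y + 1) = t1 + 1" using r by auto
        then have "cl {(c - 1, r0), (c, y + 1)} = rect (c - 1) c t1 (t1 + 1)"
          using diagonal_pair(1)[OF ind dz b2(1)] rr by simp
        then have "cl (insert (c, r2) {(c - 1, r0), (c, y + 1)}) = rect (min (c - 1) c) (max c c) (min t1 r2) (max (t1 + 1) r2)"
          by (rule cl_insert_point) (use r in \<open>auto simp: gap_def\<close>)
        moreover have "min t1 r2 = y" "max (t1 + 1) r2 = y + 2" using r by auto
        ultimately have "cl (insert (c, r2) {(c - 1, r0), (c, y + 1)}) = rect (c - 1) c y (y + 2)" by simp
        then show False using narrow[of "insert (c, r2) {(c - 1, r0), (c, y + 1)}" "c - 1" c] b2 dz by auto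
      next
        assume "z = y + 1"
        then show False using diagonal_pair(3)[OF ind dz b2(2)] rr b2 by auto
      next
        assume "z = r2"
        then show False using diagonal_pair(3)[OF ind dz b2(1)] rr b2 by auto
      qed
    qed
    then show ?thesis by blast
  qed
qed

end

lemma card_thick_cap:
  fixes A B :: "(int \<times> int) set"
  assumes fin: "finite A" and ind: "indep A" and BA: "B \<subseteq> A" and S: "cl B = rect c d y (y + 2)" "c + 2 \<le> d"
    and narrow: "\<And>X e f. X \<subseteq> A \<Longrightarrow> cl X = rect e f y (y + 2) \<Longrightarrow> e \<le> f \<Longrightarrow> d - c \<le> f - e"
  shows "6 * int (card B) \<le> 5 * (d - c) + 13 \<or> 6 * int (card B) \<le> 5 * (d - c) + 14 \<and>
    ((\<forall>z. y \<le> z \<and> z \<le> y + 2 \<longrightarrow> (d + 1, z) \<notin> A) \<or> (\<forall>z. y \<le> z \<and> z \<le> y + 2 \<longrightarrow> (c - 1, z) \<notin> A))"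
proof -
  have finB: "finite B" using fin BA finite_subset by blast
  have indB: "indep B" using ind BA indep_subset by blast
  have cd: "c < d" "y < y + 2" using S by auto
  obtain B' C s1 s2 t1 t2 p1 p2 q1 q2 where
    "single_split B B' C s1 s2 t1 t2 p1 p2 q1 q2 \<or> corner_split B B' C s1 s2 t1 t2 p1 p2 q1 q2"
    using split_exists[OF finB indB S(1) cd] by (elim exE)
  then show ?thesis
  proof
    assume sg: "single_split B B' C s1 s2 t1 t2 p1 p2 q1 q2"
    then have sp: "splitting B B' C s1 s2 t1 t2 p1 p2 q1 q2" and pq: "p1 = p2" "q1 = q2" "C = {(p1, q1)}"
      and th: "(s1 < s2 \<and> t1 < t2) \<or> card B' \<le> 2"
      unfolding single_split_def by auto
    note sd = splittingD[OF sp]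
    have fB': "finite B'" using finB sd(1) by auto
    have wB: "(p1, q1) \<in> B" "(p1, q1) \<notin> B'" "B = insert (p1, q1) B'" using sd(1,2) pq(3) by auto
    have cB: "card B = card B' + 1" using wB fB' by simp
    have B'A: "B' \<subseteq> A" using BA sd(1) by auto
    have "(p1, q1) \<notin> cl B'" by (rule indepD[OF ind]) (use wB BA B'A in auto)
    then have wS: "\<not> (s1 \<le> p1 \<and> p1 \<le> s2 \<and> t1 \<le> q1 \<and> q1 \<le> t2)" unfolding sd(5) by simp
    have hull: "c = min s1 p1" "d = max s2 p1" "y = min t1 q1" "y + 2 = max t2 q1"
      using sd(12) S rect_eq_iff[of c d y "y + 2"] pq(1,2) by auto
    show ?thesis
    proof (cases "card B' \<le> 2")
      case True
      then show ?thesis using cB S(2) by simp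
    next
      case False
      then have th: "s1 < s2" "t1 < t2" using th by auto
      have t2: "t2 = t1 + 1"
      proof (rule ccontr)
        assume "t2 \<noteq> t1 + 1"
        then have t: "t1 = y" "t2 = y + 2" using th hull by linarith+
        have "d - c \<le> s2 - s1" by (rule narrow[OF B'A]) (use sd(5) t th in auto)
        then have "s1 \<le> p1" "p1 \<le> s2" using hull by linarith+
        moreover have "t1 \<le> q1" "q1 \<le> t2" using hull t by linarith+
        ultimately show False using wS by blast
      qed
      have q: "t1 = y \<and> q1 = y + 2 \<or> t1 = y + 1 \<and> q1 = y" using hull t2 by linarith
      have "6 * int (card B') \<le> 4 * (s2 - s1 + 3)"
        by (rule two_row_bound[OF fB' indep_subset[OF ind B'A]]) (use sd(5) t2 th in auto)
      note b = this
      show ?thesis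
      proof (cases "s1 \<le> p1 \<and> p1 \<le> s2")
        case False
        have "gap q1 q1 t1 t2 = 1" using q t2 by (auto simp: gap_def)
        then have "gap p1 p1 s1 s2 \<le> 1" using sd(11) pq by simp
        then have "s1 - p1 \<le> 1" "p1 - s2 \<le> 1" by (auto simp: gap_def)
        then have "d - c = s2 - s1 + 1" using False hull th by linarith
        then show ?thesis using b cB S(2) by simp
      next
        case True
        then have cs: "s1 = c" "s2 = d" using hull by linarith+
        have cap: "three_row_cap A B' y (if q1 = y then y + 2 else y) q1 t1 c d (p1 - c)" if "4 \<le> card B"
        proof
          show "indep A" "B' \<subseteq> A" "finite B'" "c \<le> d" using ind B'A fB' cd by auto
          show "(if q1 = y then y + 2 else y) = y \<and> q1 = y + 2 \<and> t1 = y \<or>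
            (if q1 = y then y + 2 else y) = y + 2 \<and> q1 = y \<and> t1 = y + 1" using q by auto
          show "cl B' = rect c d t1 (t1 + 1)" using sd(5) cs t2 by simp
          show "(c + (p1 - c), q1) \<in> A" "0 \<le> p1 - c" "c + (p1 - c) \<le> d" using wB BA True cs by auto
          fix X e f assume X: "X \<subseteq> insert (c + (p1 - c), q1) B'" "card X \<le> 3" "cl X = rect e f y (y + 2)" "e \<le> f" "f - e \<le> 2"
          have XB: "X \<subseteq> B" using X(1) wB(3) by simp
          have "rect e f y (y + 2) \<subseteq> rect c d y (y + 2)" using cl_mono[OF XB] X(3) S(1) by simp
          then have "c \<le> e" "f \<le> d" using rect_subset_iff X(4) by auto
          moreover have "d - c \<le> f - e" by (rule narrow[OF _ X(3,4)]) (use XB BA in auto)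
          ultimately have "cl X = cl B" using X(3) S(1) by auto
          moreover have "B \<noteq> X" using X(2) that by auto
          then obtain v where "v \<in> B" "v \<notin> X" using XB by blast
          ultimately show False using indepD[OF indB _ XB, of v] subsetD[OF subset_cl[of B], of v] by simp
        qed
        consider "5 \<le> d - c" | "d - c = 4" | "d - c = 3" "card B' = 4" | "d - c = 3" "card B' \<noteq> 4"
          | "d - c = 2" "card B' = 3" | "d - c = 2" "card B' \<noteq> 3" using S(2) by linarith
        then show ?thesis
        proof cases
          case 1 then show ?thesis using b cB cs by simp
        next
          case 2 then show ?thesis using b cB cs by simp
        next
          case 3 then show ?thesis using three_row_cap.four_columns[OF cap] cB by simp
        next
          case 4 then show ?thesis using b cB cs by simp
        next
          case 5
          have "(\<forall>z. y \<le> z \<and> z \<le> y + 2 \<longrightarrow> (d + 1, z) \<notin> A) \<or> (\<forall>z. y \<le> z \<and> z \<le> y + 2 \<longrightarrow> (c - 1, z) \<notin> A)"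
          proof (rule three_row_cap.three_columns_side_empty[OF cap])
            show "4 \<le> card B" "d = c + 2" "card B' = 3" using 5 cB by auto
            show "2 \<le> f - e" if "X \<subseteq> A" "cl X = rect e f y (y + 2)" "e \<le> f" for X e f
              using narrow[OF that] 5 by simp
          qed
          then show ?thesis using 5 cB by simp
        next
          case 6 then show ?thesis using b cB cs by simp
        qed
      qed
    qed
  next
    assume cs: "corner_split B B' C s1 s2 t1 t2 p1 p2 q1 q2"
    then have sp: "splitting B B' C s1 s2 t1 t2 p1 p2 q1 q2" and c2: "2 \<le> card C"
      and th: "s1 < s2" "t1 < t2" "p1 < p2" "q1 < q2"
      and o: "s1 < p1 \<and> s2 < p2 \<or> p1 < s1 \<and> p2 < s2" "t1 < q1 \<and> t2 < q2 \<or> q1 < t1 \<and> q2 < t2"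
      unfolding corner_split_def by auto
    note sd = splittingD[OF sp]
    have hull: "c = min s1 p1" "d = max s2 p2" "y = min t1 q1" "y + 2 = max t2 q2"
      using sd(12) S rect_eq_iff[of c d y "y + 2"] by auto
    have t: "t2 = t1 + 1" "q2 = q1 + 1" "t1 = q1 + 1 \<or> q1 = t1 + 1" using hull th o by linarith+
    have f: "finite B'" "finite C" "B' \<subseteq> A" "C \<subseteq> A" using finB sd(1) BA by auto
    have b1: "6 * int (card B') \<le> 4 * (s2 - s1 + 3)"
      by (rule two_row_bound[OF f(1) indep_subset[OF ind f(3)]]) (use sd(5) t th in auto)
    have b2: "6 * int (card C) \<le> 4 * (p2 - p1 + 3)"
      by (rule two_row_bound[OF f(2) indep_subset[OF ind f(4)]]) (use sd(8) t th in auto)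
    have cB: "card B = card B' + card C" unfolding sd(1) by (rule card_Un_disjoint) (use f sd in auto)
    have far2: "2 \<le> gap x x s1 s2" if "(x, z) \<in> C" for x z
    proof -
      have "{(x, z)} \<subset> C" using that c2 by auto
      from sd(13)[OF this] have "3 \<le> gap x x s1 s2 + gap z z t1 t2"
        using far_point_rect_iff[OF sd(6,7)] by simp
      moreover have "q1 \<le> z" "z \<le> q2" using subset_cl[of C] that unfolding sd(8) by auto
      then have "gap z z t1 t2 \<le> 1" using t by (auto simp: gap_def)
      ultimately show ?thesis by simp
    qed
    obtain z where z: "(p1, z) \<in> C" using side_hit(1)[OF sd(8-10)] by blast
    obtain z' where z': "(p2, z') \<in> C" using side_hit(2)[OF sd(8-10)] by blast
    have "s2 + 2 \<le> p1 \<or> p2 + 2 \<le> s1"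
      using o(1) far2[OF z] far2[OF z'] th by (auto simp: gap_def)
    then have "(s2 - s1) + (p2 - p1) + 2 \<le> d - c" using hull o(1) th by linarith
    then show ?thesis using b1 b2 cB th by simp
  qed
qed

theorem three_row_bound:
  assumes fin: "finite A" and ind: "indep A" and R: "cl A = rect x1 x2 y (y + 2)" "x1 < x2"
  shows "6 * int (card A) \<le> 5 * (x2 - x1 + 3)"
proof -
  define P where "P = (\<lambda>(B, c, d). B \<subseteq> A \<and> cl B = rect c d y (y + 2) \<and> c \<le> d)"
  have "P (A, x1, x2)" using R by (simp add: P_def)
  then obtain T where T: "P T" and min: "\<And>U. P U \<Longrightarrow> (\<lambda>(B, c, d). nat (d - c)) T \<le> (\<lambda>(B, c, d). nat (d - c)) U"
    using ex_has_least_nat[of P _ "\<lambda>(B, c, d). nat (d - c)"] by blast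
  obtain B c d where Tq: "T = (B, c, d)" by (cases T) auto
  have B: "B \<subseteq> A" "cl B = rect c d y (y + 2)" "c \<le> d" using T by (auto simp: P_def Tq)
  have narrow: "d - c \<le> f - e" if "X \<subseteq> A" "cl X = rect e f y (y + 2)" "e \<le> f" for X e f
    using min[of "(X, e, f)"] that by (simp add: P_def Tq)
  have y: "y \<le> y + 2" by simp
  have x: "x1 \<le> x2" using R by simp
  note r = right_columns(4-6)[OF fin ind R(1) x B y] and l = left_columns(4-6)[OF fin ind R(1) x B y]
  note tot = full_height_card[OF fin ind R(1) x B y]
  have AR: "A \<subseteq> rect x1 x2 y (y + 2)" using subset_cl[of A] R by simp
  have finB: "finite B" using fin B finite_subset by blast
  have indB: "indep B" using ind B indep_subset by blast
  have K: "6 * int (card B) \<le> 5 * (d - c) + 13 \<or> 6 * int (card B) \<le> 5 * (d - c) + 14 \<and>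
    ((\<forall>z. y \<le> z \<and> z \<le> y + 2 \<longrightarrow> (d + 1, z) \<notin> A) \<or> (\<forall>z. y \<le> z \<and> z \<le> y + 2 \<longrightarrow> (c - 1, z) \<notin> A))"
  proof -
    consider "d = c" | "d = c + 1" | "c + 2 \<le> d" using B by linarith
    then show ?thesis
    proof cases
      case 1
      have BS: "B \<subseteq> rect c c y (y + 2)" using subset_cl[of B] B 1 by simp
      have e: "(c, y) \<in> B" "(c, y + 2) \<in> B"
        using side_hit(3)[OF B(2,3) y] side_hit(4)[OF B(2,3) y] BS by force+
      have "(c, y + 1) \<notin> B"
      proof
        assume m: "(c, y + 1) \<in> B"
        have "(c, y) \<in> cl {(c, y), (c, y + 2)}" "(c, y + 2) \<in> cl {(c, y), (c, y + 2)}" using subset_cl by blast+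
        from nclosedD[OF nclosed_cl this, of "(c, y + 1)"] have "(c, y + 1) \<in> cl {(c, y), (c, y + 2)}" by simp
        then show False using indepD[OF indB m, of "{(c, y), (c, y + 2)}"] e by auto
      qed
      moreover have "v = y \<or> v = y + 1 \<or> v = y + 2" if "y \<le> v" "v \<le> y + 2" for v using that by linarith
      ultimately have "B \<subseteq> {(c, y), (c, y + 2)}" using BS by (force simp: rect_def)
      then have "card B \<le> card {(c, y), (c, y + 2)}" by (intro card_mono) auto
      then have "card B \<le> 2" by simp
      then show ?thesis using 1 by simp
    next
      case 2
      have "6 * int (card (prod.swap ` B)) \<le> 4 * (y + 2 - y + 3)"
      proof (rule two_row_bound)
        show "finite (prod.swap ` B)" "indep (prod.swap ` B)" using finB indB by (auto simp: swap_facts)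
        show "cl (prod.swap ` B) = rect y (y + 2) c (c + 1)" using B(2) 2 by (simp add: swap_facts)
      qed simp
      then show ?thesis using 2 by (simp add: card_image)
    next
      case 3
      show ?thesis by (rule card_thick_cap[OF fin ind B(1,2) 3 narrow])
    qed
  qed
  have Z: "6 * int (card {p \<in> A. d < fst p}) \<le> 5 * (x2 - d) + (if x2 = d + 1 then 1 else 0)"
    using r by (cases "x2 = d") auto
  have W: "6 * int (card {p \<in> A. fst p < c}) \<le> 5 * (c - x1) + (if x1 = c - 1 then 1 else 0)"
    using l by (cases "x1 = c") auto
  obtain z where "(x1, z) \<in> A" using side_hit(1)[OF R(1) x y] by blast
  then have e1: "\<not> (\<forall>z. y \<le> z \<and> z \<le> y + 2 \<longrightarrow> (c - 1, z) \<notin> A)" if "x1 = c - 1" using AR that by fastforce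
  obtain z where "(x2, z) \<in> A" using side_hit(2)[OF R(1) x y] by blast
  then have e2: "\<not> (\<forall>z. y \<le> z \<and> z \<le> y + 2 \<longrightarrow> (d + 1, z) \<notin> A)" if "x2 = d + 1" using AR that by fastforce
  show ?thesis using K Z W tot e1 e2 by (cases "x1 = c - 1"; cases "x2 = d + 1") auto
qed

section \<open>The upper bound\<close>

definition phi :: "int \<Rightarrow> int \<Rightarrow> int \<Rightarrow> int \<Rightarrow> int" where
  "phi x1 x2 y1 y2 = (x2 - x1 + 3) * (y2 - y1 + 3)"

lemma phi_small:
  assumes B: "cl B = rect s1 s2 t1 t2" "s1 \<le> s2" "t1 \<le> t2" "finite B" "card B \<le> 2"
  shows "6 * int (card B) \<le> phi s1 s2 t1 t2"
proof -
  have BS: "B \<subseteq> rect s1 s2 t1 t2" using subset_cl[of B] B by simp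
  have 9: "3 * 3 \<le> phi s1 s2 t1 t2" unfolding phi_def using B by (intro mult_mono) auto
  show ?thesis
  proof (cases "s1 = s2 \<and> t1 = t2")
    case True
    then have "B \<subseteq> {(s1, t1)}" using BS by (auto simp: rect_def)
    then have "card B \<le> card {(s1, t1)}" by (intro card_mono) auto
    then show ?thesis using 9 by simp
  next
    case False
    then consider "s1 < s2" | "t1 < t2" using B by linarith
    then have "12 \<le> phi s1 s2 t1 t2"
    proof cases
      case 1
      have "4 * 3 \<le> phi s1 s2 t1 t2" unfolding phi_def using B 1 by (intro mult_mono) auto
      then show ?thesis by simp
    next
      case 2
      have "3 * 4 \<le> phi s1 s2 t1 t2" unfolding phi_def using B 2 by (intro mult_mono) auto
      then show ?thesis by simp
    qed
    then show ?thesis using B by simp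
  qed
qed

lemma splitting_image:
  fixes f :: "int \<times> int \<Rightarrow> int \<times> int"
  assumes f: "bij f" "\<And>p q. d1 (f p) (f q) = d1 p q"
    and sp: "splitting A B C s1 s2 t1 t2 p1 p2 q1 q2"
    and S: "f ` rect s1 s2 t1 t2 = rect s1' s2' t1' t2'" "s1' \<le> s2'" "t1' \<le> t2'"
    and P: "f ` rect p1 p2 q1 q2 = rect p1' p2' q1' q2'" "p1' \<le> p2'" "q1' \<le> q2'"
    and g: "gap p1' p2' s1' s2' + gap q1' q2' t1' t2' \<le> 2"
  shows "splitting (f ` A) (f ` B) (f ` C) s1' s2' t1' t2' p1' p2' q1' q2'"
proof -
  note i = d1_isometry_image[OF f]
  note d = splittingD[OF sp]
  have inj: "inj f" using f(1) bij_is_inj by blast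
  have e: "f ` A = f ` B \<union> f ` C" "f ` B \<inter> f ` C = {}" "f ` B \<noteq> {}" "f ` C \<noteq> {}"
    using d(1-4) inj by (auto simp: image_Un inj_eq)
  have cB: "cl (f ` B) = rect s1' s2' t1' t2'" and cC: "cl (f ` C) = rect p1' p2' q1' q2'"
    using d(5,8) S P i(2) by simp_all
  have "\<not> far (rect s1' s2' t1' t2') (rect p1' p2' q1' q2')"
    using g far_rect_iff[OF S(2,3) P(2,3)] by (simp add: gap_commute[of p1'] gap_commute[of q1'])
  from cl_Un_rect[OF cB cC this] have h: "cl (f ` A) = rect (min s1' p1') (max s2' p2') (min t1' q1') (max t2' q2')"
    unfolding e(1) .
  have "far (cl D) (rect s1' s2' t1' t2')" if D: "D \<subset> f ` C" for D
  proof -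
    obtain E where E: "E \<subset> C" "D = f ` E"
    proof -
      obtain E where "E \<subseteq> C" "D = f ` E" using D subset_image_iff[of D f C] by blast
      then show thesis using that[of E] D by blast
    qed
    show ?thesis using d(13)[OF E(1)] i(3)[of "cl E" "rect s1 s2 t1 t2"] i(2)[of E] E(2) S(1) by simp
  qed
  then show ?thesis unfolding splitting_def using e cB cC S P g h by simp
qed

lemma corner_split_flipx:
  assumes c: "corner_split A B C s1 s2 t1 t2 p1 p2 q1 q2"
  shows "corner_split (flipx ` A) (flipx ` B) (flipx ` C) (- s2) (- s1) t1 t2 (- p2) (- p1) q1 q2"
proof -
  have sp: "splitting A B C s1 s2 t1 t2 p1 p2 q1 q2" using c unfolding corner_split_def by simp
  have inj: "inj_on flipx C" using bij_is_inj[OF bij_flipx] inj_on_subset by blast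
  have "splitting (flipx ` A) (flipx ` B) (flipx ` C) (- s2) (- s1) t1 t2 (- p2) (- p1) q1 q2"
    by (rule splitting_image[OF bij_flipx d1_flipx sp]) (use splittingD[OF sp] in \<open>auto simp: gap_def\<close>)
  then show ?thesis using c unfolding corner_split_def by (auto simp: card_image[OF inj])
qed

lemma corner_split_flipy:
  assumes c: "corner_split A B C s1 s2 t1 t2 p1 p2 q1 q2"
  shows "corner_split (flipy ` A) (flipy ` B) (flipy ` C) s1 s2 (- t2) (- t1) p1 p2 (- q2) (- q1)"
proof -
  have sp: "splitting A B C s1 s2 t1 t2 p1 p2 q1 q2" using c unfolding corner_split_def by simp
  have inj: "inj_on flipy C" using bij_is_inj[OF bij_flipy] inj_on_subset by blast
  have "splitting (flipy ` A) (flipy ` B) (flipy ` C) s1 s2 (- t2) (- t1) p1 p2 (- q2) (- q1)"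
    by (rule splitting_image[OF bij_flipy d1_flipy sp]) (use splittingD[OF sp] in \<open>auto simp: gap_def\<close>)
  then show ?thesis using c unfolding corner_split_def by (auto simp: card_image[OF inj])
qed

lemma far_quadrant:
  assumes f: "far X (rect s1 s2 t1 t2)" and X: "X \<subseteq> {s1..} \<times> {t1..}" and le: "s1 \<le> s2" "t1 \<le> t2"
  shows "far X ({..s2} \<times> {..t2})"
  unfolding far_def
proof (intro ballI)
  fix p q assume p: "p \<in> X" and q: "q \<in> {..s2} \<times> {..t2}"
  obtain x y where xy: "p = (x, y)" by fastforce
  have ge: "s1 \<le> x" "t1 \<le> y" using X p xy by auto
  have "(min x s2, min y t2) \<in> rect s1 s2 t1 t2" using ge le by auto
  then have "3 \<le> d1 p (min x s2, min y t2)" using f p unfolding far_def by blast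
  then show "3 \<le> d1 p q" using q xy by (cases q) auto
qed

lemma far_rect_quadrant:
  assumes "far (rect s1 s2 t1 t2) ({..a} \<times> {..b})" "s1 \<le> s2" "t1 \<le> t2"
  shows "3 \<le> max 0 (s1 - a) + max 0 (t1 - b)"
proof -
  have "(s1, t1) \<in> rect s1 s2 t1 t2" "(min s1 a, min t1 b) \<in> {..a} \<times> {..b}" using assms by auto
  then have "3 \<le> d1 (s1, t1) (min s1 a, min t1 b)" using assms(1) unfolding far_def by blast
  then show ?thesis by (auto simp: min_def max_def split: if_splits)
qed

text \<open>The enlarged parts overlap in the product that is subtracted, while two opposite corners of
  the enlarged hull stay uncovered.\<close>

lemma phi_corner:
  "phi s1 p2 t1 q2 = phi s1 s2 t1 t2 + phi p1 p2 q1 q2 - (s2 + 3 - p1) * (t2 + 3 - q1)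
     + (p1 - s1) * (q2 - t2) + (p2 - s2) * (q1 - t1)"
  unfolding phi_def by (simp add: algebra_simps)

text \<open>If every proper subset stays away from a quadrant, then nearly all of the overlap of the
  enlarged hull with the enlarged quadrant is unused. This is applied to the second part of a
  splitting, whose proper subsets stay away from the first part.\<close>

definition cornered :: "(int \<times> int) set \<Rightarrow> bool" where
  "cornered A \<longleftrightarrow> (\<forall>p m q n a b. cl A = rect p m q n \<longrightarrow> p < m \<longrightarrow> q < n \<longrightarrow>
     max 0 (p - a) + max 0 (q - b) \<le> 2 \<longrightarrow> (\<forall>D. D \<subset> A \<longrightarrow> far (cl D) ({..a} \<times> {..b})) \<longrightarrow>
     (a + 3 - p) * (b + 3 - q) \<le> phi p m q n - 6 * int (card A) + 6)"

lemma corneredD: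
  assumes "cornered A" and "cl A = rect p m q n" "p < m" "q < n" "max 0 (p - a) + max 0 (q - b) \<le> 2"
    and "\<forall>D. D \<subset> A \<longrightarrow> far (cl D) ({..a} \<times> {..b})"
  shows "(a + 3 - p) * (b + 3 - q) \<le> phi p m q n - 6 * int (card A) + 6"
proof -
  have "cl A = rect p m q n \<longrightarrow> p < m \<longrightarrow> q < n \<longrightarrow>
     max 0 (p - a) + max 0 (q - b) \<le> 2 \<longrightarrow> (\<forall>D. D \<subset> A \<longrightarrow> far (cl D) ({..a} \<times> {..b})) \<longrightarrow>
     (a + 3 - p) * (b + 3 - q) \<le> phi p m q n - 6 * int (card A) + 6"
    using assms(1) unfolding cornered_def by (elim allE)
  then show ?thesis using assms(2-) by (elim impE)
qed

lemma corner_bound: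
  assumes c: "corner_split A B C s1 s2 t1 t2 p1 p2 q1 q2" and fin: "finite A"
    and o: "s1 < p1" "s2 < p2" "t1 < q1" "t2 < q2"
    and UB: "6 * int (card B) \<le> phi s1 s2 t1 t2" and YC: "cornered C"
  shows "6 * int (card A) \<le> phi s1 p2 t1 q2 + 6 - (p1 - s1) * (q2 - t2) - (p2 - s2) * (q1 - t1)"
    "3 \<le> (p1 - s1) * (q2 - t2)" "3 \<le> (p2 - s2) * (q1 - t1)"
proof -
  have sp: "splitting A B C s1 s2 t1 t2 p1 p2 q1 q2" and c2: "2 \<le> card C"
    and th: "s1 < s2" "t1 < t2" "p1 < p2" "q1 < q2"
    using c unfolding corner_split_def by auto
  note d = splittingD[OF sp]
  have f: "finite B" "finite C" using fin d(1) by auto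
  have cA: "card A = card B + card C" unfolding d(1) by (rule card_Un_disjoint) (use f d in auto)
  have near: "max 0 (p1 - s2) + max 0 (q1 - t2) \<le> 2" using d(11) o th by (auto simp: gap_def)
  have fq: "\<forall>D. D \<subset> C \<longrightarrow> far (cl D) ({..s2} \<times> {..t2})"
  proof (intro allI impI, rule far_quadrant[OF d(13)])
    fix D assume D: "D \<subset> C"
    then show "D \<subset> C" .
    have "cl D \<subseteq> rect p1 p2 q1 q2" using cl_mono[of D C] D d(8) by auto
    then show "cl D \<subseteq> {s1..} \<times> {t1..}" using o by (fastforce simp: rect_def)
  qed (use th in auto)
  have Y: "(s2 + 3 - p1) * (t2 + 3 - q1) \<le> phi p1 p2 q1 q2 - 6 * int (card C) + 6"
    by (rule corneredD[OF YC d(8) th(3,4) near fq])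
  show "6 * int (card A) \<le> phi s1 p2 t1 q2 + 6 - (p1 - s1) * (q2 - t2) - (p2 - s2) * (q1 - t1)"
    using phi_corner[of s1 p2 t1 q2 s2 t2 p1 q1] Y UB cA by simp
  have fw: "3 \<le> gap x x s1 s2 + gap z z t1 t2" if "(x, z) \<in> C" for x z
  proof -
    have "{(x, z)} \<subset> C" using that c2 by auto
    from d(13)[OF this] show ?thesis using far_point_rect_iff[OF d(6,7)] by simp
  qed
  have CS: "C \<subseteq> rect p1 p2 q1 q2" using subset_cl[of C] d(8) by simp
  obtain z where z: "(p1, z) \<in> C" using side_hit(1)[OF d(8-10)] by blast
  then have zq: "q1 \<le> z" "z \<le> q2" using CS by auto
  obtain x where x: "(x, q1) \<in> C" using side_hit(3)[OF d(8-10)] by blast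
  then have xp: "p1 \<le> x" "x \<le> p2" using CS by auto
  have i: "3 \<le> max 0 (p1 - s2) + (q2 - t2)" using fw[OF z] zq o by (auto simp: gap_def)
  have j: "3 \<le> (p2 - s2) + max 0 (q1 - t2)" using fw[OF x] xp o by (auto simp: gap_def)
  have prod: "3 \<le> u * v" if uv: "1 \<le> u" "1 \<le> v" "3 \<le> u \<or> 3 \<le> v \<or> 2 \<le> u \<and> 2 \<le> v" for u v :: int
  proof -
    consider "3 \<le> u" | "3 \<le> v" | "2 \<le> u" "2 \<le> v" using uv by blast
    then show ?thesis
    proof cases
      case 1 then show ?thesis using mult_mono[of 3 u 1 v] uv by simp
    next
      case 2 then show ?thesis using mult_mono[of 1 u 3 v] uv by simp
    next
      case 3 then show ?thesis using mult_mono[of 2 u 2 v] uv by simp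
    qed
  qed
  show "3 \<le> (p1 - s1) * (q2 - t2)"
    by (rule prod) (use i near o th in linarith)+
  show "3 \<le> (p2 - s2) * (q1 - t1)"
    by (rule prod) (use j near o th in linarith)+
qed

lemma quadrant_product:
  fixes p q a b P Q :: int
  assumes "max 0 (p - a) + max 0 (q - b) \<le> 2"
    and "3 \<le> max 0 (p - a) + max 0 (Q - b)" "3 \<le> max 0 (P - a) + max 0 (q - b)"
  shows "(a + 3 - p) * (b + 3 - q) \<le> (P - p) * (Q - q) + 3"
proof -
  define i where "i = max 0 (p - a)"
  define j where "j = max 0 (q - b)"
  have ij: "0 \<le> i" "0 \<le> j" "i + j \<le> 2" "i > 0 \<Longrightarrow> p = a + i" "j > 0 \<Longrightarrow> q = b + j" "p \<le> a + i" "q \<le> b + j"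
    using assms(1) unfolding i_def j_def by auto
  have PQ: "a + 3 - j \<le> P" "b + 3 - i \<le> Q" using assms(2,3) ij unfolding i_def[symmetric] j_def[symmetric] by auto
  have "(a + 3 - j - p) * (b + 3 - i - q) \<le> (P - p) * (Q - q)"
    by (rule mult_mono) (use PQ ij in auto)
  moreover have "(a + 3 - p) * (b + 3 - q) = (a + 3 - j - p) * (b + 3 - i - q) + i * (a + 3 - p) + j * (b + 3 - q) - i * j"
    by (simp add: algebra_simps)
  moreover have "i * (a + 3 - p) + j * (b + 3 - q) - i * j \<le> 3"
  proof -
    consider "i = 0" "j = 0" | "i = 0" "j = 1" | "i = 0" "j = 2" | "i = 1" "j = 0" | "i = 1" "j = 1" | "i = 2" "j = 0"
      using ij(1-3) by linarith
    then show ?thesis by cases (use ij in auto)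
  qed
  ultimately show ?thesis by linarith
qed

lemma phi_single_quadrant:
  assumes le: "s1 \<le> s2" "t1 \<le> t2" and near: "gap u u s1 s2 + gap v v t1 t2 \<le> 2"
    and q: "max 0 (min s1 u - a) + max 0 (min t1 v - b) \<le> 2"
    and S: "3 \<le> max 0 (s1 - a) + max 0 (t1 - b)" and w: "3 \<le> max 0 (u - a) + max 0 (v - b)"
  shows "(a + 3 - min s1 u) * (b + 3 - min t1 v) + phi s1 s2 t1 t2 \<le> phi (min s1 u) (max s2 u) (min t1 v) (max t2 v)"
proof -
  have add: "A + p \<le> p'" if "p' = p + Y + z" "X \<le> Y" "3 \<le> z" "A \<le> X + 3" for A X Y p p' z :: int
    using that by linarith
  consider (1) "u < s1" "t1 < v" | (2) "s1 < u" "v < t1" | (3) "u \<le> s1" "v \<le> t1" | (4) "s1 \<le> u" "t1 \<le> v" by linarith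
  then show ?thesis
  proof cases
    case 1
    then have m: "min s1 u = u" "min t1 v = t1" "max s2 u = s2" using le by auto
    have P: "(a + 3 - u) * (b + 3 - t1) \<le> (s1 - u) * (v - t1) + 3"
      by (rule quadrant_product) (use q S w m in auto)
    show ?thesis
    proof (cases "v \<le> t2")
      case True
      have "phi u s2 t1 t2 = phi s1 s2 t1 t2 + (s1 - u) * (t2 - t1) + 3 * (s1 - u)"
        by (simp add: phi_def algebra_simps)
      moreover have "(s1 - u) * (v - t1) \<le> (s1 - u) * (t2 - t1)" by (rule mult_left_mono) (use 1 True in auto)
      moreover have mx: "max t2 v = t2" using True by simp
      moreover have "3 \<le> 3 * (s1 - u)" using 1 by simp
      ultimately have "(a + 3 - u) * (b + 3 - t1) + phi s1 s2 t1 t2 \<le> phi u s2 t1 t2" using P by (intro add)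
      then show ?thesis by (simp only: m mx)
    next
      case False
      then have "u = s1 - 1" "v = t2 + 1" using near 1 by (auto simp: gap_def)
      then show ?thesis using P m le by (simp add: phi_def algebra_simps)
    qed
  next
    case 2
    then have m: "min s1 u = s1" "min t1 v = v" "max t2 v = t2" using le by auto
    have P: "(a + 3 - s1) * (b + 3 - v) \<le> (u - s1) * (t1 - v) + 3"
      by (rule quadrant_product) (use q S w m in auto)
    show ?thesis
    proof (cases "u \<le> s2")
      case True
      have "phi s1 s2 v t2 = phi s1 s2 t1 t2 + (s2 - s1) * (t1 - v) + 3 * (t1 - v)"
        by (simp add: phi_def algebra_simps)
      moreover have "(u - s1) * (t1 - v) \<le> (s2 - s1) * (t1 - v)" by (rule mult_right_mono) (use 2 True in auto)
      moreover have mx: "max s2 u = s2" using True by simp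
      moreover have "3 \<le> 3 * (t1 - v)" using 2 by simp
      ultimately have "(a + 3 - s1) * (b + 3 - v) + phi s1 s2 t1 t2 \<le> phi s1 s2 v t2" using P by (intro add)
      then show ?thesis by (simp only: m mx)
    next
      case False
      then have "u = s2 + 1" "v = t1 - 1" using near 2 by (auto simp: gap_def)
      then show ?thesis using P m le by (simp add: phi_def algebra_simps)
    qed
  next
    case 3
    then show ?thesis using q w by (auto simp: min_def split: if_splits)
  next
    case 4
    then show ?thesis using q S by (auto simp: min_def split: if_splits)
  qed
qed

definition thick_bounded :: "(int \<times> int) set \<Rightarrow> bool" where
  "thick_bounded A \<longleftrightarrow> (\<forall>x1 x2 y1 y2. cl A = rect x1 x2 y1 y2 \<longrightarrow> x1 < x2 \<longrightarrow> y1 < y2 \<longrightarrow>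
     6 * int (card A) \<le> phi x1 x2 y1 y2)"

lemma thick_boundedD:
  "thick_bounded A \<Longrightarrow> cl A = rect x1 x2 y1 y2 \<Longrightarrow> x1 < x2 \<Longrightarrow> y1 < y2 \<Longrightarrow> 6 * int (card A) \<le> phi x1 x2 y1 y2"
  unfolding thick_bounded_def by (elim allE impE)

lemma single_split_bound:
  assumes sg: "single_split A B C s1 s2 t1 t2 p1 p2 q1 q2" and fin: "finite A" and U: "thick_bounded B"
  shows "card A = card B + 1" "6 * int (card B) \<le> phi s1 s2 t1 t2" "finite B"
proof -
  have sp: "splitting A B C s1 s2 t1 t2 p1 p2 q1 q2" and pq: "C = {(p1, q1)}"
    and th: "(s1 < s2 \<and> t1 < t2) \<or> card B \<le> 2"
    using sg unfolding single_split_def by auto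
  note d = splittingD[OF sp]
  show f: "finite B" using fin d(1) by auto
  show "card A = card B + 1" using d(1,2) pq f by auto
  show "6 * int (card B) \<le> phi s1 s2 t1 t2"
    using th
  proof
    assume "s1 < s2 \<and> t1 < t2"
    then show ?thesis using thick_boundedD[OF U d(5)] by simp
  next
    assume "card B \<le> 2"
    then show ?thesis using phi_small[OF d(5-7) f] by simp
  qed
qed

lemma corner_bound_flipx:
  assumes c: "corner_split A B C s1 s2 t1 t2 p1 p2 q1 q2" and fin: "finite A"
    and o: "p1 < s1" "p2 < s2" "t1 < q1" "t2 < q2"
    and UB: "6 * int (card B) \<le> phi s1 s2 t1 t2" and YC: "cornered (flipx ` C)"
  shows "6 * int (card A) \<le> phi p1 s2 t1 q2 + 6 - (s2 - p2) * (q2 - t2) - (s1 - p1) * (q1 - t1)"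
    "3 \<le> (s2 - p2) * (q2 - t2)" "3 \<le> (s1 - p1) * (q1 - t1)"
proof -
  have inj: "inj_on flipx X" for X using bij_is_inj[OF bij_flipx] inj_on_subset by blast
  have 1: "finite (flipx ` A)" "- s2 < - p2" "- s1 < - p1" using fin o by auto
  have 2: "6 * int (card (flipx ` B)) \<le> phi (- s2) (- s1) t1 t2" using UB by (simp add: card_image[OF inj] phi_def)
  note b = corner_bound[OF corner_split_flipx[OF c] 1 o(3,4) 2 YC]
  show "6 * int (card A) \<le> phi p1 s2 t1 q2 + 6 - (s2 - p2) * (q2 - t2) - (s1 - p1) * (q1 - t1)"
    using b(1) by (simp add: card_image[OF inj] phi_def)
  show "3 \<le> (s2 - p2) * (q2 - t2)" "3 \<le> (s1 - p1) * (q1 - t1)" using b(2,3) by simp_all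
qed

lemma corner_bound_flipy:
  assumes c: "corner_split A B C s1 s2 t1 t2 p1 p2 q1 q2" and fin: "finite A"
    and o: "s1 < p1" "s2 < p2" "q1 < t1" "q2 < t2"
    and UB: "6 * int (card B) \<le> phi s1 s2 t1 t2" and YC: "cornered (flipy ` C)"
  shows "6 * int (card A) \<le> phi s1 p2 q1 t2 + 6 - (p1 - s1) * (t1 - q1) - (p2 - s2) * (t2 - q2)"
    "3 \<le> (p1 - s1) * (t1 - q1)" "3 \<le> (p2 - s2) * (t2 - q2)"
proof -
  have inj: "inj_on flipy X" for X using bij_is_inj[OF bij_flipy] inj_on_subset by blast
  have 1: "finite (flipy ` A)" using fin by auto
  have 3: "- t2 < - q2" "- t1 < - q1" using o by auto
  have 2: "6 * int (card (flipy ` B)) \<le> phi s1 s2 (- t2) (- t1)" using UB by (simp add: card_image[OF inj] phi_def)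
  note b = corner_bound[OF corner_split_flipy[OF c] 1 o(1,2) 3 2 YC]
  show "6 * int (card A) \<le> phi s1 p2 q1 t2 + 6 - (p1 - s1) * (t1 - q1) - (p2 - s2) * (t2 - q2)"
    using b(1) by (simp add: card_image[OF inj] phi_def)
  show "3 \<le> (p1 - s1) * (t1 - q1)" "3 \<le> (p2 - s2) * (t2 - q2)" using b(2,3) by simp_all
qed

lemma cornered_step:
  assumes fin: "finite A" and ind: "indep A"
    and IH: "\<And>D. card D < card A \<Longrightarrow> finite D \<Longrightarrow> indep D \<Longrightarrow> thick_bounded D \<and> cornered D"
  shows "cornered A"
  unfolding cornered_def
proof (intro allI impI)
  fix p m q n a b
  assume R: "cl A = rect p m q n" "p < m" "q < n" and near: "max 0 (p - a) + max 0 (q - b) \<le> 2"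
    and far: "\<forall>D. D \<subset> A \<longrightarrow> far (cl D) ({..a} \<times> {..b})"
  have sub: "thick_bounded D" "cornered D" "cornered (flipx ` D)" "cornered (flipy ` D)" if "D \<subset> A" for D
  proof -
    have D: "card D < card A" "finite D" "indep D"
      using that psubset_card_mono[OF fin that] fin finite_subset ind indep_subset by blast+
    then show "thick_bounded D" "cornered D" using IH by blast+
    have "card (flipx ` D) = card D" "card (flipy ` D) = card D"
      using bij_is_inj[OF bij_flipx] bij_is_inj[OF bij_flipy] by (auto intro!: card_image elim: inj_on_subset)
    then show "cornered (flipx ` D)" "cornered (flipy ` D)"
      using IH[of "flipx ` D"] IH[of "flipy ` D"] D flipx_facts(3) flipy_facts(3) by auto
  qed
  obtain B C s1 s2 t1 t2 p1 p2 q1 q2 where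
    "single_split A B C s1 s2 t1 t2 p1 p2 q1 q2 \<or> corner_split A B C s1 s2 t1 t2 p1 p2 q1 q2"
    using split_exists[OF fin ind R] by (elim exE)
  then show "(a + 3 - p) * (b + 3 - q) \<le> phi p m q n - 6 * int (card A) + 6"
  proof
    assume sg: "single_split A B C s1 s2 t1 t2 p1 p2 q1 q2"
    then have sp: "splitting A B C s1 s2 t1 t2 p1 p2 q1 q2" and pq: "p2 = p1" "q2 = q1"
      unfolding single_split_def by auto
    note d = splittingD[OF sp]
    have BC: "B \<subset> A" "C \<subset> A" using d(1-4) by blast+
    have S: "3 \<le> max 0 (s1 - a) + max 0 (t1 - b)"
      using far_rect_quadrant[of s1 s2 t1 t2 a b] far BC(1) d(5-7) by metis
    have w: "3 \<le> max 0 (p1 - a) + max 0 (q1 - b)"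
      using far_rect_quadrant[of p1 p2 q1 q2 a b] far BC(2) d(8-10) by metis
    have h: "p = min s1 p1" "m = max s2 p1" "q = min t1 q1" "n = max t2 q1"
      using d(12) R rect_eq_iff[of p m q n] pq by auto
    have "(a + 3 - p) * (b + 3 - q) + phi s1 s2 t1 t2 \<le> phi p m q n"
      unfolding h by (rule phi_single_quadrant[OF d(6,7) _ _ S w]) (use d(11) pq near h in auto)
    then show ?thesis using single_split_bound[OF sg fin sub(1)[OF BC(1)]] by simp
  next
    assume cs: "corner_split A B C s1 s2 t1 t2 p1 p2 q1 q2"
    then have sp: "splitting A B C s1 s2 t1 t2 p1 p2 q1 q2" and th: "s1 < s2" "t1 < t2" "p1 < p2" "q1 < q2"
      and o: "s1 < p1 \<and> s2 < p2 \<or> p1 < s1 \<and> p2 < s2" "t1 < q1 \<and> t2 < q2 \<or> q1 < t1 \<and> q2 < t2"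
      unfolding corner_split_def by auto
    note d = splittingD[OF sp]
    have BC: "B \<subset> A" "C \<subset> A" using d(1-4) by blast+
    have S: "3 \<le> max 0 (s1 - a) + max 0 (t1 - b)"
      using far_rect_quadrant[of s1 s2 t1 t2 a b] far BC(1) d(5-7) by metis
    have w: "3 \<le> max 0 (p1 - a) + max 0 (q1 - b)"
      using far_rect_quadrant[of p1 p2 q1 q2 a b] far BC(2) d(8-10) by metis
    have h: "p = min s1 p1" "m = max s2 p2" "q = min t1 q1" "n = max t2 q2"
      using d(12) R rect_eq_iff[of p m q n] by auto
    have UB: "6 * int (card B) \<le> phi s1 s2 t1 t2" by (rule thick_boundedD[OF sub(1)[OF BC(1)] d(5) th(1,2)])
    consider "s1 < p1" "t1 < q1" | "p1 < s1" "q1 < t1"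
      | (y) "s1 < p1" "s2 < p2" "q1 < t1" "q2 < t2" | (x) "p1 < s1" "p2 < s2" "t1 < q1" "t2 < q2"
      using o by blast
    then show ?thesis
    proof cases
      case 1
      then show ?thesis using S near h by simp
    next
      case 2
      then show ?thesis using w near h by simp
    next
      case y
      then have h': "p = s1" "m = p2" "q = q1" "n = t2" using h by auto
      have "(a + 3 - p) * (b + 3 - q) \<le> (p1 - p) * (t1 - q) + 3"
        by (rule quadrant_product[OF near]) (use S w h' in auto)
      then show ?thesis using corner_bound_flipy[OF cs fin y UB sub(4)[OF BC(2)]] unfolding h' by linarith
    next
      case x
      then have h': "p = p1" "m = s2" "q = t1" "n = q2" using h by auto
      have "(a + 3 - p) * (b + 3 - q) \<le> (s1 - p) * (q1 - q) + 3"
        by (rule quadrant_product[OF near]) (use S w h' in auto)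
      then show ?thesis using corner_bound_flipx[OF cs fin x UB sub(3)[OF BC(2)]] unfolding h' by linarith
    qed
  qed
qed

lemma thick_bounded_step:
  assumes fin: "finite A" and ind: "indep A"
    and IH: "\<And>D. card D < card A \<Longrightarrow> finite D \<Longrightarrow> indep D \<Longrightarrow> thick_bounded D \<and> cornered D"
  shows "thick_bounded A"
  unfolding thick_bounded_def
proof (intro allI impI)
  fix x1 x2 y1 y2
  assume R: "cl A = rect x1 x2 y1 y2" "x1 < x2" "y1 < y2"
  have sub: "thick_bounded D" "cornered D" "cornered (flipx ` D)" "cornered (flipy ` D)" "cornered (flipy ` flipx ` D)"
    if "D \<subset> A" for D
  proof -
    have D: "card D < card A" "finite D" "indep D"
      using that psubset_card_mono[OF fin that] fin finite_subset ind indep_subset by blast+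
    then show "thick_bounded D" "cornered D" using IH by blast+
    have "card (flipx ` D) = card D" "card (flipy ` D) = card D" "card (flipy ` flipx ` D) = card (flipx ` D)"
      using bij_is_inj[OF bij_flipx] bij_is_inj[OF bij_flipy] by (auto intro!: card_image elim: inj_on_subset)
    then show "cornered (flipx ` D)" "cornered (flipy ` D)" "cornered (flipy ` flipx ` D)"
      using IH[of "flipx ` D"] IH[of "flipy ` D"] IH[of "flipy ` flipx ` D"] D flipx_facts(3) flipy_facts(3) by auto
  qed
  have sw: "finite (prod.swap ` A)" "indep (prod.swap ` A)" "cl (prod.swap ` A) = rect y1 y2 x1 x2" "card (prod.swap ` A) = card A"
    using fin ind R by (simp_all add: swap_facts card_image)
  consider "y2 = y1 + 1" | "y2 = y1 + 2" | "x2 = x1 + 1" | "x2 = x1 + 2" | (big) "x1 + 3 \<le> x2" "y1 + 3 \<le> y2"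
    using R by linarith
  then show "6 * int (card A) \<le> phi x1 x2 y1 y2"
  proof cases
    case 1 then show ?thesis using two_row_bound[OF fin ind, of x1 x2 y1] R by (simp add: phi_def)
  next
    case 2 then show ?thesis using three_row_bound[OF fin ind, of x1 x2 y1] R by (simp add: phi_def)
  next
    case 3 then show ?thesis using two_row_bound[OF sw(1,2), of y1 y2 x1] R sw by (simp add: phi_def)
  next
    case 4 then show ?thesis using three_row_bound[OF sw(1,2), of y1 y2 x1] R sw by (simp add: phi_def)
  next
    case big
    obtain B C s1 s2 t1 t2 p1 p2 q1 q2 where
      "single_split A B C s1 s2 t1 t2 p1 p2 q1 q2 \<or> corner_split A B C s1 s2 t1 t2 p1 p2 q1 q2"
      using split_exists[OF fin ind R] by (elim exE)
    then show ?thesis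
    proof
      assume sg: "single_split A B C s1 s2 t1 t2 p1 p2 q1 q2"
      then have sp: "splitting A B C s1 s2 t1 t2 p1 p2 q1 q2" and pq: "p2 = p1" "q2 = q1" "C = {(p1, q1)}"
        unfolding single_split_def by auto
      note d = splittingD[OF sp]
      have BC: "B \<subset> A" using d(1-4) by blast
      have h: "x1 = min s1 p1" "x2 = max s2 p1" "y1 = min t1 q1" "y2 = max t2 q1"
        using d(12) R rect_eq_iff[of x1 x2 y1 y2] pq by auto
      have "(p1, q1) \<notin> cl B" by (rule indepD[OF ind]) (use d(1,2) pq in auto)
      then have wS: "\<not> (s1 \<le> p1 \<and> p1 \<le> s2 \<and> t1 \<le> q1 \<and> q1 \<le> t2)" unfolding d(5) by simp
      define W H W' H' where "W = s2 - s1" and "H = t2 - t1" and "W' = x2 - x1" and "H' = y2 - y1"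
      have b: "0 \<le> W" "0 \<le> H" "3 \<le> W'" "3 \<le> H'" "W \<le> W'" "H \<le> H'" using d(6,7) big h unfolding W_def H_def W'_def H'_def by linarith+
      have "W + 1 \<le> W' \<or> H + 1 \<le> H'" using wS h unfolding W_def H_def W'_def H'_def by linarith
      then have "(W + 3) * (H + 3) + 6 \<le> (W' + 3) * (H' + 3)"
      proof
        assume "W + 1 \<le> W'"
        then have "(W + 1 + 3) * (H' + 3) \<le> (W' + 3) * (H' + 3)" by (intro mult_right_mono) (use b in auto)
        moreover have "(W + 3) * (H + 3) \<le> (W + 3) * (H' + 3)" by (intro mult_left_mono) (use b in auto)
        ultimately show ?thesis using b by (simp add: algebra_simps)
      next
        assume "H + 1 \<le> H'"
        then have "(W' + 3) * (H + 1 + 3) \<le> (W' + 3) * (H' + 3)" by (intro mult_left_mono) (use b in auto)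
        moreover have "(W + 3) * (H + 3) \<le> (W' + 3) * (H + 3)" by (intro mult_right_mono) (use b in auto)
        ultimately show ?thesis using b by (simp add: algebra_simps)
      qed
      then have "phi s1 s2 t1 t2 + 6 \<le> phi x1 x2 y1 y2" unfolding phi_def W_def H_def W'_def H'_def .
      then show ?thesis using single_split_bound[OF sg fin sub(1)[OF BC]] by simp
    next
      assume cs: "corner_split A B C s1 s2 t1 t2 p1 p2 q1 q2"
      then have sp: "splitting A B C s1 s2 t1 t2 p1 p2 q1 q2" and th: "s1 < s2" "t1 < t2" "p1 < p2" "q1 < q2"
        and o: "s1 < p1 \<and> s2 < p2 \<or> p1 < s1 \<and> p2 < s2" "t1 < q1 \<and> t2 < q2 \<or> q1 < t1 \<and> q2 < t2"
        unfolding corner_split_def by auto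
      note d = splittingD[OF sp]
      have BC: "B \<subset> A" "C \<subset> A" using d(1-4) by blast+
      have h: "x1 = min s1 p1" "x2 = max s2 p2" "y1 = min t1 q1" "y2 = max t2 q2"
        using d(12) R rect_eq_iff[of x1 x2 y1 y2] by auto
      have UB: "6 * int (card B) \<le> phi s1 s2 t1 t2" by (rule thick_boundedD[OF sub(1)[OF BC(1)] d(5) th(1,2)])
      consider (bl) "s1 < p1" "s2 < p2" "t1 < q1" "t2 < q2" | (xy) "p1 < s1" "p2 < s2" "q1 < t1" "q2 < t2"
        | (y) "s1 < p1" "s2 < p2" "q1 < t1" "q2 < t2" | (x) "p1 < s1" "p2 < s2" "t1 < q1" "t2 < q2"
        using o by blast
      then show ?thesis
      proof cases
        case bl
        then have h': "x1 = s1" "x2 = p2" "y1 = t1" "y2 = q2" using h by auto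
        show ?thesis using corner_bound[OF cs fin bl UB sub(2)[OF BC(2)]] unfolding h' by linarith
      next
        case y
        then have h': "x1 = s1" "x2 = p2" "y1 = q1" "y2 = t2" using h by auto
        show ?thesis using corner_bound_flipy[OF cs fin y UB sub(4)[OF BC(2)]] unfolding h' by linarith
      next
        case x
        then have h': "x1 = p1" "x2 = s2" "y1 = t1" "y2 = q2" using h by auto
        show ?thesis using corner_bound_flipx[OF cs fin x UB sub(3)[OF BC(2)]] unfolding h' by linarith
      next
        case xy
        then have h': "x1 = p1" "x2 = s2" "y1 = q1" "y2 = t2" using h by auto
        have inj: "inj_on flipx X" for X using bij_is_inj[OF bij_flipx] inj_on_subset by blast
        have 1: "finite (flipx ` A)" "- s2 < - p2" "- s1 < - p1" using fin xy by auto
        have 2: "6 * int (card (flipx ` B)) \<le> phi (- s2) (- s1) t1 t2" using UB by (simp add: card_image[OF inj] phi_def)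
        from corner_bound_flipy[OF corner_split_flipx[OF cs] 1 xy(3,4) 2 sub(5)[OF BC(2)]]
        have "6 * int (card A) \<le> phi (- s2) (- p1) q1 t2" by (simp add: card_image[OF inj])
        then show ?thesis unfolding h' by (simp add: phi_def)
      qed
    qed
  qed
qed

theorem indep_card_bound:
  assumes "finite A" "indep A" "cl A = rect x1 x2 y1 y2" "x1 < x2" "y1 < y2"
  shows "6 * int (card A) \<le> (x2 - x1 + 3) * (y2 - y1 + 3)"
proof -
  have "finite A \<Longrightarrow> indep A \<Longrightarrow> thick_bounded A \<and> cornered A" for A
  proof (induction "card A" arbitrary: A rule: less_induct)
    case less
    then show ?case using thick_bounded_step[of A] cornered_step[of A] by blast
  qed
  then show ?thesis using thick_boundedD[of A] assms unfolding phi_def by blast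
qed

section \<open>Percolation on the grid\<close>

definition lattice_point :: "nat \<times> nat \<Rightarrow> int \<times> int" where
  "lattice_point p = (int (fst p), int (snd p))"

lemma inj_lattice_point: "inj lattice_point"
  by (auto simp: inj_def lattice_point_def prod_eq_iff)

lemma grid_adj_d1: "grid_adj u v \<longleftrightarrow> d1 (lattice_point u) (lattice_point v) = 1"
proof -
  obtain a b c d where uv: "u = (a, b)" "v = (c, d)" by fastforce
  have "(a = c \<and> (b = Suc d \<or> d = Suc b)) \<or> (b = d \<and> (a = Suc c \<or> c = Suc a)) \<longleftrightarrow>
    \<bar>int a - int c\<bar> + \<bar>int b - int d\<bar> = 1"
    by linarith
  then show ?thesis by (simp add: uv lattice_point_def grid_adj_iff)
qed

lemma lattice_point_grid_verts: "lattice_point ` grid_verts m n = rect 1 (int m) 1 (int n)"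
proof
  show "lattice_point ` grid_verts m n \<subseteq> rect 1 (int m) 1 (int n)"
    by (auto simp: lattice_point_def grid_verts_def)
  show "rect 1 (int m) 1 (int n) \<subseteq> lattice_point ` grid_verts m n"
  proof
    fix p assume p: "p \<in> rect 1 (int m) 1 (int n)"
    obtain x y where xy: "p = (x, y)" by fastforce
    then have "(nat x, nat y) \<in> grid_verts m n" "lattice_point (nat x, nat y) = p"
      using p by (auto simp: grid_verts_def lattice_point_def nat_le_iff le_nat_iff)
    then show "p \<in> lattice_point ` grid_verts m n" by (metis image_eqI)
  qed
qed

lemma infected_subset: "A \<subseteq> V \<Longrightarrow> infected V adj r A t \<subseteq> V"
  by (induction t) auto

lemma infected_mono: "s \<le> t \<Longrightarrow> infected V adj r A s \<subseteq> infected V adj r A t"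
  by (induction rule: dec_induct) auto

lemma infected_cl:
  assumes A: "A \<subseteq> grid_verts m n"
  shows "(\<Union>t. lattice_point ` infected (grid_verts m n) grid_adj 2 A t) = cl (lattice_point ` A)"
proof -
  let ?V = "grid_verts m n"
  let ?I = "infected ?V grid_adj 2 A"
  have fV: "finite ?V" by (simp add: grid_verts_def)
  have step: "lattice_point ` ?I t \<subseteq> cl (lattice_point ` A)" for t
  proof (induction t)
    case 0
    then show ?case using subset_cl by simp
  next
    case (Suc t)
    have "lattice_point v \<in> cl (lattice_point ` A)" if v: "2 \<le> card {u \<in> ?V. grid_adj v u \<and> u \<in> ?I t}" for v
    proof -
      have "\<not> card {u \<in> ?V. grid_adj v u \<and> u \<in> ?I t} \<le> Suc 0" using v by simp
      then obtain u w where uw: "u \<noteq> w" "grid_adj v u" "grid_adj v w" "u \<in> ?I t" "w \<in> ?I t"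
        using card_le_Suc0_iff_eq[of "{u \<in> ?V. grid_adj v u \<and> u \<in> ?I t}"] fV by auto
      show ?thesis
      proof (rule nclosedD[OF nclosed_cl])
        show "lattice_point u \<in> cl (lattice_point ` A)" "lattice_point w \<in> cl (lattice_point ` A)" using Suc uw by auto
        show "lattice_point u \<noteq> lattice_point w" using inj_lattice_point uw(1) by (simp add: inj_eq)
      qed (use uw in \<open>simp_all add: grid_adj_d1\<close>)
    qed
    then show ?case using Suc by auto
  qed
  have "nclosed (\<Union>t. lattice_point ` ?I t)"
    unfolding nclosed_def
  proof (intro allI impI)
    fix p u v
    assume a: "u \<in> (\<Union>t. lattice_point ` ?I t)" "v \<in> (\<Union>t. lattice_point ` ?I t)" "u \<noteq> v" "d1 p u = 1" "d1 p v = 1"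
    obtain s u' where u: "u = lattice_point u'" "u' \<in> ?I s" using a(1) by blast
    obtain t v' where v: "v = lattice_point v'" "v' \<in> ?I t" using a(2) by blast
    have uv: "u' \<in> ?I (max s t)" "v' \<in> ?I (max s t)"
      using subsetD[OF infected_mono u(2)] subsetD[OF infected_mono v(2)] by simp_all
    have uV: "u' \<in> ?V" "v' \<in> ?V" using uv infected_subset[OF A] by blast+
    then have "u \<in> rect 1 (int m) 1 (int n)" "v \<in> rect 1 (int m) 1 (int n)"
      using u v lattice_point_grid_verts by blast+
    then have "p \<in> rect 1 (int m) 1 (int n)" using a nclosedD[OF nclosed_rect] by blast
    then obtain p' where p: "p' \<in> ?V" "p = lattice_point p'" using lattice_point_grid_verts by blast
    have "{u', v'} \<subseteq> {x \<in> ?V. grid_adj p' x \<and> x \<in> ?I (max s t)}"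
      using uv uV a(4,5) u v p by (auto simp: grid_adj_d1)
    then have "card {u', v'} \<le> card {x \<in> ?V. grid_adj p' x \<and> x \<in> ?I (max s t)}"
      by (rule card_mono[rotated]) (use fV in auto)
    moreover have "u' \<noteq> v'" using a(3) u v by auto
    then have "card {u', v'} = 2" by simp
    ultimately have "p' \<in> ?I (Suc (max s t))" using p by simp
    then show "p \<in> (\<Union>t. lattice_point ` ?I t)" using p(2) by blast
  qed
  moreover have "lattice_point ` A \<subseteq> (\<Union>t. lattice_point ` ?I t)"
  proof -
    have "lattice_point ` ?I 0 \<subseteq> (\<Union>t. lattice_point ` ?I t)" by blast
    then show ?thesis by simp
  qed
  ultimately have "cl (lattice_point ` A) \<subseteq> (\<Union>t. lattice_point ` ?I t)" by (intro cl_least)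
  then show ?thesis using step by blast
qed

lemma percolates_iff:
  "percolates (grid_verts m n) grid_adj 2 A \<longleftrightarrow>
     A \<subseteq> grid_verts m n \<and> cl (lattice_point ` A) = rect 1 (int m) 1 (int n)"
proof (cases "A \<subseteq> grid_verts m n")
  case True
  let ?V = "grid_verts m n"
  let ?I = "infected ?V grid_adj 2 A"
  have "(\<forall>v\<in>?V. \<exists>t. v \<in> ?I t) \<longleftrightarrow> (\<forall>v\<in>?V. lattice_point v \<in> (\<Union>t. lattice_point ` ?I t))"
    using inj_lattice_point by (simp add: inj_image_mem_iff)
  also have "\<dots> \<longleftrightarrow> lattice_point ` ?V \<subseteq> cl (lattice_point ` A)" unfolding infected_cl[OF True] by blast
  also have "\<dots> \<longleftrightarrow> cl (lattice_point ` A) = rect 1 (int m) 1 (int n)"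
  proof -
    have "lattice_point ` A \<subseteq> rect 1 (int m) 1 (int n)" using True lattice_point_grid_verts by blast
    then have "cl (lattice_point ` A) \<subseteq> rect 1 (int m) 1 (int n)" by (intro cl_least nclosed_rect)
    then show ?thesis unfolding lattice_point_grid_verts by blast
  qed
  finally show ?thesis unfolding percolates_def using True by blast
qed (simp add: percolates_def)

lemma min_percolating_iff:
  "min_percolating (grid_verts m n) grid_adj 2 A \<longleftrightarrow>
     A \<subseteq> grid_verts m n \<and> cl (lattice_point ` A) = rect 1 (int m) 1 (int n) \<and> indep (lattice_point ` A)"
proof
  assume mp: "min_percolating (grid_verts m n) grid_adj 2 A"
  then have A: "A \<subseteq> grid_verts m n" "cl (lattice_point ` A) = rect 1 (int m) 1 (int n)"
    unfolding min_percolating_def percolates_iff by blast+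
  have "lattice_point v \<notin> cl (lattice_point ` A - {lattice_point v})" if v: "v \<in> A" for v
  proof
    assume c: "lattice_point v \<in> cl (lattice_point ` A - {lattice_point v})"
    have e: "lattice_point ` A - {lattice_point v} = lattice_point ` (A - {v})" using inj_lattice_point by (auto simp: inj_eq)
    have "lattice_point ` A \<subseteq> cl (lattice_point ` (A - {v}))"
    proof (rule image_subsetI)
      fix a assume "a \<in> A"
      then show "lattice_point a \<in> cl (lattice_point ` (A - {v}))"
        using c e subset_cl[of "lattice_point ` (A - {v})"] by (cases "a = v") auto
    qed
    then have "cl (lattice_point ` A) \<subseteq> cl (lattice_point ` (A - {v}))" by (rule cl_subset_cl)
    moreover have "cl (lattice_point ` (A - {v})) \<subseteq> cl (lattice_point ` A)" by (intro cl_mono) auto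
    ultimately have "percolates (grid_verts m n) grid_adj 2 (A - {v})"
      unfolding percolates_iff using A by auto
    moreover have "A - {v} \<subset> A" using v by blast
    ultimately show False using mp unfolding min_percolating_def by blast
  qed
  then show "A \<subseteq> grid_verts m n \<and> cl (lattice_point ` A) = rect 1 (int m) 1 (int n) \<and> indep (lattice_point ` A)"
    using A unfolding indep_def by blast
next
  assume A: "A \<subseteq> grid_verts m n \<and> cl (lattice_point ` A) = rect 1 (int m) 1 (int n) \<and> indep (lattice_point ` A)"
  have "\<not> percolates (grid_verts m n) grid_adj 2 B" if B: "B \<subset> A" for B
  proof
    assume "percolates (grid_verts m n) grid_adj 2 B"
    then have cB: "cl (lattice_point ` B) = rect 1 (int m) 1 (int n)" unfolding percolates_iff by blast
    obtain v where v: "v \<in> A" "v \<notin> B" using B by blast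
    have "lattice_point v \<notin> cl (lattice_point ` B)"
      by (rule indepD[of "lattice_point ` A"]) (use A v B inj_lattice_point in \<open>auto simp: inj_image_mem_iff\<close>)
    moreover have "lattice_point v \<in> rect 1 (int m) 1 (int n)" using v A lattice_point_grid_verts by blast
    ultimately show False using cB by simp
  qed
  then show "min_percolating (grid_verts m n) grid_adj 2 A"
    unfolding min_percolating_def using A percolates_iff by blast
qed

lemma max_min_percolating_le:
  assumes "2 \<le> m" "2 \<le> n"
  shows "6 * max_min_percolating m n \<le> (m + 2) * (n + 2)"
proof -
  obtain A where A: "min_percolating (grid_verts m n) grid_adj 2 A" "card A = max_min_percolating m n"
    using max_min_percolating_attained by blast
  then have a: "A \<subseteq> grid_verts m n" "cl (lattice_point ` A) = rect 1 (int m) 1 (int n)" "indep (lattice_point ` A)"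
    unfolding min_percolating_iff by blast+
  have "finite A" using a(1) finite_subset by (fastforce simp: grid_verts_def)
  then have "6 * int (card (lattice_point ` A)) \<le> (int m - 1 + 3) * (int n - 1 + 3)"
    using indep_card_bound[OF _ a(3,2)] assms by simp
  moreover have "card (lattice_point ` A) = card A" 
    by (rule card_image[OF inj_on_subset[OF inj_lattice_point]]) simp
  ultimately have "int (6 * max_min_percolating m n) \<le> int ((m + 2) * (n + 2))" using A(2) by (simp add: algebra_simps)
  then show ?thesis by (simp only: of_nat_le_iff)
qed

lemma indep_card_le_max_min_percolating:
  assumes S: "cl S = rect 1 (int m) 1 (int n)" "indep S"
  shows "card S \<le> max_min_percolating m n"
proof -
  define A where "A = {v \<in> grid_verts m n. lattice_point v \<in> S}"
  have "S \<subseteq> lattice_point ` grid_verts m n" using subset_cl[of S] S(1) lattice_point_grid_verts by simp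
  then have e: "lattice_point ` A = S" unfolding A_def by blast
  have "min_percolating (grid_verts m n) grid_adj 2 A"
    unfolding min_percolating_iff e using S by (auto simp: A_def)
  then have "card A \<le> max_min_percolating m n" by (rule max_min_percolating_upper)
  moreover have "card (lattice_point ` A) = card A" 
    by (rule card_image[OF inj_on_subset[OF inj_lattice_point]]) simp
  ultimately show ?thesis using e by simp
qed

lemma max_min_percolating_ge:
  "4 * real m * real n / 33 - 5 * real (max m n) \<le> real (max_min_percolating m n)"
proof -
  consider "m < 40 \<or> n < 40" | "40 \<le> m" "m \<le> n" | "40 \<le> n" "n \<le> m" by linarith
  then show ?thesis
  proof cases
    case 1
    then have "real m * real n \<le> 40 * real (max m n)"
    proof
      assume "m < 40"
      then show ?thesis by (intro mult_mono) auto
    next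
      assume "n < 40"
      then have "real n * real m \<le> 40 * real (max m n)" by (intro mult_mono) auto
      then show ?thesis by (simp add: mult.commute)
    qed
    then have "4 * real m * real n / 33 \<le> 5 * real (max m n)" by simp
    then show ?thesis by (simp add: order_trans[of _ 0])
  next
    case 2
    obtain S where S: "indep S" "cl S = rect 1 (int m) 1 (int n)" "4 * real m * real n / 33 - 5 * real n \<le> real (card S)"
      using large_minimal_set[OF 2(2,1)] by blast
    then show ?thesis using indep_card_le_max_min_percolating[OF S(2,1)] 2 by simp
  next
    case 3
    obtain S where S: "indep S" "cl S = rect 1 (int n) 1 (int m)" "4 * real n * real m / 33 - 5 * real m \<le> real (card S)"
      using large_minimal_set[OF 3(2,1)] by blast
    have "card (prod.swap ` S) \<le> max_min_percolating m n"
      by (rule indep_card_le_max_min_percolating) (use S in \<open>simp_all add: swap_facts\<close>)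
    then have "card S \<le> max_min_percolating m n" by (simp add: card_image)
    moreover have "4 * real m * real n / 33 = 4 * real n * real m / 33" by simp
    moreover have "max m n = m" using 3 by simp
    ultimately show ?thesis using S(3) by linarith
  qed
qed

theorem theorem1p1:
  shows "(\<exists>C::real. C > 0 \<and>
            (\<forall>m n :: nat. m \<ge> 2 \<longrightarrow> n \<ge> 2 \<longrightarrow>
               4 * real m * real n / 33
                   - C * (real m powr (3 / 2) + real n * sqrt (real m))
                 \<le> real (max_min_percolating m n) \<and>
               real (max_min_percolating m n) \<le> (real m + 2) * (real n + 2) / 6))
       \<and> (\<exists>f :: nat \<Rightarrow> real. f \<in> o(\<lambda>n. (real n)\<^sup>2) \<and>
            (\<forall>n::nat. n \<ge> 2 \<longrightarrow>
               4 * (real n)\<^sup>2 / 33 + f n \<le> real (max_min_percolating n n) \<and>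
               real (max_min_percolating n n) \<le> (real n + 2)\<^sup>2 / 6))"
proof -
  have upper: "real (max_min_percolating m n) \<le> (real m + 2) * (real n + 2) / 6" if "2 \<le> m" "2 \<le> n" for m n
  proof -
    have "real (6 * max_min_percolating m n) \<le> real ((m + 2) * (n + 2))"
      using max_min_percolating_le[OF that] by (rule of_nat_mono)
    then have "6 * real (max_min_percolating m n) \<le> (real m + 2) * (real n + 2)"
      by (simp only: of_nat_mult of_nat_add of_nat_numeral)
    then show ?thesis by simp
  qed
  have lower: "4 * real m * real n / 33 - 5 * (real m powr (3 / 2) + real n * sqrt (real m))
      \<le> real (max_min_percolating m n)" if m: "2 \<le> m" for m n
  proof -
    have "real m powr 1 \<le> real m powr (3 / 2)" using m by (intro powr_mono) auto
    then have "real m \<le> real m powr (3 / 2)" using m by simp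
    moreover have "real n * 1 \<le> real n * sqrt (real m)" using m by (intro mult_left_mono) auto
    moreover have "0 \<le> real n * sqrt (real m)" "0 \<le> real m powr (3 / 2)" by auto
    ultimately have "real (max m n) \<le> real m powr (3 / 2) + real n * sqrt (real m)"
      by (simp add: max_def)
    then have "5 * real (max m n) \<le> 5 * (real m powr (3 / 2) + real n * sqrt (real m))"
      by (intro mult_left_mono) auto
    then have "4 * real m * real n / 33 - 5 * (real m powr (3 / 2) + real n * sqrt (real m))
        \<le> 4 * real m * real n / 33 - 5 * real (max m n)"
      by (rule diff_left_mono)
    then show ?thesis using max_min_percolating_ge[of m n] by (rule order_trans)
  qed
  have "(\<lambda>n. - 5 * real n) \<in> o(\<lambda>n. (real n)\<^sup>2)" by real_asymp
  moreover have "4 * (real n)\<^sup>2 / 33 + - 5 * real n \<le> real (max_min_percolating n n) \<and>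
      real (max_min_percolating n n) \<le> (real n + 2)\<^sup>2 / 6" if "2 \<le> n" for n
    using max_min_percolating_ge[of n n] upper[OF that that] by (simp add: power2_eq_square mult.assoc)
  ultimately have "\<exists>f :: nat \<Rightarrow> real. f \<in> o(\<lambda>n. (real n)\<^sup>2) \<and>
            (\<forall>n::nat. n \<ge> 2 \<longrightarrow>
               4 * (real n)\<^sup>2 / 33 + f n \<le> real (max_min_percolating n n) \<and>
               real (max_min_percolating n n) \<le> (real n + 2)\<^sup>2 / 6)"
    by (intro exI[of _ "\<lambda>n. - 5 * real n"]) blast
  moreover have "\<exists>C::real. C > 0 \<and>
            (\<forall>m n :: nat. m \<ge> 2 \<longrightarrow> n \<ge> 2 \<longrightarrow>
               4 * real m * real n / 33
                   - C * (real m powr (3 / 2) + real n * sqrt (real m))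
                 \<le> real (max_min_percolating m n) \<and>
               real (max_min_percolating m n) \<le> (real m + 2) * (real n + 2) / 6)"
    using upper lower by (intro exI[of _ 5]) auto
  ultimately show ?thesis by blast
qed

end
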